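(* The pseudohyperbolic metric ${\bf d}:[B(\mathcal H)^n]_1\times[B(\mathcal H)^n]_1\to[0,\infty)$ has the following properties: (i) for any $X,Y\in[B(\mathcal H)^n]_1$, ${\bf d}(X,Y)=\tanh\delta(X,Y)$; (ii) ${\bf d}|_{\mathbb B_n\times\mathbb B_n}$ coincides with the pseudohyperbolic distance on $\mathbb B_n$, i.e., $${\bf d}(z,w)=\|\psi_z(w)\|_2,\qquad z,w\in\mathbb B_n,$$ where $\psi_z$ is the involutive automorphism of $\mathbb B_n$ that interchanges $0$ and $z$; (iii) the ${\bf d}$-topology coincides with the norm topology on the open unit ball $[B(\mathcal H)^n]_1$; (iv) for any $X,Y\in[B(\mathcal H)^n]_1$, $${\bf d}(X,Y)=\frac{\max\{\|\Gamma\|,\|\Gamma^{-1}\|\}-1}{\max\{\|\Gamma\|,\|\Gamma^{-1}\|\}+1},$$ where $\Gamma:=(C_XC_Y^{-1})^*(C_XC_Y^{-1})$, $C_X:=(\Delta_X\otimes I)(I-R_X)^{-1}$, and $R_X:=X_1^*\otimes R_1+\cdots+X_n^*\otimes R_n$ is the reconstruction operator.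
   Context: $\mathcal H$ is a separable infinite dimensional Hilbert space. For $X=(X_1,\dots,X_n)\in B(\mathcal H)^n$, $\|X\|=\|\sum_iX_iX_i^*\|^{1/2}$, $[B(\mathcal H)^n]_1=\{X:\|X\|<1\}$, $[B(\mathcal H)^n]_1^-=\{X:\|X\|\le1\}$. $\mathbb B_n$ is the open Euclidean unit ball of $\mathbb C^n$; $z\in\mathbb B_n$ is identified with $(z_1I_{\mathcal H},\dots,z_nI_{\mathcal H})\in[B(\mathcal H)^n]_1$. For $A,B\in[B(\mathcal H)^n]_1^-$ and $c\ge1$, write $A\overset{H}{\underset{c}\sim}B$ if $$\frac1{c^2}\Re p(B_1,\dots,B_n)\le\Re p(A_1,\dots,A_n)\le c^2\,\Re p(B_1,\dots,B_n)$$ for every noncommutative polynomial $p\in\mathbb C[X_1,\dots,X_n]\otimes M_{m\times m}$, $m\in\mathbb N$, such that $\Re p\ge0$ (i.e. $\Re p(X)=\frac12(p(X)+p(X)^* )\ge0$ for all $X\in[B(\mathcal H)^n]_1$). $A,B$ are Harnack equivalent if this holds for some $c\ge1$; the equivalence classes are called Harnack parts. The open ball $[B(\mathcal H)^n]_1$ is the Harnack part of $0$. For $A,B$ in the same Harnack part, $$\omega(A,B)=\inf\{c\ge1:\ A\overset{H}{\underset{c}\sim}B\},\quad \delta(A,B)=\ln\omega(A,B),\quad {\bf d}(A,B)=\frac{\omega(A,B)^2-1}{\omega(A,B)^2+1}.$$ For $z\in\mathbb B_n$, $\psi_z$ is the standard involutive biholomorphic automorphism of $\mathbb B_n$ with $\psi_z(0)=z$,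 $\psi_z(z)=0$ (equivalently $1-\|\psi_z(w)\|_2^2=\frac{(1-\|z\|_2^2)(1-\|w\|_2^2)}{|1-\langle w,z\rangle|^2}$). $R_i\varphi=\varphi\otimes e_i$ ($i=1,\dots,n$) are the right creation operators on the full Fock space $F^2(H_n)=\mathbb C1\oplus\bigoplus_{k\ge1}H_n^{\otimes k}$, $e_1,\dots,e_n$ being an orthonormal basis of the $n$-dimensional Hilbert space $H_n$; $\Delta_X=(I-\sum_iX_iX_i^* )^{1/2}$; $C_X$ acts on $\mathcal H\otimes F^2(H_n)$. *)

theory Defs
  imports "HOL-Analysis.Analysis" "HOL-Library.Poly_Mapping"
begin

section \<open>Complex Hilbert spaces\<close>

class complex_vector = real_vector +
  fixes scaleC :: "complex \<Rightarrow> 'a \<Rightarrow> 'a"  (infixr "*\<^sub>C" 75)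
  assumes scaleC_add_right: "a *\<^sub>C (x + y) = a *\<^sub>C x + a *\<^sub>C y"
    and scaleC_add_left: "(a + b) *\<^sub>C x = a *\<^sub>C x + b *\<^sub>C x"
    and scaleC_scaleC: "a *\<^sub>C b *\<^sub>C x = (a * b) *\<^sub>C x"
    and scaleR_scaleC: "r *\<^sub>R x = complex_of_real r *\<^sub>C x"

lemma scaleC_one [simp]: "1 *\<^sub>C x = x" for x :: "'a::complex_vector"
  using scaleR_scaleC[of 1 x] by simp

global_interpretation complex_vs: vector_space "scaleC :: complex \<Rightarrow> 'a \<Rightarrow> 'a::complex_vector"
  defines cspan = complex_vs.span
  by unfold_locales (simp_all add: scaleC_add_right scaleC_add_left scaleC_scaleC)

text \<open>The inner product is linear in the first argument and conjugate-linear in the second.\<close>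

class chilbert_space = complex_vector + real_inner + complete_space +
  fixes cinner :: "'a \<Rightarrow> 'a \<Rightarrow> complex"
  assumes cinner_commute: "cinner x y = cnj (cinner y x)"
    and cinner_add_left: "cinner (x + y) z = cinner x z + cinner y z"
    and cinner_scaleC_left: "cinner (a *\<^sub>C x) y = a * cinner x y"
    and Re_cinner: "Re (cinner x y) = x \<bullet> y"

instance chilbert_space \<subseteq> banach ..

lemma cinner_scaleC_right: "cinner x (a *\<^sub>C y) = cnj a * cinner x y"
  for x y :: "'a::chilbert_space"
  by (metis cinner_commute cinner_scaleC_left complex_cnj_cnj complex_cnj_mult)

lemma cinner_add_right: "cinner x (y + z) = cinner x y + cinner x z"
  for x y :: "'a::chilbert_space"
  by (metis cinner_commute cinner_add_left complex_cnj_add)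

lemma cinner_zero_left [simp]: "cinner 0 y = 0" for y :: "'a::chilbert_space"
  using cinner_scaleC_left[of 0 0 y] by simp

lemma cinner_zero_right [simp]: "cinner y 0 = 0" for y :: "'a::chilbert_space"
  by (metis cinner_commute cinner_zero_left complex_cnj_zero)

lemma cinner_minus_left: "cinner (- x) y = - cinner x y" for y :: "'a::chilbert_space"
  using cinner_add_left[of "- x" x y] by (simp add: eq_neg_iff_add_eq_0)

lemma cinner_minus_right: "cinner x (- y) = - cinner x y" for y :: "'a::chilbert_space"
  using cinner_add_right[of x "- y" y] by (simp add: eq_neg_iff_add_eq_0)

lemma cinner_diff_left: "cinner (x - z) y = cinner x y - cinner z y"
  for y :: "'a::chilbert_space"
  using cinner_add_left[of x "- z" y] by (simp add: cinner_minus_left)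

lemma cinner_diff_right: "cinner y (x - z) = cinner y x - cinner y z"
  for y :: "'a::chilbert_space"
  using cinner_add_right[of y x "- z"] by (simp add: cinner_minus_right)

lemma cinner_self: "cinner x x = complex_of_real ((norm x)\<^sup>2)" for x :: "'a::chilbert_space"
proof (rule complex_eqI)
  show "Re (cinner x x) = Re (complex_of_real ((norm x)\<^sup>2))"
    by (simp add: Re_cinner power2_norm_eq_inner)
  have "Im (cinner x x) = - Im (cinner x x)"
    by (metis cinner_commute cnj.simps(2))
  then show "Im (cinner x x) = Im (complex_of_real ((norm x)\<^sup>2))"
    by simp
qed

lemma norm_scaleC: "norm (a *\<^sub>C x) = cmod a * norm x" for x :: "'a::chilbert_space"
proof -
  have "cinner (a *\<^sub>C x) (a *\<^sub>C x) = (a * cnj a) * cinner x x"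
    by (simp add: cinner_scaleC_left cinner_scaleC_right mult.assoc)
  then have "complex_of_real ((norm (a *\<^sub>C x))\<^sup>2) = complex_of_real ((cmod a)\<^sup>2 * (norm x)\<^sup>2)"
    by (simp only: cinner_self complex_norm_square[symmetric] of_real_mult)
  then have "(norm (a *\<^sub>C x))\<^sup>2 = (cmod a * norm x)\<^sup>2"
    by (simp only: of_real_eq_iff power_mult_distrib)
  then show ?thesis
    by (simp add: power2_eq_iff_nonneg)
qed

lemma bounded_linear_scaleC: "bounded_linear (\<lambda>x::'a::chilbert_space. a *\<^sub>C x)"
proof (rule bounded_linear_intro[where K = "cmod a"])
  fix x y :: 'a and r :: real
  show "a *\<^sub>C (x + y) = a *\<^sub>C x + a *\<^sub>C y"
    by (rule scaleC_add_right)
  show "a *\<^sub>C r *\<^sub>R x = r *\<^sub>R a *\<^sub>C x"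
    by (simp add: scaleR_scaleC scaleC_scaleC mult.commute)
  show "norm (a *\<^sub>C x) \<le> norm x * cmod a"
    by (simp add: norm_scaleC mult.commute)
qed

lemma norm_cinner_le: "cmod (cinner x y) \<le> norm x * norm y" for x y :: "'a::chilbert_space"
proof (cases "cinner x y = 0")
  case False
  define u where "u = cnj (cinner x y) / cmod (cinner x y)"
  have u: "cmod u = 1"
    using False by (simp add: u_def norm_divide)
  have "cinner (u *\<^sub>C x) y = cmod (cinner x y)"
    using False by (simp add: cinner_scaleC_left u_def divide_simps power2_eq_square
        complex_norm_square[symmetric, unfolded power2_eq_square] mult.commute)
  then have "cmod (cinner x y) = (u *\<^sub>C x) \<bullet> y"
    by (metis Re_cinner Re_complex_of_real)
  also have "\<dots> \<le> norm (u *\<^sub>C x) * norm y"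
    by (rule norm_cauchy_schwarz)
  finally show ?thesis
    by (simp add: norm_scaleC u)
qed simp

instantiation complex :: chilbert_space
begin
definition "scaleC_complex = ((*) :: complex \<Rightarrow> complex \<Rightarrow> complex)"
definition "cinner_complex x y = x * cnj (y :: complex)"
instance
  by standard (auto simp: scaleC_complex_def cinner_complex_def algebra_simps scaleR_conv_of_real
      inner_complex_def)
end

instantiation vec :: (chilbert_space, finite) chilbert_space
begin
definition "scaleC_vec a x = (\<chi> i. a *\<^sub>C (x $ i))"
definition "cinner_vec x y = (\<Sum>i\<in>UNIV. cinner (x $ i) (y $ i))"
instance
proof
  fix x y z :: "('a, 'b) vec" and a b :: complex and r :: real
  show "a *\<^sub>C (x + y) = a *\<^sub>C x + a *\<^sub>C y"
    by (simp add: scaleC_vec_def vec_eq_iff scaleC_add_right)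
  show "(a + b) *\<^sub>C x = a *\<^sub>C x + b *\<^sub>C x"
    by (simp add: scaleC_vec_def vec_eq_iff scaleC_add_left)
  show "a *\<^sub>C b *\<^sub>C x = (a * b) *\<^sub>C x"
    by (simp add: scaleC_vec_def vec_eq_iff scaleC_scaleC)
  show "r *\<^sub>R x = complex_of_real r *\<^sub>C x"
    by (simp add: scaleC_vec_def vec_eq_iff scaleR_scaleC)
  show "cinner x y = cnj (cinner y x)"
    unfolding cinner_vec_def cnj_sum by (intro sum.cong refl cinner_commute)
  show "cinner (x + y) z = cinner x z + cinner y z"
    by (simp add: cinner_vec_def cinner_add_left sum.distrib)
  show "cinner (a *\<^sub>C x) y = a * cinner x y"
    by (simp add: cinner_vec_def scaleC_vec_def cinner_scaleC_left sum_distrib_left)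
  show "Re (cinner x y) = x \<bullet> y"
    by (simp add: cinner_vec_def inner_vec_def Re_cinner)
qed
end


section \<open>Hilbert space direct sums of copies of a Hilbert space\<close>

typedef (overloaded) ('i, 'a::chilbert_space) ell2 =
    "{f :: 'i \<Rightarrow> 'a. (\<lambda>i. (norm (f i))\<^sup>2) summable_on UNIV}"
  morphisms coord Abs_ell2
  by (rule exI[of _ "\<lambda>_. 0"]) simp

setup_lifting type_definition_ell2

lemma coord_summable: "(\<lambda>i. (norm (coord f i))\<^sup>2) summable_on UNIV"
  using coord[of f] by simp

lemma ell2_eqI: "(\<And>i. coord f i = coord g i) \<Longrightarrow> f = g"
  using coord_inject by blast

lemma square_summable_add:
  fixes f g :: "'i \<Rightarrow> 'a::chilbert_space"
  assumes "(\<lambda>i. (norm (f i))\<^sup>2) summable_on UNIV" "(\<lambda>i. (norm (g i))\<^sup>2) summable_on UNIV"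
  shows "(\<lambda>i. (norm (f i + g i))\<^sup>2) summable_on UNIV"
proof (rule summable_on_comparison_test)
  show "(\<lambda>i. 2 * ((norm (f i))\<^sup>2 + (norm (g i))\<^sup>2)) summable_on UNIV"
    by (intro summable_on_cmult_right summable_on_add assms)
  show "(norm (f i + g i))\<^sup>2 \<le> 2 * ((norm (f i))\<^sup>2 + (norm (g i))\<^sup>2)" for i
  proof -
    have "(norm (f i + g i))\<^sup>2 \<le> (norm (f i) + norm (g i))\<^sup>2"
      by (intro power_mono norm_triangle_ineq norm_ge_zero)
    also have "\<dots> \<le> 2 * ((norm (f i))\<^sup>2 + (norm (g i))\<^sup>2)"
      using sum_squares_bound[of "norm (f i)" "norm (g i)"] by (simp add: power2_sum)
    finally show ?thesis .
  qed
qed simp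

lemma square_summable_scaleC:
  fixes f :: "'i \<Rightarrow> 'a::chilbert_space"
  assumes "(\<lambda>i. (norm (f i))\<^sup>2) summable_on UNIV"
  shows "(\<lambda>i. (norm (a *\<^sub>C f i))\<^sup>2) summable_on UNIV"
  by (simp add: norm_scaleC power_mult_distrib summable_on_cmult_right assms)

lemma summable_cinner:
  fixes f g :: "'i \<Rightarrow> 'a::chilbert_space"
  assumes "(\<lambda>i. (norm (f i))\<^sup>2) summable_on UNIV" "(\<lambda>i. (norm (g i))\<^sup>2) summable_on UNIV"
  shows "(\<lambda>i. cinner (f i) (g i)) summable_on UNIV"
proof -
  have "(\<lambda>i. cmod (cinner (f i) (g i))) summable_on UNIV"
  proof (rule summable_on_comparison_test)
    show "(\<lambda>i. (norm (f i))\<^sup>2 + (norm (g i))\<^sup>2) summable_on UNIV"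
      by (intro summable_on_add assms)
    show "cmod (cinner (f i) (g i)) \<le> (norm (f i))\<^sup>2 + (norm (g i))\<^sup>2" for i
    proof -
      have "0 \<le> norm (f i) * norm (g i)"
        by simp
      moreover have "2 * (norm (f i) * norm (g i)) \<le> (norm (f i))\<^sup>2 + (norm (g i))\<^sup>2"
        using sum_squares_bound[of "norm (f i)" "norm (g i)"] by (simp add: mult.assoc)
      ultimately show ?thesis
        using norm_cinner_le[of "f i" "g i"] by linarith
    qed
  qed simp
  then show ?thesis
    by (rule abs_summable_summable)
qed

instantiation ell2 :: (type, chilbert_space) complex_vector
begin
lift_definition zero_ell2 :: "('a, 'b) ell2" is "\<lambda>_. 0" by simp
lift_definition plus_ell2 :: "('a, 'b) ell2 \<Rightarrow> ('a, 'b) ell2 \<Rightarrow> ('a, 'b) ell2"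
  is "\<lambda>f g i. f i + g i" by (simp add: square_summable_add)
lift_definition uminus_ell2 :: "('a, 'b) ell2 \<Rightarrow> ('a, 'b) ell2" is "\<lambda>f i. - f i" by simp
definition minus_ell2 :: "('a, 'b) ell2 \<Rightarrow> ('a, 'b) ell2 \<Rightarrow> ('a, 'b) ell2"
  where "minus_ell2 f g = f + - g"
lift_definition scaleC_ell2 :: "complex \<Rightarrow> ('a, 'b) ell2 \<Rightarrow> ('a, 'b) ell2"
  is "\<lambda>a f i. a *\<^sub>C f i" by (simp add: square_summable_scaleC)
definition scaleR_ell2 :: "real \<Rightarrow> ('a, 'b) ell2 \<Rightarrow> ('a, 'b) ell2"
  where "scaleR_ell2 r f = complex_of_real r *\<^sub>C f"
instance
proof
  fix f g h :: "('a, 'b) ell2" and a b :: complex and r s :: real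
  show "f + g + h = f + (g + h)" by transfer (simp add: add.assoc)
  show "f + g = g + f" by transfer (simp add: add.commute)
  show "0 + f = f" by transfer simp
  show "- f + f = 0" by transfer simp
  show "f - g = f + - g" by (simp add: minus_ell2_def)
  show "a *\<^sub>C (f + g) = a *\<^sub>C f + a *\<^sub>C g" by transfer (simp add: scaleC_add_right)
  show "(a + b) *\<^sub>C f = a *\<^sub>C f + b *\<^sub>C f" by transfer (simp add: scaleC_add_left)
  show "a *\<^sub>C b *\<^sub>C f = (a * b) *\<^sub>C f" by transfer (simp add: scaleC_scaleC)
  show "r *\<^sub>R f = complex_of_real r *\<^sub>C f" by (simp add: scaleR_ell2_def)
  show "r *\<^sub>R (f + g) = r *\<^sub>R f + r *\<^sub>R g"
    unfolding scaleR_ell2_def by transfer (simp add: scaleC_add_right)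
  show "(r + s) *\<^sub>R f = r *\<^sub>R f + s *\<^sub>R f"
    unfolding scaleR_ell2_def by transfer (simp add: scaleC_add_left)
  show "r *\<^sub>R s *\<^sub>R f = (r * s) *\<^sub>R f"
    unfolding scaleR_ell2_def by transfer (simp add: scaleC_scaleC)
  show "1 *\<^sub>R f = f"
    unfolding scaleR_ell2_def by transfer simp
qed
end

lemma coord_simps [simp]:
  "coord 0 i = 0" "coord (f + g) i = coord f i + coord g i" "coord (- f) i = - coord f i"
  "coord (f - g) i = coord f i - coord g i" "coord (a *\<^sub>C f) i = a *\<^sub>C coord f i"
  "coord (r *\<^sub>R f) i = r *\<^sub>R coord f i"
proof -
  show add: "coord (f + g) i = coord f i + coord g i" for f g
    by (simp add: plus_ell2.rep_eq)
  show minus: "coord (- f) i = - coord f i" for f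
    by (simp add: uminus_ell2.rep_eq)
  show "coord (f - g) i = coord f i - coord g i"
    unfolding minus_ell2_def add minus by simp
qed (simp_all add: zero_ell2.rep_eq scaleC_ell2.rep_eq scaleR_ell2_def scaleR_scaleC)

instantiation ell2 :: (type, chilbert_space) real_inner
begin
definition inner_ell2 :: "('a, 'b) ell2 \<Rightarrow> ('a, 'b) ell2 \<Rightarrow> real"
  where "inner_ell2 f g = Re (\<Sum>\<^sub>\<infinity>i. cinner (coord f i) (coord g i))"
definition norm_ell2 :: "('a, 'b) ell2 \<Rightarrow> real"
  where "norm_ell2 f = sqrt (inner f f)"
definition sgn_ell2 :: "('a, 'b) ell2 \<Rightarrow> ('a, 'b) ell2"
  where "sgn_ell2 f = f /\<^sub>R norm f"
definition dist_ell2 :: "('a, 'b) ell2 \<Rightarrow> ('a, 'b) ell2 \<Rightarrow> real"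
  where "dist_ell2 f g = norm (f - g)"
definition uniformity_ell2 :: "(('a, 'b) ell2 \<times> ('a, 'b) ell2) filter"
  where "uniformity_ell2 = (INF e\<in>{0<..}. principal {(x, y). dist x y < e})"
definition open_ell2 :: "('a, 'b) ell2 set \<Rightarrow> bool"
  where "open_ell2 U \<longleftrightarrow> (\<forall>x\<in>U. eventually (\<lambda>(x', y). x' = x \<longrightarrow> y \<in> U) uniformity)"
instance
proof
  fix f g h :: "('a, 'b) ell2" and r :: real and U :: "('a, 'b) ell2 set"
  note summ = summable_cinner[OF coord_summable coord_summable]
  have self: "inner k k = (\<Sum>\<^sub>\<infinity>i. (norm (coord k i))\<^sup>2)" for k :: "('a, 'b) ell2"
    unfolding inner_ell2_def infsum_Re[OF summ, symmetric] by (simp add: cinner_self)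
  show "dist f g = norm (f - g)" by (rule dist_ell2_def)
  show "sgn f = f /\<^sub>R norm f" by (rule sgn_ell2_def)
  show "uniformity = (INF e\<in>{0<..}. principal {(x, y :: ('a, 'b) ell2). dist x y < e})"
    by (rule uniformity_ell2_def)
  show "open U \<longleftrightarrow> (\<forall>x\<in>U. eventually (\<lambda>(x', y). x' = x \<longrightarrow> y \<in> U) uniformity)"
    by (rule open_ell2_def)
  show "inner f g = inner g f"
    unfolding inner_ell2_def infsum_Re[OF summ, symmetric] Re_cinner by (simp add: inner_commute)
  show "inner (f + g) h = inner f h + inner g h"
    unfolding inner_ell2_def by (simp add: cinner_add_left infsum_add summ)
  show "inner (r *\<^sub>R f) g = r * inner f g"
    unfolding inner_ell2_def
    by (simp add: scaleR_scaleC cinner_scaleC_left infsum_cmult_right')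
  show "0 \<le> inner f f"
    unfolding self by (rule infsum_nonneg) simp
  show "inner f f = 0 \<longleftrightarrow> f = 0"
  proof
    assume "inner f f = 0"
    then have "(norm (coord f i))\<^sup>2 = 0" for i
      unfolding self by (intro nonneg_infsum_le_0D[OF _ coord_summable]) auto
    then show "f = 0"
      by (intro ell2_eqI) simp
  qed (simp add: self)
  show "norm f = sqrt (inner f f)" by (rule norm_ell2_def)
qed
end

lemma norm_ell2_squared: "(norm f)\<^sup>2 = (\<Sum>\<^sub>\<infinity>i. (norm (coord f i))\<^sup>2)"
  unfolding power2_norm_eq_inner inner_ell2_def
    infsum_Re[OF summable_cinner[OF coord_summable coord_summable], symmetric]
  by (simp add: Re_cinner)

lemma sum_coord_le: "finite F \<Longrightarrow> (\<Sum>i\<in>F. (norm (coord f i))\<^sup>2) \<le> (norm f)\<^sup>2"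
  unfolding norm_ell2_squared by (rule finite_sum_le_infsum[OF coord_summable]) auto

lemma norm_coord_le: "norm (coord f i) \<le> norm f"
  using sum_coord_le[of "{i}" f] by (simp add: power2_le_iff_abs_le)

lemma ell2_limit:
  fixes L :: "'i \<Rightarrow> 'a::chilbert_space"
  assumes "\<And>F. finite F \<Longrightarrow> (\<Sum>i\<in>F. (norm (L i))\<^sup>2) \<le> e\<^sup>2" and "0 \<le> e"
  shows "(\<lambda>i. (norm (L i))\<^sup>2) summable_on UNIV" and "norm (Abs_ell2 L) \<le> e"
proof -
  show s: "(\<lambda>i. (norm (L i))\<^sup>2) summable_on UNIV"
    by (rule nonneg_bdd_above_summable_on) (auto intro!: bdd_aboveI2 assms)
  then have "(norm (Abs_ell2 L))\<^sup>2 \<le> e\<^sup>2"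
    unfolding norm_ell2_squared
    by (intro infsum_le_finite_sums) (simp_all add: Abs_ell2_inverse assms)
  then show "norm (Abs_ell2 L) \<le> e"
    using assms(2) power2_le_imp_le by blast
qed

instance ell2 :: (type, chilbert_space) complete_space
proof
  fix X :: "nat \<Rightarrow> ('a, 'b) ell2"
  assume X: "Cauchy X"
  have "Cauchy (\<lambda>n. coord (X n) i)" for i
  proof (rule CauchyI)
    fix e :: real assume "0 < e"
    then obtain M where "\<forall>m\<ge>M. \<forall>n\<ge>M. norm (X m - X n) < e"
      using X CauchyD by blast
    then show "\<exists>M. \<forall>m\<ge>M. \<forall>n\<ge>M. norm (coord (X m) i - coord (X n) i) < e"
      by (metis coord_simps(4) norm_coord_le order_le_less_trans)
  qed
  then have "\<forall>i. \<exists>l. (\<lambda>n. coord (X n) i) \<longlonglongrightarrow> l"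
    using Cauchy_convergent unfolding convergent_def by blast
  then obtain L where L: "\<And>i. (\<lambda>n. coord (X n) i) \<longlonglongrightarrow> L i"
    using choice[of "\<lambda>i l. (\<lambda>n. coord (X n) i) \<longlonglongrightarrow> l"] by blast
  have key: "(\<Sum>i\<in>F. (norm (L i - coord (X n) i))\<^sup>2) \<le> e\<^sup>2"
    if M: "\<forall>m\<ge>M. \<forall>n\<ge>M. norm (X m - X n) < e" and "n \<ge> M" "finite F" for e M n F
  proof (rule LIMSEQ_le_const2)
    show "(\<lambda>m. \<Sum>i\<in>F. (norm (coord (X m) i - coord (X n) i))\<^sup>2)
      \<longlonglongrightarrow> (\<Sum>i\<in>F. (norm (L i - coord (X n) i))\<^sup>2)"
      by (intro tendsto_intros L)
    have "(\<Sum>i\<in>F. (norm (coord (X m) i - coord (X n) i))\<^sup>2) \<le> e\<^sup>2" if "m \<ge> M" for m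
    proof -
      have "(\<Sum>i\<in>F. (norm (coord (X m) i - coord (X n) i))\<^sup>2) \<le> (norm (X m - X n))\<^sup>2"
        using sum_coord_le[OF \<open>finite F\<close>, of "X m - X n"] by simp
      also have "\<dots> \<le> e\<^sup>2"
        using M that \<open>n \<ge> M\<close> by (intro power_mono) (auto intro: less_imp_le)
      finally show ?thesis .
    qed
    then show "\<exists>N. \<forall>m\<ge>N. (\<Sum>i\<in>F. (norm (coord (X m) i - coord (X n) i))\<^sup>2) \<le> e\<^sup>2"
      by blast
  qed
  obtain M where M: "\<forall>m\<ge>M. \<forall>n\<ge>M. norm (X m - X n) < 1"
    using CauchyD[OF X, of 1] by auto
  have "(\<lambda>i. (norm (L i - coord (X M) i))\<^sup>2) summable_on UNIV"
    using key[OF M order_refl] by (intro ell2_limit(1)[of _ 1]) auto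
  from square_summable_add[OF this coord_summable[of "X M"]]
  have L2: "(\<lambda>i. (norm (L i))\<^sup>2) summable_on UNIV"
    by simp
  have "X \<longlonglongrightarrow> Abs_ell2 L"
  proof (rule LIMSEQ_I)
    fix r :: real assume "0 < r"
    then obtain M where M: "\<forall>m\<ge>M. \<forall>n\<ge>M. norm (X m - X n) < r / 2"
      using CauchyD[OF X, of "r / 2"] by auto
    have "norm (X n - Abs_ell2 L) < r" if "n \<ge> M" for n
    proof -
      have eq: "Abs_ell2 L - X n = Abs_ell2 (\<lambda>i. L i - coord (X n) i)"
      proof (rule ell2_eqI)
        have "(\<lambda>i. (norm (L i - coord (X n) i))\<^sup>2) summable_on UNIV"
          using key[OF M that] \<open>0 < r\<close> by (intro ell2_limit(1)[of _ "r / 2"]) auto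
        then show "coord (Abs_ell2 L - X n) i = coord (Abs_ell2 (\<lambda>i. L i - coord (X n) i)) i" for i
          by (simp add: Abs_ell2_inverse L2)
      qed
      have "norm (Abs_ell2 L - X n) \<le> r / 2"
        unfolding eq using key[OF M that] \<open>0 < r\<close> by (intro ell2_limit(2)) auto
      then show ?thesis
        using \<open>0 < r\<close> by (simp add: norm_minus_commute)
    qed
    then show "\<exists>no. \<forall>n\<ge>no. norm (X n - Abs_ell2 L) < r"
      by blast
  qed
  then show "convergent X"
    by (auto simp: convergent_def)
qed

instantiation ell2 :: (type, chilbert_space) chilbert_space
begin
definition cinner_ell2 :: "('a, 'b) ell2 \<Rightarrow> ('a, 'b) ell2 \<Rightarrow> complex"
  where "cinner_ell2 f g = (\<Sum>\<^sub>\<infinity>i. cinner (coord f i) (coord g i))"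
instance
proof
  fix f g h :: "('a, 'b) ell2" and a :: complex
  note summ = summable_cinner[OF coord_summable coord_summable]
  show "cinner f g = cnj (cinner g f)"
    unfolding cinner_ell2_def infsum_cnj[symmetric] by (intro infsum_cong cinner_commute)
  show "cinner (f + g) h = cinner f h + cinner g h"
    unfolding cinner_ell2_def by (simp add: cinner_add_left infsum_add summ)
  show "cinner (a *\<^sub>C f) g = a * cinner f g"
    unfolding cinner_ell2_def by (simp add: cinner_scaleC_left infsum_cmult_right')
  show "Re (cinner f g) = inner f g"
    by (simp add: cinner_ell2_def inner_ell2_def)
qed
end


section \<open>Bounded complex-linear operators\<close>

typedef (overloaded) ('a::chilbert_space, 'b::chilbert_space) cblinfun =
    "{T :: 'a \<Rightarrow>\<^sub>L 'b. \<forall>a x. blinfun_apply T (a *\<^sub>C x) = a *\<^sub>C blinfun_apply T x}"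
  morphisms blinfun_of_cblinfun Abs_cblinfun
  by (rule exI[of _ 0]) simp

setup_lifting type_definition_cblinfun

lift_definition capply :: "('a::chilbert_space, 'b::chilbert_space) cblinfun \<Rightarrow> 'a \<Rightarrow> 'b"
  is blinfun_apply .

lemma capply_scaleC [simp]: "capply T (a *\<^sub>C x) = a *\<^sub>C capply T x"
  by transfer simp

lemma bounded_linear_capply: "bounded_linear (capply T)"
  by transfer (rule blinfun.bounded_linear_right)

lemma cblinfun_eqI: "(\<And>x. capply S x = capply T x) \<Longrightarrow> S = T"
  by transfer (rule blinfun_eqI)

definition CBlinfun :: "('a \<Rightarrow> 'b) \<Rightarrow> ('a::chilbert_space, 'b::chilbert_space) cblinfun"
  where "CBlinfun f = Abs_cblinfun (Blinfun f)"

lemma capply_CBlinfun: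
  assumes "bounded_linear f" "\<And>a x. f (a *\<^sub>C x) = a *\<^sub>C f x"
  shows "capply (CBlinfun f) = f"
  unfolding CBlinfun_def capply.rep_eq
  by (subst Abs_cblinfun_inverse) (simp_all add: bounded_linear_Blinfun_apply assms)

instantiation cblinfun :: (chilbert_space, chilbert_space) complex_vector
begin
lift_definition zero_cblinfun :: "('a, 'b) cblinfun" is 0 by simp
lift_definition plus_cblinfun :: "('a, 'b) cblinfun \<Rightarrow> ('a, 'b) cblinfun \<Rightarrow> ('a, 'b) cblinfun"
  is "(+)" by (simp add: blinfun.add_left scaleC_add_right)
lift_definition uminus_cblinfun :: "('a, 'b) cblinfun \<Rightarrow> ('a, 'b) cblinfun"
  is uminus by (simp add: blinfun.minus_left)
lift_definition minus_cblinfun :: "('a, 'b) cblinfun \<Rightarrow> ('a, 'b) cblinfun \<Rightarrow> ('a, 'b) cblinfun"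
  is "(-)" by (simp add: blinfun.diff_left complex_vs.scale_right_diff_distrib)
lift_definition scaleC_cblinfun :: "complex \<Rightarrow> ('a, 'b) cblinfun \<Rightarrow> ('a, 'b) cblinfun"
  is "\<lambda>a T. Blinfun (\<lambda>x. a *\<^sub>C blinfun_apply T x)"
  by (simp add: bounded_linear_Blinfun_apply scaleC_scaleC mult.commute
      bounded_linear_compose[OF bounded_linear_scaleC blinfun.bounded_linear_right])
lift_definition scaleR_cblinfun :: "real \<Rightarrow> ('a, 'b) cblinfun \<Rightarrow> ('a, 'b) cblinfun"
  is "scaleR" by (simp add: blinfun.scaleR_left scaleR_scaleC scaleC_scaleC mult.commute)

lemma capply_scaleC_left: "capply (a *\<^sub>C T) x = a *\<^sub>C capply T x"
  by transfer (simp add: bounded_linear_Blinfun_apply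
      bounded_linear_compose[OF bounded_linear_scaleC blinfun.bounded_linear_right])

lemma capply_add_left: "capply (S + T) x = capply S x + capply T x"
  by transfer (simp add: blinfun.add_left)

lemma capply_scaleR_left: "capply (r *\<^sub>R T) x = r *\<^sub>R capply T x"
  by transfer (simp add: blinfun.scaleR_left)

instance
proof
  fix S T U :: "('a, 'b) cblinfun" and a b :: complex and r s :: real
  show "S + T + U = S + (T + U)" by transfer (simp add: add.assoc)
  show "S + T = T + S" by transfer (simp add: add.commute)
  show "0 + S = S" by transfer simp
  show "- S + S = 0" by transfer simp
  show "S - T = S + - T" by transfer simp
  show "r *\<^sub>R (S + T) = r *\<^sub>R S + r *\<^sub>R T" by transfer (simp add: scaleR_add_right)
  show "(r + s) *\<^sub>R S = r *\<^sub>R S + s *\<^sub>R S" by transfer (simp add: scaleR_add_left)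
  show "r *\<^sub>R s *\<^sub>R S = (r * s) *\<^sub>R S" by transfer simp
  show "1 *\<^sub>R S = S" by transfer simp
  show "a *\<^sub>C (S + T) = a *\<^sub>C S + a *\<^sub>C T"
    by (rule cblinfun_eqI) (simp add: capply_scaleC_left capply_add_left scaleC_add_right)
  show "(a + b) *\<^sub>C S = a *\<^sub>C S + b *\<^sub>C S"
    by (rule cblinfun_eqI) (simp add: capply_scaleC_left capply_add_left scaleC_add_left)
  show "a *\<^sub>C b *\<^sub>C S = (a * b) *\<^sub>C S"
    by (rule cblinfun_eqI) (simp add: capply_scaleC_left scaleC_scaleC)
  show "r *\<^sub>R S = complex_of_real r *\<^sub>C S"
    by (rule cblinfun_eqI) (simp add: capply_scaleC_left capply_scaleR_left scaleR_scaleC)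
qed
end

lemma capply_simps [simp]:
  "capply 0 x = 0" "capply (S + T) x = capply S x + capply T x" "capply (- T) x = - capply T x"
  "capply (S - T) x = capply S x - capply T x" "capply (a *\<^sub>C T) x = a *\<^sub>C capply T x"
  "capply (r *\<^sub>R T) x = r *\<^sub>R capply T x"
       apply (simp add: capply.rep_eq zero_cblinfun.rep_eq)
      apply (rule capply_add_left)
     apply (simp add: capply.rep_eq uminus_cblinfun.rep_eq blinfun.minus_left)
    apply (simp add: capply.rep_eq minus_cblinfun.rep_eq blinfun.diff_left)
   apply (rule capply_scaleC_left)
  apply (rule capply_scaleR_left)
  done

lemma capply_sum: "capply (\<Sum>i\<in>A. F i) x = (\<Sum>i\<in>A. capply (F i) x)"
  by (induction A rule: infinite_finite_induct) auto

text \<open>The operator norm is inherited from the library type of bounded (real-)linear operators.\<close>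

instantiation cblinfun :: (chilbert_space, chilbert_space) real_normed_vector
begin
lift_definition norm_cblinfun :: "('a, 'b) cblinfun \<Rightarrow> real" is norm .
definition sgn_cblinfun :: "('a, 'b) cblinfun \<Rightarrow> ('a, 'b) cblinfun"
  where "sgn_cblinfun T = T /\<^sub>R norm T"
definition dist_cblinfun :: "('a, 'b) cblinfun \<Rightarrow> ('a, 'b) cblinfun \<Rightarrow> real"
  where "dist_cblinfun S T = norm (S - T)"
definition uniformity_cblinfun :: "(('a, 'b) cblinfun \<times> ('a, 'b) cblinfun) filter"
  where "uniformity_cblinfun = (INF e\<in>{0<..}. principal {(x, y). dist x y < e})"
definition open_cblinfun :: "('a, 'b) cblinfun set \<Rightarrow> bool"
  where "open_cblinfun U \<longleftrightarrow> (\<forall>x\<in>U. eventually (\<lambda>(x', y). x' = x \<longrightarrow> y \<in> U) uniformity)"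
instance
proof
  fix S T :: "('a, 'b) cblinfun" and r :: real and U :: "('a, 'b) cblinfun set"
  show "dist S T = norm (S - T)" by (rule dist_cblinfun_def)
  show "sgn S = S /\<^sub>R norm S" by (rule sgn_cblinfun_def)
  show "uniformity = (INF e\<in>{0<..}. principal {(x, y :: ('a, 'b) cblinfun). dist x y < e})"
    by (rule uniformity_cblinfun_def)
  show "open U \<longleftrightarrow> (\<forall>x\<in>U. eventually (\<lambda>(x', y). x' = x \<longrightarrow> y \<in> U) uniformity)"
    by (rule open_cblinfun_def)
  show "norm S = 0 \<longleftrightarrow> S = 0" by transfer simp
  show "norm (S + T) \<le> norm S + norm T" by transfer (rule norm_triangle_ineq)
  show "norm (r *\<^sub>R S) = \<bar>r\<bar> * norm S" by transfer simp
qed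
end

lift_definition cid :: "('a::chilbert_space, 'a) cblinfun" is id_blinfun by simp

lift_definition ccompose :: "('b::chilbert_space, 'c::chilbert_space) cblinfun \<Rightarrow>
    ('a::chilbert_space, 'b) cblinfun \<Rightarrow> ('a, 'c) cblinfun"  (infixl "\<circ>\<^sub>C" 67)
  is blinfun_compose by simp

lemma capply_cid [simp]: "capply cid x = x"
  by transfer simp

lemma capply_ccompose [simp]: "capply (S \<circ>\<^sub>C T) x = capply S (capply T x)"
  by transfer simp

lemma norm_cblinfun_onorm: "norm T = onorm (capply T)"
  by transfer (rule norm_blinfun.rep_eq)

definition adj :: "('a::chilbert_space, 'b::chilbert_space) cblinfun \<Rightarrow> ('b, 'a) cblinfun"
  where "adj T = (THE S. \<forall>x y. cinner (capply T x) y = cinner x (capply S y))"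

text \<open>The two-sided inverse; unspecified for operators that are not invertible.\<close>

definition cinverse :: "('a::chilbert_space, 'b::chilbert_space) cblinfun \<Rightarrow> ('b, 'a) cblinfun"
  where "cinverse T = (THE S. S \<circ>\<^sub>C T = cid \<and> T \<circ>\<^sub>C S = cid)"

definition positive_op :: "('a::chilbert_space, 'a) cblinfun \<Rightarrow> bool"
  where "positive_op T \<longleftrightarrow> (\<forall>x. cinner (capply T x) x \<in> \<real> \<and> 0 \<le> Re (cinner (capply T x) x))"

text \<open>The positive square root; unspecified for operators that are not positive.\<close>

definition sqrt_op :: "('a::chilbert_space, 'a) cblinfun \<Rightarrow> ('a, 'a) cblinfun"
  where "sqrt_op T = (THE S. positive_op S \<and> S \<circ>\<^sub>C S = T)"


section \<open>The noncommutative ball and Harnack equivalence\<close>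

type_synonym ('h, 'n) optuple = "(('h, 'h) cblinfun, 'n) vec"

text \<open>The row norm of a tuple, which is not the Euclidean norm that the type \<open>vec\<close> carries.\<close>

definition row_norm :: "('h::chilbert_space, 'n::finite) optuple \<Rightarrow> real"
  where "row_norm X = sqrt (norm (\<Sum>i\<in>UNIV. X $ i \<circ>\<^sub>C adj (X $ i)))"

definition op_ball :: "('h::chilbert_space, 'n::finite) optuple set"
  where "op_ball = {X. row_norm X < 1}"

definition op_cball :: "('h::chilbert_space, 'n::finite) optuple set"
  where "op_cball = {X. row_norm X \<le> 1}"

definition scalar_tuple :: "complex ^ 'n \<Rightarrow> ('h::chilbert_space, 'n::finite) optuple"
  where "scalar_tuple z = (\<chi> i. (z $ i) *\<^sub>C cid)"

text \<open>Words in the generators are lists over the index type, so a noncommutative polynomial is a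
  finitely supported family of coefficients indexed by words. An element of
  \<open>\<complex>[X\<^sub>1, \<dots>, X\<^sub>n] \<otimes> M\<^sub>m\<^sub>\<times>\<^sub>m\<close> is a matrix of such polynomials, given as a function of two indices of
  which only the values at indices below \<open>m\<close> matter; operators on \<open>\<H> \<otimes> \<complex>\<^sup>m\<close> are
  \<open>m \<times> m\<close> operator matrices in the same sense, acting on \<open>\<H>\<^sup>m\<close>.\<close>

type_synonym 'n ncpoly = "'n list \<Rightarrow>\<^sub>0 complex"

definition op_word :: "('h::chilbert_space, 'n::finite) optuple \<Rightarrow> 'n list \<Rightarrow> ('h, 'h) cblinfun"
  where "op_word X w = foldr (\<lambda>i T. X $ i \<circ>\<^sub>C T) w cid"

definition eval_ncpoly :: "'n ncpoly \<Rightarrow> ('h::chilbert_space, 'n::finite) optuple \<Rightarrow> ('h, 'h) cblinfun"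
  where "eval_ncpoly q X = (\<Sum>w\<in>Poly_Mapping.keys q. Poly_Mapping.lookup q w *\<^sub>C op_word X w)"

definition opmat_positive :: "nat \<Rightarrow> (nat \<Rightarrow> nat \<Rightarrow> ('h::chilbert_space, 'h) cblinfun) \<Rightarrow> bool"
  where "opmat_positive m T \<longleftrightarrow> (\<forall>x :: nat \<Rightarrow> 'h.
    (let q = (\<Sum>i<m. cinner (\<Sum>j<m. capply (T i j) (x j)) (x i)) in q \<in> \<real> \<and> 0 \<le> Re q))"

definition opmat_le :: "nat \<Rightarrow> (nat \<Rightarrow> nat \<Rightarrow> ('h::chilbert_space, 'h) cblinfun) \<Rightarrow>
    (nat \<Rightarrow> nat \<Rightarrow> ('h, 'h) cblinfun) \<Rightarrow> bool"
  where "opmat_le m S T \<longleftrightarrow> opmat_positive m (\<lambda>i j. T i j - S i j)"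

text \<open>\<open>\<Re> p(X) = (p(X) + p(X)\<^sup>*) / 2\<close>; the \<open>(i, j)\<close> entry of \<open>p(X)\<^sup>*\<close> is the adjoint of the
  \<open>(j, i)\<close> entry of \<open>p(X)\<close>.\<close>

definition re_ncpoly :: "(nat \<Rightarrow> nat \<Rightarrow> 'n ncpoly) \<Rightarrow> ('h::chilbert_space, 'n::finite) optuple \<Rightarrow>
    nat \<Rightarrow> nat \<Rightarrow> ('h, 'h) cblinfun"
  where "re_ncpoly p X i j = (1 / 2) *\<^sub>R (eval_ncpoly (p i j) X + adj (eval_ncpoly (p j i) X))"

definition harnack_dominated :: "real \<Rightarrow> ('h::chilbert_space, 'n::finite) optuple \<Rightarrow>
    ('h, 'n) optuple \<Rightarrow> bool"
  where "harnack_dominated c A B \<longleftrightarrow> (\<forall>m (p :: nat \<Rightarrow> nat \<Rightarrow> 'n ncpoly).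
    (\<forall>X \<in> (op_ball :: ('h, 'n) optuple set). opmat_positive m (re_ncpoly p X)) \<longrightarrow>
    opmat_le m (\<lambda>i j. (1 / c\<^sup>2) *\<^sub>R re_ncpoly p B i j) (re_ncpoly p A) \<and>
    opmat_le m (re_ncpoly p A) (\<lambda>i j. c\<^sup>2 *\<^sub>R re_ncpoly p B i j))"

definition harnack_equivalent :: "('h::chilbert_space, 'n::finite) optuple \<Rightarrow>
    ('h, 'n) optuple \<Rightarrow> bool"
  where "harnack_equivalent A B \<longleftrightarrow>
    A \<in> op_cball \<and> B \<in> op_cball \<and> (\<exists>c\<ge>1. harnack_dominated c A B)"

text \<open>Only meaningful on pairs in the same Harnack part; the value \<open>1\<close> off such pairs is a
  placeholder.\<close>

definition harnack_omega :: "('h::chilbert_space, 'n::finite) optuple \<Rightarrow> ('h, 'n) optuple \<Rightarrow> real"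
  where "harnack_omega A B =
    (if harnack_equivalent A B then Inf {c. 1 \<le> c \<and> harnack_dominated c A B} else 1)"

definition hyp_delta :: "('h::chilbert_space, 'n::finite) optuple \<Rightarrow> ('h, 'n) optuple \<Rightarrow> real"
  where "hyp_delta A B = ln (harnack_omega A B)"

definition pseudohyp :: "('h::chilbert_space, 'n::finite) optuple \<Rightarrow> ('h, 'n) optuple \<Rightarrow> real"
  where "pseudohyp A B = ((harnack_omega A B)\<^sup>2 - 1) / ((harnack_omega A B)\<^sup>2 + 1)"


section \<open>The involutive automorphisms of the Euclidean ball\<close>

text \<open>\<open>\<psi>\<^sub>z(w) = (z - P\<^sub>z w - s\<^sub>z (w - P\<^sub>z w)) / (1 - \<langle>w, z\<rangle>)\<close> with \<open>s\<^sub>z = (1 - \<parallel>z\<parallel>\<^sup>2)\<^sup>1\<^sup>/\<^sup>2\<close> and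
  \<open>P\<^sub>z\<close> the orthogonal projection onto the span of \<open>z\<close>. For \<open>z = 0\<close> the quotient below is
  \<open>0 / 0 = 0\<close>, as it should be.\<close>

definition ball_proj :: "complex ^ 'n \<Rightarrow> complex ^ 'n \<Rightarrow> complex ^ 'n::finite"
  where "ball_proj z w = (cinner w z / cinner z z) *\<^sub>C z"

definition ball_involution :: "complex ^ 'n \<Rightarrow> complex ^ 'n \<Rightarrow> complex ^ 'n::finite"
  where "ball_involution z w = (1 / (1 - cinner w z)) *\<^sub>C
    (z - ball_proj z w - sqrt (1 - (norm z)\<^sup>2) *\<^sub>R (w - ball_proj z w))"

lemma ball_involution_0: "ball_involution z 0 = z"
  by (simp add: ball_involution_def ball_proj_def)

lemma ball_involution_self: "ball_involution z z = 0"
  by (cases "z = 0") (simp_all add: ball_involution_def ball_proj_def cinner_self)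

lemma ball_involution_norm:
  fixes z w :: "complex ^ 'n::finite"
  assumes z: "norm z < 1" and w: "norm w < 1"
  shows "1 - (norm (ball_involution z w))\<^sup>2 =
    (1 - (norm z)\<^sup>2) * (1 - (norm w)\<^sup>2) / (cmod (1 - cinner w z))\<^sup>2"
proof -
  define a where "a = cinner w z"
  define n where "n = (norm z)\<^sup>2"
  define s where "s = sqrt (1 - n)"
  define N where "N = z - ball_proj z w - s *\<^sub>R (w - ball_proj z w)"
  have n1: "0 \<le> n" "n < 1"
    using z by (auto simp: n_def power_less_one_iff)
  have s2: "s * s = 1 - n"
    using n1 by (simp add: s_def)
  have "cmod a \<le> norm w * norm z"
    by (simp add: a_def norm_cinner_le)
  also have "\<dots> < 1"
    using mult_strict_mono'[OF w z] by simp
  finally have a1: "1 - a \<noteq> 0"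
    by auto
  have zw: "cinner z w = cnj a"
    unfolding a_def by (rule cinner_commute)
  have zz: "cinner z z = of_real n"
    by (simp add: n_def cinner_self)
  have key: "(norm N)\<^sup>2 = (cmod (1 - a))\<^sup>2 - (1 - n) * (1 - (norm w)\<^sup>2)"
  proof (cases "z = 0")
    case True
    then show ?thesis
      by (simp add: N_def ball_proj_def s_def n_def a_def)
  next
    case False
    then have n0: "n \<noteq> 0"
      by (simp add: n_def)
    have P: "ball_proj z w = (a / of_real n) *\<^sub>C z"
      by (simp add: ball_proj_def a_def zz)
    have "cinner N N = of_real ((cmod (1 - a))\<^sup>2 - (1 - n) * (1 - (norm w)\<^sup>2))"
    proof -
      define t where "t = a / complex_of_real n"
      define ss where "ss = complex_of_real s"
      have N: "N = (1 - t + ss * t) *\<^sub>C z - ss *\<^sub>C w"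
        by (simp add: N_def P t_def ss_def scaleR_scaleC complex_vs.scale_left_diff_distrib
            complex_vs.scale_right_diff_distrib scaleC_add_left scaleC_scaleC)
      have "ss * ss = of_real (1 - n)"
        unfolding ss_def of_real_mult[symmetric] s2 ..
      then have ss: "ss * ss = 1 - of_real n" "cnj ss = ss"
        by (simp_all add: ss_def)
      have tn: "t * of_real n = a" "cnj t * of_real n = cnj a"
        using n0 by (simp_all add: t_def)
      define k where "k = 1 - t + ss * t"
      have "cinner N N = k * cnj k * of_real n - k * ss * cnj a - ss * cnj k * a
          + ss * ss * of_real ((norm w)\<^sup>2)"
        unfolding N k_def[symmetric] cinner_diff_left cinner_diff_right cinner_scaleC_left
          cinner_scaleC_right zz zw cinner_self[of w] ss(2) a_def[symmetric]
        by (simp add: algebra_simps)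
      also have "\<dots> = (1 - a) * cnj (1 - a) - (1 - of_real n) * (1 - of_real ((norm w)\<^sup>2))"
      proof -
        have kn: "k * of_real n = of_real n - a + ss * a"
          by (simp add: k_def ring_distribs tn mult.assoc)
        have kc: "cnj k = 1 - cnj t + ss * cnj t"
          by (simp add: k_def ss)
        have at: "a * cnj t = t * cnj a"
          by (simp add: t_def)
        have "k * cnj k * of_real n = (k * of_real n) * cnj k"
          by simp
        also have "\<dots> = of_real n - a + ss * a - (cnj a - a * cnj t + ss * a * cnj t)
            + ss * (cnj a - a * cnj t + ss * a * cnj t)"
          unfolding kn kc tn(2)[symmetric] by (simp add: algebra_simps)
        finally have 1: "k * cnj k * of_real n = \<dots>" .
        have 2: "k * ss * cnj a = ss * cnj a - ss * (a * cnj t) + ss * ss * (a * cnj t)"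
          by (simp add: k_def at algebra_simps)
        have 3: "ss * cnj k * a = ss * a - ss * (a * cnj t) + ss * ss * (a * cnj t)"
          unfolding kc by (simp add: algebra_simps)
        have 4: "a * cnj a = of_real n * (a * cnj t)"
          using tn(2) by (simp add: mult.commute mult.left_commute)
        have "k * cnj k * of_real n - k * ss * cnj a - ss * cnj k * a
            = of_real n - a - cnj a + (a * cnj t) - (ss * ss) * (a * cnj t)"
          unfolding 1 2 3 by (simp add: algebra_simps)
        also have "\<dots> = of_real n - a - cnj a + a * cnj a"
          unfolding ss(1) 4 by (simp add: algebra_simps)
        finally show ?thesis
          unfolding ss(1) by (simp add: algebra_simps)
      qed
      finally show ?thesis
        using complex_norm_square[of "1 - a"] by simp
    qed
    then show ?thesis
      unfolding cinner_self of_real_eq_iff .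
  qed
  have "ball_involution z w = (1 / (1 - a)) *\<^sub>C N"
    by (simp add: ball_involution_def N_def s_def n_def a_def)
  then have "(norm (ball_involution z w))\<^sup>2 = (norm N)\<^sup>2 / (cmod (1 - a))\<^sup>2"
    by (simp add: norm_scaleC norm_divide power_divide power_mult_distrib)
  then show ?thesis
    using a1 unfolding key by (simp add: diff_divide_distrib flip: a_def n_def)
qed


section \<open>Fock space and the reconstruction operator\<close>

text \<open>The full Fock space is \<open>('n list, complex) ell2\<close>: the word \<open>[i\<^sub>1, \<dots>, i\<^sub>k]\<close> indexes the
  orthonormal basis vector \<open>e\<^bsub>i\<^sub>1\<^esub> \<otimes> \<dots> \<otimes> e\<^bsub>i\<^sub>k\<^esub>\<close>, and the empty word the vacuum. More generally
  \<open>('i, 'h) ell2\<close> is the Hilbert space tensor product of \<open>'h\<close> with \<open>('i, complex) ell2\<close>, with the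
  following elementary tensors.\<close>

lift_definition tens :: "'h::chilbert_space \<Rightarrow> ('i, complex) ell2 \<Rightarrow> ('i, 'h) ell2"
  is "\<lambda>h \<phi> i. \<phi> i *\<^sub>C h"
  by (simp add: norm_scaleC power_mult_distrib summable_on_cmult_left)

lemma cinner_tens: "cinner (tens h \<phi>) (tens k \<psi>) = cinner h k * cinner \<phi> \<psi>"
  unfolding cinner_ell2_def tens.rep_eq infsum_cmult_right'[symmetric]
  by (intro infsum_cong)
    (simp add: cinner_scaleC_left cinner_scaleC_right cinner_complex_def mult_ac)

text \<open>\<open>T \<otimes> I\<close>\<close>

lemma square_summable_capply:
  assumes "(\<lambda>i. (norm (f i))\<^sup>2) summable_on UNIV"
  shows "(\<lambda>i. (norm (capply T (f i)))\<^sup>2) summable_on UNIV"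
proof (rule summable_on_comparison_test)
  show "(\<lambda>i. (onorm (capply T))\<^sup>2 * (norm (f i))\<^sup>2) summable_on UNIV"
    by (intro summable_on_cmult_right assms)
  show "(norm (capply T (f i)))\<^sup>2 \<le> (onorm (capply T))\<^sup>2 * (norm (f i))\<^sup>2" for i
    unfolding power_mult_distrib[symmetric]
    by (intro power_mono onorm bounded_linear_capply norm_ge_zero)
qed simp

lift_definition ampl_fun :: "('h::chilbert_space, 'k::chilbert_space) cblinfun \<Rightarrow>
    ('i, 'h) ell2 \<Rightarrow> ('i, 'k) ell2"
  is "\<lambda>T f i. capply T (f i)"
  by (simp add: square_summable_capply)

definition ampl :: "('h::chilbert_space, 'k::chilbert_space) cblinfun \<Rightarrow>
    (('i, 'h) ell2, ('i, 'k) ell2) cblinfun"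
  where "ampl T = CBlinfun (ampl_fun T)"

lemma capply_ampl:
  fixes T :: "('h::chilbert_space, 'k::chilbert_space) cblinfun"
  shows "capply (ampl T :: (('i, 'h) ell2, ('i, 'k) ell2) cblinfun) = ampl_fun T"
  unfolding ampl_def
proof (rule capply_CBlinfun)
  interpret T: bounded_linear "capply T" by (rule bounded_linear_capply)
  show "bounded_linear (ampl_fun T :: ('i, 'h) ell2 \<Rightarrow> ('i, 'k) ell2)"
  proof (rule bounded_linear_intro[where K = "onorm (capply T)"])
    fix f g :: "('i, 'h) ell2" and r :: real
    show "ampl_fun T (f + g) = ampl_fun T f + ampl_fun T g"
      by (rule ell2_eqI) (simp add: ampl_fun.rep_eq T.add)
    show "ampl_fun T (r *\<^sub>R f) = r *\<^sub>R ampl_fun T f"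
      by (rule ell2_eqI) (simp add: ampl_fun.rep_eq T.scaleR)
    have "(norm (ampl_fun T f))\<^sup>2 \<le> (\<Sum>\<^sub>\<infinity>i. (onorm (capply T))\<^sup>2 * (norm (coord f i))\<^sup>2)"
      unfolding norm_ell2_squared ampl_fun.rep_eq
      by (intro infsum_mono square_summable_capply coord_summable summable_on_cmult_right)
        (auto simp: power_mult_distrib[symmetric]
          intro!: power_mono onorm bounded_linear_capply)
    also have "\<dots> = (norm f * onorm (capply T))\<^sup>2"
      unfolding power_mult_distrib norm_ell2_squared infsum_cmult_right' by (simp add: mult.commute)
    finally show "norm (ampl_fun T f) \<le> norm f * onorm (capply T)"
      by (rule power2_le_imp_le) (simp add: onorm_pos_le bounded_linear_capply)
  qed
  show "ampl_fun T (a *\<^sub>C f) = a *\<^sub>C ampl_fun T f" for a and f :: "('i, 'h) ell2"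
    by (rule ell2_eqI) (simp add: ampl_fun.rep_eq)
qed

lemma ampl_tens: "capply (ampl T) (tens h \<phi>) = tens (capply T h) \<phi>"
  by (rule ell2_eqI) (simp add: capply_ampl ampl_fun.rep_eq tens.rep_eq)

text \<open>\<open>I \<otimes> R\<^sub>i\<close>, where \<open>R\<^sub>i\<close> appends the letter \<open>i\<close> to basis words; for \<open>'h = complex\<close> this is
  \<open>R\<^sub>i\<close> itself.\<close>

lemma snoc_word_cases: "v \<noteq> [] \<and> last v = i \<longleftrightarrow> v \<in> range (\<lambda>w. w @ [i])"
  by (auto, metis append_butlast_last_id rangeI)

lemma inj_snoc: "inj (\<lambda>w. w @ [i])"
  by (rule injI) simp

lemma create_sum:
  fixes f :: "'n list \<Rightarrow> 'h::chilbert_space" and i :: 'n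
  defines "g \<equiv> \<lambda>v. if v \<noteq> [] \<and> last v = i then f (butlast v) else 0"
  shows "(\<lambda>v. (norm (g v))\<^sup>2) summable_on UNIV \<longleftrightarrow> (\<lambda>w. (norm (f w))\<^sup>2) summable_on UNIV"
    and "(\<Sum>\<^sub>\<infinity>v. (norm (g v))\<^sup>2) = (\<Sum>\<^sub>\<infinity>w. (norm (f w))\<^sup>2)"
proof -
  have *: "(\<lambda>w. (norm (f w))\<^sup>2) = (\<lambda>v. (norm (g v))\<^sup>2) \<circ> (\<lambda>w. w @ [i])"
    by (simp add: g_def fun_eq_iff)
  have 0: "(norm (g v))\<^sup>2 = 0" if "v \<in> UNIV - range (\<lambda>w. w @ [i])" for v
    using that snoc_word_cases[of v i] by (auto simp: g_def)
  show "(\<lambda>v. (norm (g v))\<^sup>2) summable_on UNIV \<longleftrightarrow> (\<lambda>w. (norm (f w))\<^sup>2) summable_on UNIV"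
    unfolding * summable_on_reindex[OF inj_snoc, symmetric]
    by (rule summable_on_cong_neutral) (use 0 in auto)
  show "(\<Sum>\<^sub>\<infinity>v. (norm (g v))\<^sup>2) = (\<Sum>\<^sub>\<infinity>w. (norm (f w))\<^sup>2)"
    unfolding * infsum_reindex[OF inj_snoc, symmetric]
    by (rule infsum_cong_neutral) (use 0 in auto)
qed

lift_definition create_fun :: "'n \<Rightarrow> ('n list, 'h::chilbert_space) ell2 \<Rightarrow> ('n list, 'h) ell2"
  is "\<lambda>i f v. if v \<noteq> [] \<and> last v = i then f (butlast v) else 0"
  by (rule create_sum(1)[THEN iffD2])

definition right_create :: "'n \<Rightarrow>
    (('n list, 'h::chilbert_space) ell2, ('n list, 'h) ell2) cblinfun"
  where "right_create i = CBlinfun (create_fun i)"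

lemma norm_create_fun: "norm (create_fun i f) = norm f"
proof -
  have "(norm (create_fun i f))\<^sup>2 = (norm f)\<^sup>2"
    unfolding norm_ell2_squared create_fun.rep_eq by (rule create_sum(2))
  then show ?thesis
    by (simp add: power2_eq_iff_nonneg)
qed

lemma capply_right_create: "capply (right_create i) = create_fun i"
  unfolding right_create_def
proof (rule capply_CBlinfun)
  show "bounded_linear (create_fun i :: (_, 'b) ell2 \<Rightarrow> _)"
  proof (rule bounded_linear_intro[where K = 1])
    fix f g :: "('a list, 'b) ell2" and r :: real
    show "create_fun i (f + g) = create_fun i f + create_fun i g"
      by (rule ell2_eqI) (simp add: create_fun.rep_eq)
    show "create_fun i (r *\<^sub>R f) = r *\<^sub>R create_fun i f"
      by (rule ell2_eqI) (simp add: create_fun.rep_eq)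
    show "norm (create_fun i f) \<le> norm f * 1"
      by (simp add: norm_create_fun)
  qed
  show "create_fun i (a *\<^sub>C f) = a *\<^sub>C create_fun i f" for a and f :: "('a list, 'b) ell2"
    by (rule ell2_eqI) (simp add: create_fun.rep_eq)
qed

lemma right_create_tens:
  "capply (right_create i) (tens h \<phi>) = tens h (capply (right_create i) \<phi>)"
  by (rule ell2_eqI) (simp add: capply_right_create create_fun.rep_eq tens.rep_eq)

definition reconstruction :: "('h::chilbert_space, 'n::finite) optuple \<Rightarrow>
    (('n list, 'h) ell2, ('n list, 'h) ell2) cblinfun"
  where "reconstruction X = (\<Sum>i\<in>UNIV. ampl (adj (X $ i)) \<circ>\<^sub>C right_create i)"

lemma reconstruction_tens:
  "capply (reconstruction X) (tens h \<phi>) =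
    (\<Sum>i\<in>UNIV. tens (capply (adj (X $ i)) h) (capply (right_create i) \<phi>))"
  by (simp add: reconstruction_def capply_sum right_create_tens ampl_tens)

definition defect :: "('h::chilbert_space, 'n::finite) optuple \<Rightarrow> ('h, 'h) cblinfun"
  where "defect X = sqrt_op (cid - (\<Sum>i\<in>UNIV. X $ i \<circ>\<^sub>C adj (X $ i)))"

definition kernel_C :: "('h::chilbert_space, 'n::finite) optuple \<Rightarrow>
    (('n list, 'h) ell2, ('n list, 'h) ell2) cblinfun"
  where "kernel_C X = ampl (defect X) \<circ>\<^sub>C cinverse (cid - reconstruction X)"

definition kernel_Gamma :: "('h::chilbert_space, 'n::finite) optuple \<Rightarrow> ('h, 'n) optuple \<Rightarrow>
    (('n list, 'h) ell2, ('n list, 'h) ell2) cblinfun"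
  where "kernel_Gamma X Y =
    adj (kernel_C X \<circ>\<^sub>C cinverse (kernel_C Y)) \<circ>\<^sub>C (kernel_C X \<circ>\<^sub>C cinverse (kernel_C Y))"

end

theory Submission
  imports Defs
begin

text \<open>
  Everything rests on the Poisson kernel \<open>P(X) = C\<^sub>X\<^sup>* C\<^sub>X\<close>, an operator on \<open>\<H> \<otimes> \<F>\<close> with \<open>\<F>\<close> the full
  Fock space. Since \<open>R\<^sub>X\<^sup>* R\<^sub>X = (\<Sum>X\<^sub>iX\<^sub>i\<^sup>*) \<otimes> I\<close>, it equals
  \<open>(I - R\<^sub>X)\<^sup>-\<^sup>1 + ((I - R\<^sub>X)\<^sup>-\<^sup>1)\<^sup>* - I\<close> (\<open>poisson_eq\<close>), so its entry at the words \<open>\<alpha>\<close> and \<open>\<alpha>\<gamma>\<close> is \<open>X\<^sub>\<gamma>\<close> and it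
  is Toeplitz with respect to the left creation operators \<open>L\<^sub>i\<close>.

  The central step is \<open>harnack_dominated_iff_poisson\<close>: \<open>A\<close> and \<open>B\<close> are Harnack equivalent with constant
  \<open>c\<close> exactly when \<open>P(A) \<le> c\<^sup>2 P(B)\<close> and \<open>P(B) \<le> c\<^sup>2 P(A)\<close>. In one direction the finite sections of \<open>P(X)\<close>
  are real parts of matrix polynomials in \<open>X\<close>. In the other, if \<open>M = c\<^sup>2 P(B) - P(A) + \<epsilon>\<close> with \<open>\<epsilon> > 0\<close>,
  the Toeplitz property makes the operators \<open>M\<^sup>1\<^sup>/\<^sup>2 L\<^sub>i M\<^sup>-\<^sup>1\<^sup>/\<^sup>2\<close> isometries with orthogonal ranges, and
  von Neumann's inequality for this row contraction is the claim up to a multiple of \<open>\<epsilon>\<close>. Von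
  Neumann's inequality itself (\<open>von_neumann_inequality\<close>) needs no dilation: a polynomial evaluated at
  finitely many vectors only sees a finite-dimensional compression of the tuple, and this
  compression can be copied into \<open>\<H>\<close>, where the hypothesis on the polynomial applies.

  Consequently \<open>\<omega>(X, Y)\<close> is the larger of the norms of \<open>C\<^sub>X C\<^sub>Y\<^sup>-\<^sup>1\<close> and its inverse. This is the formula
  in terms of \<open>\<Gamma>\<close>, it gives multiplicativity of \<open>\<omega>\<close> along triangles, and with the addition theorem
  for \<open>tanh\<close> the triangle inequality for the pseudohyperbolic distance. Because the first row of
  \<open>P(X)\<close> contains the \<open>X\<^sub>i\<close>, a small distance forces \<open>X\<close> and \<open>Y\<close> to be close in norm; the converse follows
  from the resolvent identity and from a lower bound for \<open>P(X)\<close>.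

  At scalar points, \<open>(I - R\<^sub>w)\<^sup>-\<^sup>1 (I - R\<^sub>z)\<close> is a multiple of \<open>I - S\<close>, where \<open>S\<close> is \<open>\<parallel>\<psi>\<^sub>z(w)\<parallel>\<close> times a
  non-unitary isometry (\<open>scalar_kernel_factorization\<close>). Hence \<open>I - S\<close> has norm \<open>1 + \<parallel>\<psi>\<^sub>z(w)\<parallel>\<close>, which
  determines the distance.
\<close>


section \<open>Adjoints, inverses and square roots of bounded operators\<close>

lemma inner_scaleC_left: "(a *\<^sub>C x) \<bullet> y = x \<bullet> (cnj a *\<^sub>C y)"
  for x y :: "'a::chilbert_space"
  unfolding Re_cinner[symmetric] by (simp add: cinner_scaleC_left cinner_scaleC_right)

lemma Im_cinner: "Im (cinner x y) = x \<bullet> (\<i> *\<^sub>C y)"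
  for x y :: "'a::chilbert_space"
  unfolding Re_cinner[symmetric] by (simp add: cinner_scaleC_right)

lemma cinner_sum_left: "cinner (\<Sum>i\<in>A. f i) y = (\<Sum>i\<in>A. cinner (f i) y)"
  for y :: "'a::chilbert_space"
  by (induction A rule: infinite_finite_induct) (auto simp: cinner_add_left)

lemma cinner_sum_right: "cinner y (\<Sum>i\<in>A. f i) = (\<Sum>i\<in>A. cinner y (f i))"
  for y :: "'a::chilbert_space"
  by (induction A rule: infinite_finite_induct) (auto simp: cinner_add_right)

lemma eq_if_inner_eq:
  fixes x x' :: "'a::real_inner"
  assumes "\<And>y. x \<bullet> y = x' \<bullet> y"
  shows "x = x'"
proof -
  have "(x - x') \<bullet> (x - x') = 0"
    using assms[of "x - x'"] by (simp only: inner_diff_left diff_self)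
  then show ?thesis
    by simp
qed

lemma capply_linear [simp]:
  "capply T (x + y) = capply T x + capply T y" "capply T (x - y) = capply T x - capply T y"
  "capply T 0 = 0" "capply T (- x) = - capply T x" "capply T (r *\<^sub>R x) = r *\<^sub>R capply T x"
  "capply T (\<Sum>i\<in>A. f i) = (\<Sum>i\<in>A. capply T (f i))"
  by (simp_all add: linear_add linear_diff linear_0 linear_neg linear_scale linear_sum
      bounded_linear.linear bounded_linear_capply)

lemma norm_capply_le: "norm (capply T x) \<le> norm T * norm x"
  unfolding norm_cblinfun_onorm by (rule onorm[OF bounded_linear_capply])

lemma norm_cblinfun_bound:
  "0 \<le> b \<Longrightarrow> (\<And>x. norm (capply T x) \<le> b * norm x) \<Longrightarrow> norm T \<le> b"
  unfolding norm_cblinfun_onorm by (rule onorm_bound)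

lemma norm_ccompose_le: "norm (S \<circ>\<^sub>C T) \<le> norm S * norm T"
proof (rule norm_cblinfun_bound)
  fix x
  have "norm (capply S (capply T x)) \<le> norm S * norm (capply T x)"
    by (rule norm_capply_le)
  also have "\<dots> \<le> norm S * (norm T * norm x)"
    by (intro mult_left_mono norm_capply_le) auto
  finally show "norm (capply (S \<circ>\<^sub>C T) x) \<le> norm S * norm T * norm x"
    by (simp add: mult.assoc)
qed simp

text \<open>Complex-linearity survives limits in the operator norm, so the complex-linear operators
  form a closed subspace of the Banach space of all real-linear ones.\<close>

instance cblinfun :: (chilbert_space, chilbert_space) banach
proof
  fix X :: "nat \<Rightarrow> ('a, 'b) cblinfun"
  let ?Y = "\<lambda>n. blinfun_of_cblinfun (X n)"
  have d: "dist (X m) (X n) = dist (?Y m) (?Y n)" for m n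
    by (simp add: dist_norm norm_cblinfun.rep_eq minus_cblinfun.rep_eq)
  assume "Cauchy X"
  then have "Cauchy ?Y"
    unfolding Cauchy_def d .
  then obtain L where L: "?Y \<longlonglongrightarrow> L"
    using Cauchy_convergent convergent_def by blast
  have app: "(\<lambda>n. blinfun_apply (?Y n) x) \<longlonglongrightarrow> blinfun_apply L x" for x
    by (intro blinfun.tendsto L tendsto_const)
  have "blinfun_apply L (a *\<^sub>C x) = a *\<^sub>C blinfun_apply L x" for a x
  proof (rule LIMSEQ_unique[OF app])
    have "(\<lambda>n. a *\<^sub>C blinfun_apply (?Y n) x) \<longlonglongrightarrow> a *\<^sub>C blinfun_apply L x"
      by (rule bounded_linear.tendsto[OF bounded_linear_scaleC app])
    moreover have "blinfun_apply (?Y n) (a *\<^sub>C x) = a *\<^sub>C blinfun_apply (?Y n) x" for n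
      using blinfun_of_cblinfun[of "X n"] by simp
    ultimately show "(\<lambda>n. blinfun_apply (?Y n) (a *\<^sub>C x)) \<longlonglongrightarrow> a *\<^sub>C blinfun_apply L x"
      by simp
  qed
  then have inv: "blinfun_of_cblinfun (Abs_cblinfun L) = L"
    by (intro Abs_cblinfun_inverse) simp
  have "dist (X n) (Abs_cblinfun L) = dist (?Y n) L" for n
    by (simp add: dist_norm norm_cblinfun.rep_eq minus_cblinfun.rep_eq inv)
  then have "X \<longlonglongrightarrow> Abs_cblinfun L"
    using L by (simp only: tendsto_dist_iff[of X] tendsto_dist_iff[of ?Y])
  then show "convergent X"
    by (auto simp: convergent_def)
qed

text \<open>The Riesz representation theorem: the representing vector minimises
  \<open>\<parallel>x\<parallel>\<^sup>2 - 2 f(x)\<close>, and minimising sequences are Cauchy by the parallelogram law.\<close>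

lemma riesz_representation:
  fixes f :: "'a::{real_inner, complete_space} \<Rightarrow> real"
  assumes "bounded_linear f"
  obtains z where "\<And>x. f x = x \<bullet> z"
proof -
  interpret f: bounded_linear f by fact
  obtain K where K: "\<And>x. norm (f x) \<le> norm x * K"
    using f.bounded by blast
  define J where "J x = (norm x)\<^sup>2 - 2 * f x" for x
  have par: "(norm (x - y))\<^sup>2 = 2 * J x + 2 * J y - 4 * J ((1/2) *\<^sub>R (x + y))" for x y
    unfolding J_def power2_norm_eq_inner
    by (simp add: f.scaleR f.add algebra_simps inner_add_left inner_add_right inner_diff_left
        inner_diff_right inner_commute)
  have lower: "- K\<^sup>2 \<le> J x" for x
  proof -
    have "f x \<le> norm x * K"
      using K[of x] by auto
    moreover have "0 \<le> (norm x - K)\<^sup>2"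
      by simp
    ultimately show ?thesis
      by (simp add: J_def power2_diff)
  qed
  define m where "m = Inf (range J)"
  have bdd: "bdd_below (range J)"
    by (rule bdd_belowI2[where m = "- K\<^sup>2"]) (rule lower)
  have mJ: "m \<le> J x" for x
    unfolding m_def by (rule cInf_lower[OF _ bdd]) simp
  have "\<exists>x. J x < m + 1 / Suc n" for n
    using cInf_lessD[of "range J" "m + 1 / Suc n"] unfolding m_def[symmetric] by auto
  then obtain x where x: "\<And>n. J (x n) < m + 1 / Suc n"
    by metis
  have close: "(norm (x i - x j))\<^sup>2 < 4 / Suc n" if "i \<ge> n" "j \<ge> n" for i j n
  proof -
    have "1 / Suc i \<le> 1 / Suc n" "1 / Suc j \<le> 1 / Suc n"
      using that by (auto simp: divide_simps)
    then show ?thesis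
      using par[of "x i" "x j"] x[of i] x[of j] mJ[of "(1/2) *\<^sub>R (x i + x j)"] by linarith
  qed
  have "Cauchy x"
  proof (rule CauchyI)
    fix e :: real assume e: "0 < e"
    then obtain n where n: "inverse (Suc n) < e\<^sup>2 / 4"
      using reals_Archimedean[of "e\<^sup>2 / 4"] by auto
    have "norm (x i - x j) < e" if "i \<ge> n" "j \<ge> n" for i j
    proof (rule power2_less_imp_less)
      show "(norm (x i - x j))\<^sup>2 < e\<^sup>2"
      proof (rule less_trans[OF close[OF that]])
        show "4 / real (Suc n) < e\<^sup>2"
          using n unfolding inverse_eq_divide by linarith
      qed
    qed (use e in simp)
    then show "\<exists>M. \<forall>m\<ge>M. \<forall>n\<ge>M. norm (x m - x n) < e"
      by blast
  qed
  then obtain z where z: "x \<longlonglongrightarrow> z"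
    using Cauchy_convergent convergent_def by blast
  have "(\<lambda>n. J (x n)) \<longlonglongrightarrow> J z"
    unfolding J_def by (intro tendsto_intros z f.tendsto)
  moreover have "(\<lambda>n. m + 1 / Suc n) \<longlonglongrightarrow> m + 0"
    by (intro tendsto_intros LIMSEQ_Suc lim_1_over_n)
  ultimately have Jz: "J z \<le> m"
    using LIMSEQ_le[of "\<lambda>n. J (x n)" "J z" "\<lambda>n. m + 1 / Suc n" "m + 0"] x less_imp_le by auto
  have "f y = y \<bullet> z" for y
  proof -
    define t where "t = (f y - y \<bullet> z)"
    have *: "0 \<le> s\<^sup>2 * (norm y)\<^sup>2 - 2 * s * t" for s
    proof -
      have "J (z + s *\<^sub>R y) = J z + s\<^sup>2 * (norm y)\<^sup>2 - 2 * s * t"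
        unfolding J_def power2_norm_eq_inner t_def
        by (simp add: f.scaleR f.add inner_add_left inner_add_right inner_commute
            power2_eq_square algebra_simps)
      then show ?thesis
        using mJ[of "z + s *\<^sub>R y"] Jz by linarith
    qed
    have "t = 0"
    proof (rule ccontr)
      assume t: "t \<noteq> 0"
      \<comment> \<open>For \<open>y \<noteq> 0\<close> the step \<open>t / \<parallel>y\<parallel>\<^sup>2\<close> minimises the quadratic; adding 1 covers \<open>y = 0\<close>.\<close>
      define n where "n = (norm y)\<^sup>2 + 1"
      have n: "0 < n" "(norm y)\<^sup>2 \<le> n"
        by (auto simp: n_def add_nonneg_pos)
      have "0 \<le> (t / n)\<^sup>2 * n - 2 * (t / n) * t"
        using *[of "t / n"] mult_left_mono[OF n(2), of "(t / n)\<^sup>2"] by simp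
      also have "\<dots> = - (t\<^sup>2 / n)"
        using n by (simp add: power2_eq_square)
      finally have "t\<^sup>2 / n \<le> 0"
        by simp
      moreover have "0 < t\<^sup>2 / n"
        using t n by (intro divide_pos_pos) auto
      ultimately show False
        by linarith
    qed
    then show ?thesis
      by (simp add: t_def)
  qed
  then show ?thesis
    using that by blast
qed

lemma adjoint_exists:
  fixes T :: "('a::chilbert_space, 'b::chilbert_space) cblinfun"
  shows "\<exists>S. \<forall>x y. capply T x \<bullet> y = x \<bullet> capply S y"
proof -
  have "\<exists>z. \<forall>x. capply T x \<bullet> y = x \<bullet> z" for y
    by (rule riesz_representation[of "\<lambda>x. capply T x \<bullet> y"])
      (auto intro: bounded_linear_compose[OF bounded_linear_inner_left bounded_linear_capply])
  then obtain g where g: "\<And>x y. capply T x \<bullet> y = x \<bullet> g y"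
    by metis
  have eq: "y = y'" if "\<And>x. x \<bullet> y = x \<bullet> y'" for y y' :: 'a
    using that by (rule eq_if_inner_eq[OF trans[OF inner_commute trans[OF _ inner_commute]]])
  have "capply (CBlinfun g) = g"
  proof (rule capply_CBlinfun)
    show "bounded_linear g"
    proof (rule bounded_linear_intro[where K = "norm T"])
      show "g (x + y) = g x + g y" for x y
        by (rule eq) (simp add: g[symmetric] inner_add_right)
      show "g (r *\<^sub>R x) = r *\<^sub>R g x" for r x
        by (rule eq) (simp add: g[symmetric])
      show "norm (g y) \<le> norm y * norm T" for y
      proof (cases "g y = 0")
        case False
        have "norm (g y) * norm (g y) = capply T (g y) \<bullet> y"
          using g[of "g y" y] by (simp add: power2_norm_eq_inner[symmetric] power2_eq_square)
        also have "\<dots> \<le> norm (capply T (g y)) * norm y"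
          by (rule norm_cauchy_schwarz)
        also have "\<dots> \<le> norm T * norm (g y) * norm y"
          by (intro mult_right_mono norm_capply_le) auto
        finally show ?thesis
          using False by (simp add: mult_ac)
      qed simp
    qed
    show "g (a *\<^sub>C y) = a *\<^sub>C g y" for a y
    proof (rule eq)
      fix x
      have "x \<bullet> g (a *\<^sub>C y) = capply T (cnj a *\<^sub>C x) \<bullet> y"
        by (simp add: g[symmetric] inner_scaleC_left)
      also have "\<dots> = x \<bullet> (a *\<^sub>C g y)"
        unfolding g by (simp add: inner_scaleC_left)
      finally show "x \<bullet> g (a *\<^sub>C y) = x \<bullet> (a *\<^sub>C g y)" .
    qed
  qed
  then show ?thesis
    using g by (intro exI[of _ "CBlinfun g"]) simp
qed

lemma adjoint_real_imp_complex:
  assumes "\<And>x y. capply T x \<bullet> y = x \<bullet> capply S y"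
  shows "cinner (capply T x) y = cinner x (capply S y)"
proof (rule complex_eqI)
  show "Re (cinner (capply T x) y) = Re (cinner x (capply S y))"
    unfolding Re_cinner by (rule assms)
  show "Im (cinner (capply T x) y) = Im (cinner x (capply S y))"
    unfolding Im_cinner assms by simp
qed

lemma cinner_adj: "cinner (capply T x) y = cinner x (capply (adj T) y)"
proof -
  obtain S where S: "\<And>x y. cinner (capply T x) y = cinner x (capply S y)"
    using adjoint_exists[of T] adjoint_real_imp_complex by metis
  have "adj T = S"
    unfolding adj_def
  proof (rule the_equality)
    fix S' assume S': "\<forall>x y. cinner (capply T x) y = cinner x (capply S' y)"
    show "S' = S"
    proof (rule cblinfun_eqI, rule eq_if_inner_eq)
      fix y x
      show "capply S' y \<bullet> x = capply S y \<bullet> x"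
        using S[of x y] S' by (metis Re_cinner inner_commute)
    qed
  qed (use S in blast)
  then show ?thesis
    using S by simp
qed

lemma inner_adj: "capply T x \<bullet> y = x \<bullet> capply (adj T) y"
  by (metis Re_cinner cinner_adj)

lemma adj_unique:
  assumes "\<And>x y. capply T x \<bullet> y = x \<bullet> capply S y"
  shows "adj T = S"
proof (rule cblinfun_eqI, rule eq_if_inner_eq)
  fix x y
  have "y \<bullet> capply (adj T) x = y \<bullet> capply S x"
    using assms inner_adj[of T y x] by simp
  then show "capply (adj T) x \<bullet> y = capply S x \<bullet> y"
    by (simp only: inner_commute)
qed

lemma inner_adj_left: "capply (adj T) x \<bullet> y = x \<bullet> capply T y"
  unfolding inner_commute[of _ y] inner_commute[of x] by (rule inner_adj[symmetric])

lemma adj_adj [simp]: "adj (adj T) = T"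
  by (rule adj_unique) (rule inner_adj_left)

lemma adj_diff: "adj (S - T) = adj S - adj T"
  by (rule adj_unique) (simp add: inner_adj inner_diff_left inner_diff_right)

lemma norm_adj_le: "norm (adj T) \<le> norm T"
proof (rule norm_cblinfun_bound)
  fix y
  let ?z = "capply (adj T) y"
  show "norm ?z \<le> norm T * norm y"
  proof (cases "?z = 0")
    case False
    have "norm ?z * norm ?z = capply T ?z \<bullet> y"
      using inner_adj[of T ?z y] by (simp add: power2_norm_eq_inner[symmetric] power2_eq_square)
    also have "\<dots> \<le> norm (capply T ?z) * norm y"
      by (rule norm_cauchy_schwarz)
    also have "\<dots> \<le> norm T * norm ?z * norm y"
      by (intro mult_right_mono norm_capply_le) auto
    finally show ?thesis
      using False by (simp add: mult_ac)
  qed simp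
qed simp

lemma norm_adj [simp]: "norm (adj T) = norm T"
  by (metis adj_adj norm_adj_le order_antisym)

text \<open>Polarization of \<open>\<langle>T x, y\<rangle>\<close> for the vector \<open>y\<close> in the direction of \<open>T x\<close> that is as long as \<open>x\<close>.\<close>

lemma norm_le_numerical_radius:
  assumes sym: "\<And>x y. capply T x \<bullet> y = x \<bullet> capply T y"
    and K: "\<And>x. \<bar>capply T x \<bullet> x\<bar> \<le> K * (norm x)\<^sup>2" "0 \<le> K"
  shows "norm T \<le> K"
proof (rule norm_cblinfun_bound[OF K(2)])
  fix x
  show "norm (capply T x) \<le> K * norm x"
  proof (cases "x = 0 \<or> capply T x = 0")
    case False
    define y where "y = (norm x / norm (capply T x)) *\<^sub>R capply T x"
    have ny: "norm y = norm x"
      using False by (simp add: y_def)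
    have "4 * (capply T x \<bullet> y) =
        capply T (x + y) \<bullet> (x + y) - capply T (x - y) \<bullet> (x - y)"
      using sym[of x y]
      by (simp add: inner_add_left inner_add_right inner_diff_left inner_diff_right inner_commute)
    also have "\<dots> \<le> K * (norm (x + y))\<^sup>2 + K * (norm (x - y))\<^sup>2"
      using K(1)[of "x + y"] K(1)[of "x - y"] by linarith
    also have "\<dots> = K * (2 * (norm x)\<^sup>2 + 2 * (norm y)\<^sup>2)"
      unfolding power2_norm_eq_inner
      by (simp add: inner_add_left inner_add_right inner_diff_left inner_diff_right algebra_simps)
    finally have "capply T x \<bullet> y \<le> K * norm x * norm x"
      by (simp add: ny power2_eq_square)
    moreover have "capply T x \<bullet> y = norm (capply T x) * norm x"
      using False by (simp add: y_def power2_norm_eq_inner[symmetric] power2_eq_square)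
    ultimately show ?thesis
      using False by simp
  qed (auto simp: K)
qed

lemma cinverse_eqI:
  assumes "S \<circ>\<^sub>C T = cid" "T \<circ>\<^sub>C S = cid"
  shows "cinverse T = S"
  unfolding cinverse_def
proof (rule the_equality)
  fix S' assume "S' \<circ>\<^sub>C T = cid \<and> T \<circ>\<^sub>C S' = cid"
  then show "S' = S"
    by (metis assms(1) capply_ccompose capply_cid cblinfun_eqI)
qed (use assms in simp)

text \<open>Solving \<open>x = y + Y x\<close> by the contraction principle gives the inverse of \<open>1 - Y\<close> pointwise;
  uniqueness of the solution makes it linear.\<close>

lemma neumann_inverse:
  fixes Y :: "('a::chilbert_space, 'a) cblinfun"
  assumes Y: "norm Y < 1"
  obtains Z where "Z \<circ>\<^sub>C (cid - Y) = cid" "(cid - Y) \<circ>\<^sub>C Z = cid" "norm Z \<le> 1 / (1 - norm Y)"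
proof -
  have "\<exists>!x. y + capply Y x = x" for y
  proof (rule banach_fix_type)
    show "\<forall>x x'. dist (y + capply Y x) (y + capply Y x') \<le> norm Y * dist x x'"
      by (simp add: dist_norm capply_linear(2)[symmetric] norm_capply_le del: capply_linear)
  qed (use Y in auto)
  then obtain g where g: "\<And>y. y + capply Y (g y) = g y"
    and uniq: "\<And>y x. y + capply Y x = x \<Longrightarrow> x = g y"
    by metis
  have bound: "norm (g y) \<le> norm y * (1 / (1 - norm Y))" for y
  proof -
    have "norm (g y) \<le> norm y + norm (capply Y (g y))"
      by (metis g norm_triangle_ineq)
    also have "\<dots> \<le> norm y + norm Y * norm (g y)"
      using norm_capply_le by auto
    finally show ?thesis
      using Y by (simp add: field_simps)
  qed
  have Z: "capply (CBlinfun g) = g"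
  proof (rule capply_CBlinfun)
    show "bounded_linear g"
    proof (rule bounded_linear_intro[OF _ _ bound])
      show "g (x + y) = g x + g y" for x y
      proof (rule uniq[symmetric])
        have "x + y + capply Y (g x + g y) = (x + capply Y (g x)) + (y + capply Y (g y))"
          by simp
        then show "x + y + capply Y (g x + g y) = g x + g y"
          unfolding g .
      qed
      show "g (r *\<^sub>R x) = r *\<^sub>R g x" for r x
        by (rule uniq[symmetric]) (simp add: scaleR_add_right[symmetric] g)
    qed
    show "g (a *\<^sub>C x) = a *\<^sub>C g x" for a x
      by (rule uniq[symmetric]) (simp add: scaleC_add_right[symmetric] g)
  qed
  show ?thesis
  proof (rule that[of "CBlinfun g"])
    show "CBlinfun g \<circ>\<^sub>C (cid - Y) = cid"
      by (rule cblinfun_eqI) (auto simp: Z intro!: uniq[symmetric])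
    have "g x - capply Y (g x) = x" for x
      using g[of x] by (simp add: algebra_simps)
    then show "(cid - Y) \<circ>\<^sub>C CBlinfun g = cid"
      by (intro cblinfun_eqI) (simp add: Z)
    show "norm (CBlinfun g) \<le> 1 / (1 - norm Y)"
      by (rule norm_cblinfun_bound) (use Y bound in \<open>simp_all add: Z mult.commute\<close>)
  qed
qed

text \<open>The square root of the strictly positive operator \<open>1 - Q\<close> is \<open>1 - Y\<close>, where \<open>Y\<close> solves
  \<open>Y = (Q + Y\<^sup>2) / 2\<close>. On the ball of radius \<open>1 - (1 - \<parallel>Q\<parallel>)\<^sup>1\<^sup>/\<^sup>2\<close> the right-hand side is a
  contraction, and it preserves symmetry and commutation with anything that commutes with \<open>Q\<close>.\<close>

lemma sqrt_fixed_point: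
  fixes Q :: "('a::chilbert_space, 'a) cblinfun"
  assumes Q: "norm Q < 1" and sym: "\<And>x y. capply Q x \<bullet> y = x \<bullet> capply Q y"
  obtains Y where "norm Y < 1" "\<And>x y. capply Y x \<bullet> y = x \<bullet> capply Y y"
    "\<And>U. U \<circ>\<^sub>C Q = Q \<circ>\<^sub>C U \<Longrightarrow> U \<circ>\<^sub>C Y = Y \<circ>\<^sub>C U"
    "(cid - Y) \<circ>\<^sub>C (cid - Y) = cid - Q"
proof -
  define r where "r = 1 - sqrt (1 - norm Q)"
  have r: "0 \<le> r" "r < 1"
    using Q by (auto simp: r_def)
  have r2: "norm Q + r * r = 2 * r"
  proof -
    have "(1 - r) * (1 - r) = 1 - norm Q"
      using Q by (simp add: r_def)
    then show ?thesis by (simp add: algebra_simps)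
  qed
  define D where "D = {Y. norm Y \<le> r \<and> (\<forall>x y. capply Y x \<bullet> y = x \<bullet> capply Y y) \<and>
    (\<forall>U. U \<circ>\<^sub>C Q = Q \<circ>\<^sub>C U \<longrightarrow> (\<forall>x. capply U (capply Y x) = capply Y (capply U x)))}"
  define F where "F Y = (1/2) *\<^sub>R (Q + Y \<circ>\<^sub>C Y)" for Y
  have cont: "continuous_on UNIV (\<lambda>Y :: ('a, 'a) cblinfun. capply Y x)" for x
  proof -
    have "bounded_linear (\<lambda>Y :: ('a, 'a) cblinfun. capply Y x)"
      by (rule bounded_linear_intro[where K = "norm x"]) (auto simp: norm_capply_le)
    then show ?thesis
      by (rule linear_continuous_on)
  qed
  have "D = cball 0 r \<inter> (\<Inter>x. \<Inter>y. {Y. capply Y x \<bullet> y = x \<bullet> capply Y y}) \<inter>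
      (\<Inter>U\<in>{U. U \<circ>\<^sub>C Q = Q \<circ>\<^sub>C U}. \<Inter>x. {Y. capply U (capply Y x) = capply Y (capply U x)})"
    unfolding D_def by auto
  moreover have "continuous_on UNIV (\<lambda>Y. capply U (capply Y x))" for U :: "('a, 'a) cblinfun" and x :: 'a
    by (rule bounded_linear.continuous_on[OF bounded_linear_capply cont])
  ultimately have "closed D"
    by (auto intro!: closed_Int closed_INT closed_Collect_eq continuous_intros cont)
  then have "complete D"
    by (simp add: complete_eq_closed)
  moreover have "0 \<in> D"
    using r by (simp add: D_def)
  moreover have "F ` D \<subseteq> D"
  proof (rule image_subsetI)
    fix Y assume "Y \<in> D"
    then have Y: "norm Y \<le> r" and symY: "\<And>x y. capply Y x \<bullet> y = x \<bullet> capply Y y"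
      and comm: "\<And>U x. U \<circ>\<^sub>C Q = Q \<circ>\<^sub>C U \<Longrightarrow> capply U (capply Y x) = capply Y (capply U x)"
      unfolding D_def by blast+
    have "norm (Y \<circ>\<^sub>C Y) \<le> r * r"
      using norm_ccompose_le[of Y Y] mult_mono[OF Y Y] r(1) by simp
    then have "norm (Q + Y \<circ>\<^sub>C Y) \<le> 2 * r"
      using norm_triangle_ineq[of Q "Y \<circ>\<^sub>C Y"] r2 by linarith
    then have "norm (F Y) \<le> r"
      by (simp add: F_def)
    moreover have "capply (F Y) x \<bullet> y = x \<bullet> capply (F Y) y" for x y
      by (simp add: F_def inner_add_left inner_add_right sym symY)
    moreover have "capply U (capply (F Y) x) = capply (F Y) (capply U x)"
      if U: "U \<circ>\<^sub>C Q = Q \<circ>\<^sub>C U" for U x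
    proof -
      have "capply U (capply Q x) = capply Q (capply U x)"
        using U by (metis capply_ccompose)
      then show ?thesis
        by (simp add: F_def comm[OF U])
    qed
    ultimately show "F Y \<in> D"
      unfolding D_def by blast
  qed
  moreover have "dist (F Y) (F Y') \<le> r * dist Y Y'" if "Y \<in> D" "Y' \<in> D" for Y Y'
  proof -
    have "F Y - F Y' = (1/2) *\<^sub>R (Y \<circ>\<^sub>C (Y - Y') + (Y - Y') \<circ>\<^sub>C Y')"
      by (rule cblinfun_eqI) (simp add: F_def algebra_simps)
    then have "dist (F Y) (F Y') = (1/2) * norm (Y \<circ>\<^sub>C (Y - Y') + (Y - Y') \<circ>\<^sub>C Y')"
      by (simp add: dist_norm)
    also have "\<dots> \<le> (1/2) * (norm Y * norm (Y - Y') + norm (Y - Y') * norm Y')"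
      by (intro mult_left_mono norm_triangle_le add_mono norm_ccompose_le) simp
    also have "\<dots> \<le> (1/2) * (r * norm (Y - Y') + norm (Y - Y') * r)"
      using that by (intro mult_left_mono add_mono mult_mono) (auto simp: D_def r)
    finally show ?thesis
      by (simp add: dist_norm mult.commute)
  qed
  ultimately have "\<exists>!Y. Y \<in> D \<and> F Y = Y"
    by (intro Banach_fix[OF _ _ r]) auto
  then obtain Y where Y: "Y \<in> D" "F Y = Y"
    by blast
  show ?thesis
  proof (rule that[of Y])
    have "Q + Y \<circ>\<^sub>C Y = 2 *\<^sub>R Y"
      using arg_cong[OF Y(2), of "scaleR 2"] by (simp add: F_def)
    then have "capply (Q + Y \<circ>\<^sub>C Y) x = capply (2 *\<^sub>R Y) x" for x
      by simp
    then have "capply Q x + capply Y (capply Y x) = 2 *\<^sub>R capply Y x" for x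
      by simp
    then have *: "capply Y (capply Y x) = 2 *\<^sub>R capply Y x - capply Q x" for x
      by (simp add: eq_diff_eq add.commute)
    show "(cid - Y) \<circ>\<^sub>C (cid - Y) = cid - Q"
      by (rule cblinfun_eqI) (simp add: * scaleR_2 algebra_simps)
    show "U \<circ>\<^sub>C Y = Y \<circ>\<^sub>C U" if "U \<circ>\<^sub>C Q = Q \<circ>\<^sub>C U" for U
      using Y(1) that by (intro cblinfun_eqI) (auto simp: D_def)
  qed (use Y(1) r in \<open>auto simp: D_def\<close>)
qed

text \<open>Reality of \<open>\<langle>T x, x\<rangle>\<close> is the same as symmetry of \<open>T\<close>: polarize \<open>\<langle>T x, \<i> x\<rangle> = 0\<close>. This translates
  positivity to the real inner product.\<close>

lemma positive_op_iff:
  "positive_op T \<longleftrightarrow> (\<forall>x y. capply T x \<bullet> y = x \<bullet> capply T y) \<and> (\<forall>x. 0 \<le> capply T x \<bullet> x)"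
proof (intro iffI conjI allI)
  assume "positive_op T"
  then have im: "capply T x \<bullet> (\<i> *\<^sub>C x) = 0" and pos: "0 \<le> capply T x \<bullet> x" for x
    unfolding positive_op_def complex_is_Real_iff Im_cinner Re_cinner by blast+
  show "0 \<le> capply T x \<bullet> x" for x
    by (rule pos)
  have "capply T x \<bullet> (\<i> *\<^sub>C y) + capply T y \<bullet> (\<i> *\<^sub>C x) = 0" for x y
    using im[of "x + y"] im[of x] im[of y]
    by (simp add: scaleC_add_right inner_add_left inner_add_right)
  from this[of _ "- (\<i> *\<^sub>C y)" for y]
  show "capply T x \<bullet> y = x \<bullet> capply T y" for x y
    by (simp add: scaleC_scaleC inner_scaleC_left inner_commute)
next
  assume "(\<forall>x y. capply T x \<bullet> y = x \<bullet> capply T y) \<and> (\<forall>x. 0 \<le> capply T x \<bullet> x)"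
  then have sym: "\<And>x y. capply T x \<bullet> y = x \<bullet> capply T y" and pos: "\<And>x. 0 \<le> capply T x \<bullet> x"
    by blast+
  have "capply T x \<bullet> (\<i> *\<^sub>C x) = - (capply T x \<bullet> (\<i> *\<^sub>C x))" for x
  proof -
    have "capply T x \<bullet> (\<i> *\<^sub>C x) = x \<bullet> (\<i> *\<^sub>C capply T x)"
      using sym[of x "\<i> *\<^sub>C x"] by simp
    also have "\<dots> = (- \<i> *\<^sub>C x) \<bullet> capply T x"
      by (simp add: inner_scaleC_left)
    finally show ?thesis
      by (simp add: inner_commute)
  qed
  then show "positive_op T"
    unfolding positive_op_def complex_is_Real_iff Im_cinner Re_cinner using pos by simp
qed

text \<open>Uniqueness of the root: any positive root \<open>S'\<close> of \<open>1 - Q\<close> commutes with \<open>Q\<close>, hence with the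
  constructed root \<open>S\<close>, so \<open>(S + S') (S - S') = 0\<close>; and \<open>S + S'\<close> is bounded below.\<close>

lemma sqrt_op_cid_diff:
  fixes Q :: "('a::chilbert_space, 'a) cblinfun"
  assumes Q: "norm Q < 1" and sym: "\<And>x y. capply Q x \<bullet> y = x \<bullet> capply Q y"
  obtains Y where "norm Y < 1" "sqrt_op (cid - Q) = cid - Y"
    "\<And>x y. capply Y x \<bullet> y = x \<bullet> capply Y y" "(cid - Y) \<circ>\<^sub>C (cid - Y) = cid - Q"
proof -
  obtain Y where Y: "norm Y < 1" and symY: "\<And>x y. capply Y x \<bullet> y = x \<bullet> capply Y y"
    and comm: "\<And>U. U \<circ>\<^sub>C Q = Q \<circ>\<^sub>C U \<Longrightarrow> U \<circ>\<^sub>C Y = Y \<circ>\<^sub>C U"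
    and sq: "(cid - Y) \<circ>\<^sub>C (cid - Y) = cid - Q"
    using sqrt_fixed_point[OF Q sym] by blast
  let ?S = "cid - Y"
  have low: "(1 - norm Y) * (norm x)\<^sup>2 \<le> capply ?S x \<bullet> x" for x
  proof -
    have "capply Y x \<bullet> x \<le> norm (capply Y x) * norm x"
      by (rule norm_cauchy_schwarz)
    also have "\<dots> \<le> norm Y * norm x * norm x"
      by (intro mult_right_mono norm_capply_le) auto
    finally show ?thesis
      by (simp add: inner_diff_left power2_norm_eq_inner[symmetric] power2_eq_square algebra_simps)
  qed
  have "sqrt_op (cid - Q) = ?S"
    unfolding sqrt_op_def
  proof (rule the_equality, intro conjI sq)
    show "positive_op ?S"
      unfolding positive_op_iff
    proof (intro conjI allI)
      show "capply ?S x \<bullet> y = x \<bullet> capply ?S y" for x y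
        by (simp add: inner_diff_left inner_diff_right symY)
      show "0 \<le> capply ?S x \<bullet> x" for x
        by (rule order_trans[OF _ low]) (use Y in simp)
    qed
    fix S' assume S': "positive_op S' \<and> S' \<circ>\<^sub>C S' = cid - Q"
    have sq': "capply Q x = x - capply S' (capply S' x)" for x
    proof -
      have "capply (S' \<circ>\<^sub>C S') x = capply (cid - Q) x"
        using S' by simp
      then show ?thesis
        by simp
    qed
    have "S' \<circ>\<^sub>C Q = Q \<circ>\<^sub>C S'"
      by (rule cblinfun_eqI) (simp add: sq')
    from comm[OF this] have SS': "capply S' (capply Y x) = capply Y (capply S' x)" for x
      by (metis capply_ccompose)
    have sq0: "capply (?S \<circ>\<^sub>C ?S) x = capply (S' \<circ>\<^sub>C S') x" for x
      using sq S' by simp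
    show "S' = ?S"
    proof (rule cblinfun_eqI)
      fix x
      define d where "d = capply ?S x - capply S' x"
      have "capply ?S d + capply S' d = 0"
        using sq0[of x] by (simp add: d_def SS' algebra_simps)
      then have "capply ?S d \<bullet> d + capply S' d \<bullet> d = 0"
        unfolding inner_add_left[symmetric] by simp
      moreover have "0 \<le> capply S' d \<bullet> d"
        using S' unfolding positive_op_iff by blast
      ultimately have "(1 - norm Y) * (norm d)\<^sup>2 \<le> 0"
        using low[of d] by linarith
      then have "d = 0"
        using Y by (simp add: mult_le_0_iff)
      then show "capply S' x = capply ?S x"
        by (simp add: d_def)
    qed
  qed
  then show ?thesis
    using that Y symY sq by blast
qed

text \<open>Rescaling reduces to the square root of \<open>1 - Q\<close> with \<open>\<parallel>Q\<parallel> < 1\<close>. A factorization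
  \<open>M = S\<^sup>* S\<close> with invertible \<open>S\<close> is all that conjugation by \<open>M\<^sup>1\<^sup>/\<^sup>2\<close> requires.\<close>

lemma strictly_positive_sqrt:
  fixes M :: "('a::chilbert_space, 'a) cblinfun"
  assumes sym: "\<And>x y. capply M x \<bullet> y = x \<bullet> capply M y"
    and low: "\<And>x. e * (norm x)\<^sup>2 \<le> capply M x \<bullet> x" and e: "0 < e"
  obtains S S' :: "('a, 'a) cblinfun" where "S \<circ>\<^sub>C S' = cid" "S' \<circ>\<^sub>C S = cid"
    "\<And>x y. capply S x \<bullet> capply S y = capply M x \<bullet> y"
proof -
  \<comment> \<open>Then \<open>e/K \<le> M/K \<le> 1\<close>; the summand \<open>e\<close> makes \<open>K\<close> positive even if the space is zero.\<close>
  define K where "K = norm M + e"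
  have K: "0 < K" "e \<le> K"
    using e by (auto simp: K_def add_nonneg_pos)
  define Q where "Q = cid - (1 / K) *\<^sub>R M"
  have "norm Q \<le> 1 - e / K"
  proof (rule norm_le_numerical_radius)
    fix x
    have "capply M x \<bullet> x \<le> norm (capply M x) * norm x"
      by (rule norm_cauchy_schwarz)
    also have "\<dots> \<le> norm M * norm x * norm x"
      by (intro mult_right_mono norm_capply_le) auto
    also have "\<dots> \<le> K * (norm x)\<^sup>2"
      using e by (simp add: K_def power2_eq_square mult.assoc mult_right_mono)
    finally have "capply M x \<bullet> x / K \<le> (norm x)\<^sup>2"
      using K by (simp add: divide_simps mult.commute)
    moreover have "e / K * (norm x)\<^sup>2 \<le> capply M x \<bullet> x / K"
      using low[of x] K by (simp add: divide_right_mono)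
    moreover have "capply Q x \<bullet> x = (norm x)\<^sup>2 - capply M x \<bullet> x / K"
      by (simp add: Q_def inner_diff_left power2_norm_eq_inner)
    ultimately show "\<bar>capply Q x \<bullet> x\<bar> \<le> (1 - e / K) * (norm x)\<^sup>2"
      unfolding left_diff_distrib by linarith
  qed (use K sym in \<open>auto simp: Q_def inner_diff_left inner_diff_right\<close>)
  also have "\<dots> < 1"
    using K e by simp
  finally have Q1: "norm Q < 1" .
  have "capply Q x \<bullet> y = x \<bullet> capply Q y" for x y
    by (simp add: Q_def inner_diff_left inner_diff_right sym)
  then obtain Y where Y: "norm Y < 1" "\<And>x y. capply Y x \<bullet> y = x \<bullet> capply Y y"
    and sq: "(cid - Y) \<circ>\<^sub>C (cid - Y) = cid - Q"
    using sqrt_op_cid_diff[OF Q1] by blast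
  obtain Z where Z: "Z \<circ>\<^sub>C (cid - Y) = cid" "(cid - Y) \<circ>\<^sub>C Z = cid"
    using neumann_inverse[OF Y(1)] by blast
  have Z': "capply Z (capply (cid - Y) x) = x" "capply (cid - Y) (capply Z x) = x" for x
    by (metis Z capply_ccompose capply_cid)+
  show ?thesis
  proof (rule that[of "sqrt K *\<^sub>R (cid - Y)" "(1 / sqrt K) *\<^sub>R Z"])
    show "(sqrt K *\<^sub>R (cid - Y)) \<circ>\<^sub>C ((1 / sqrt K) *\<^sub>R Z) = cid"
      "((1 / sqrt K) *\<^sub>R Z) \<circ>\<^sub>C (sqrt K *\<^sub>R (cid - Y)) = cid"
      using K Z' by (auto intro!: cblinfun_eqI simp del: capply_simps(4))
    fix x y
    have "capply (cid - Y) x \<bullet> capply (cid - Y) y = capply ((cid - Y) \<circ>\<^sub>C (cid - Y)) x \<bullet> y"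
      by (simp add: inner_diff_left inner_diff_right Y(2))
    also have "\<dots> = (capply M x \<bullet> y) / K"
      unfolding sq by (simp add: Q_def)
    finally show "capply (sqrt K *\<^sub>R (cid - Y)) x \<bullet> capply (sqrt K *\<^sub>R (cid - Y)) y = capply M x \<bullet> y"
      using K by (simp add: mult.assoc[symmetric] del: capply_simps(4))
  qed
qed

section \<open>Coordinates on \<open>\<H> \<otimes> \<F>\<close>\<close>

text \<open>\<open>sgl w h\<close> is the elementary tensor \<open>h \<otimes> e\<^sub>w\<close> with a basis vector.\<close>

lift_definition sgl :: "'i \<Rightarrow> 'a \<Rightarrow> ('i, 'a::chilbert_space) ell2"
  is "\<lambda>i h j. if j = i then h else 0"
proof (rule finite_nonzero_values_imp_summable_on)
  fix i :: 'i and h :: 'a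
  show "finite {x \<in> UNIV. (norm (if x = i then h else 0))\<^sup>2 \<noteq> 0}"
    by (rule finite_subset[of _ "{i}"]) auto
qed

lemma coord_sgl [simp]: "coord (sgl i h) j = (if j = i then h else 0)"
  by (simp add: sgl.rep_eq)

lemma coord_sum [simp]: "coord (\<Sum>k\<in>A. f k) i = (\<Sum>k\<in>A. coord (f k) i)"
  by (induction A rule: infinite_finite_induct) auto

lemma inner_ell2_infsum: "f \<bullet> g = (\<Sum>\<^sub>\<infinity>i. coord f i \<bullet> coord g i)"
  unfolding inner_ell2_def infsum_Re[OF summable_cinner[OF coord_summable coord_summable], symmetric]
  by (simp add: Re_cinner)

lemma inner_sgl_right [simp]: "f \<bullet> sgl i h = coord f i \<bullet> h"
proof -
  have "f \<bullet> sgl i h = (\<Sum>\<^sub>\<infinity>j\<in>{i}. coord f j \<bullet> coord (sgl i h) j)"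
    unfolding inner_ell2_infsum by (rule infsum_cong_neutral) auto
  then show ?thesis
    by simp
qed

lemma inner_sgl_left [simp]: "sgl i h \<bullet> f = h \<bullet> coord f i"
  using inner_sgl_right[of f i h] by (simp only: inner_commute)

lemma norm_sgl [simp]: "norm (sgl i h) = norm h"
  by (simp add: norm_eq_sqrt_inner)

lemma sgl_scaleC: "sgl i (a *\<^sub>C x) = a *\<^sub>C sgl i x"
  by (rule ell2_eqI) simp

text \<open>The squared distance of \<open>x\<close> to a finite section is the corresponding tail of \<open>\<Sum> \<parallel>x\<^sub>i\<parallel>\<^sup>2\<close>.\<close>

lemma finite_sections_tendsto:
  "((\<lambda>F. \<Sum>i\<in>F. sgl i (coord x i)) \<longlongrightarrow> x) (finite_subsets_at_top UNIV)"
proof -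
  have eq: "(dist (\<Sum>i\<in>F. sgl i (coord x i)) x)\<^sup>2 = (norm x)\<^sup>2 - (\<Sum>i\<in>F. (norm (coord x i))\<^sup>2)"
    if "finite F" for F
  proof -
    define s where "s = (\<Sum>i\<in>F. sgl i (coord x i))"
    have c: "coord s i = (if i \<in> F then coord x i else 0)" for i
      using that by (simp add: s_def sum.delta)
    have "x \<bullet> s = (\<Sum>i\<in>F. (norm (coord x i))\<^sup>2)"
      by (simp add: s_def inner_sum_right power2_norm_eq_inner)
    moreover have "s \<bullet> s = (\<Sum>i\<in>F. (norm (coord x i))\<^sup>2)"
      by (subst (2) s_def) (simp add: inner_sum_right power2_norm_eq_inner c)
    ultimately have "(dist s x)\<^sup>2 = (norm x)\<^sup>2 - (\<Sum>i\<in>F. (norm (coord x i))\<^sup>2)"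
      unfolding dist_norm power2_norm_eq_inner[of "s - x"] power2_norm_eq_inner[of x]
      by (simp add: inner_diff_left inner_diff_right inner_commute)
    then show ?thesis
      by (simp add: s_def)
  qed
  have "((\<lambda>F. \<Sum>i\<in>F. (norm (coord x i))\<^sup>2) \<longlongrightarrow> (norm x)\<^sup>2) (finite_subsets_at_top UNIV)"
    unfolding norm_ell2_squared using has_sum_infsum[OF coord_summable[of x]] has_sum_def by blast
  from tendsto_diff[OF tendsto_const[of "(norm x)\<^sup>2"] this]
  have "((\<lambda>F. (norm x)\<^sup>2 - (\<Sum>i\<in>F. (norm (coord x i))\<^sup>2)) \<longlongrightarrow> 0) (finite_subsets_at_top UNIV)"
    by simp
  moreover have "\<forall>\<^sub>F F in finite_subsets_at_top UNIV.
      (norm x)\<^sup>2 - (\<Sum>i\<in>F. (norm (coord x i))\<^sup>2) = (dist (\<Sum>i\<in>F. sgl i (coord x i)) x)\<^sup>2"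
    using eq by (intro eventually_finite_subsets_at_top_weakI) simp
  ultimately have "((\<lambda>F. (dist (\<Sum>i\<in>F. sgl i (coord x i)) x)\<^sup>2) \<longlongrightarrow> 0) (finite_subsets_at_top UNIV)"
    by (rule Lim_transform_eventually)
  from tendsto_real_sqrt[OF this] show ?thesis
    by (subst tendsto_dist_iff) simp
qed

text \<open>Both families of creation operators copy coordinates along an injection of the index set.\<close>

lemma inner_push:
  assumes "inj \<iota>" "\<And>w. coord F (\<iota> w) = coord f w" "\<And>w. coord G (\<iota> w) = coord g w"
    "\<And>v. v \<notin> range \<iota> \<Longrightarrow> coord F v = 0"
  shows "F \<bullet> G = f \<bullet> g"
proof -
  have "F \<bullet> G = (\<Sum>\<^sub>\<infinity>v\<in>range \<iota>. coord F v \<bullet> coord G v)"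
    unfolding inner_ell2_infsum by (rule infsum_cong_neutral) (use assms(4) in auto)
  also have "\<dots> = (\<Sum>\<^sub>\<infinity>w. (coord F (\<iota> w)) \<bullet> coord G (\<iota> w))"
    by (subst infsum_reindex[OF assms(1)]) (simp add: o_def)
  finally show ?thesis
    by (simp add: assms(2,3) inner_ell2_infsum)
qed

lemma inner_create_fun: "create_fun i f \<bullet> create_fun j g = (if i = j then f \<bullet> g else 0)"
proof (cases "i = j")
  case True
  have "create_fun j f \<bullet> create_fun j g = f \<bullet> g"
    by (rule inner_push[OF inj_snoc[of j]]) (auto simp: create_fun.rep_eq snoc_word_cases)
  then show ?thesis
    using True by simp
next
  case False
  then show ?thesis
    unfolding inner_ell2_infsum by (auto simp: create_fun.rep_eq intro!: infsum_0)
qed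

lemma cons_word_cases: "v \<in> range (Cons i) \<longleftrightarrow> v \<noteq> [] \<and> hd v = i"
  by (cases v) auto

lift_definition left_create_fun :: "'n \<Rightarrow> ('n list, 'h::chilbert_space) ell2 \<Rightarrow> ('n list, 'h) ell2"
  is "\<lambda>i f v. if v \<noteq> [] \<and> hd v = i then f (tl v) else 0"
proof -
  fix i :: 'n and f :: "'n list \<Rightarrow> 'h"
  assume f: "(\<lambda>i. (norm (f i))\<^sup>2) summable_on UNIV"
  let ?g = "\<lambda>v. if v \<noteq> [] \<and> hd v = i then f (tl v) else 0"
  have "(\<lambda>v. (norm (?g v))\<^sup>2) summable_on range (Cons i)"
    by (subst summable_on_reindex) (use f in \<open>simp_all add: o_def\<close>)
  also have "(\<lambda>v. (norm (?g v))\<^sup>2) summable_on range (Cons i) \<longleftrightarrow>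
      (\<lambda>v. (norm (?g v))\<^sup>2) summable_on UNIV"
    by (rule summable_on_cong_neutral) (auto simp: cons_word_cases)
  finally show "(\<lambda>v. (norm (?g v))\<^sup>2) summable_on UNIV" .
qed

lemma inner_left_create_fun:
  "left_create_fun i f \<bullet> left_create_fun j g = (if i = j then f \<bullet> g else 0)"
proof (cases "i = j")
  case True
  have "left_create_fun j f \<bullet> left_create_fun j g = f \<bullet> g"
    by (rule inner_push[of "Cons j"]) (auto simp: left_create_fun.rep_eq cons_word_cases)
  then show ?thesis
    using True by simp
next
  case False
  then show ?thesis
    unfolding inner_ell2_infsum by (auto simp: left_create_fun.rep_eq intro!: infsum_0)
qed

definition left_create :: "'n \<Rightarrow> (('n list, 'h::chilbert_space) ell2, ('n list, 'h) ell2) cblinfun"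
  where "left_create i = CBlinfun (left_create_fun i)"

lemma capply_left_create: "capply (left_create i) = left_create_fun i"
  unfolding left_create_def
proof (rule capply_CBlinfun)
  show "bounded_linear (left_create_fun i :: (_, 'b) ell2 \<Rightarrow> _)"
  proof (rule bounded_linear_intro[where K = 1])
    fix f g :: "('a list, 'b) ell2" and r :: real
    show "left_create_fun i (f + g) = left_create_fun i f + left_create_fun i g"
      by (rule ell2_eqI) (simp add: left_create_fun.rep_eq)
    show "left_create_fun i (r *\<^sub>R f) = r *\<^sub>R left_create_fun i f"
      by (rule ell2_eqI) (simp add: left_create_fun.rep_eq)
    show "norm (left_create_fun i f) \<le> norm f * 1"
      by (simp add: norm_eq_sqrt_inner inner_left_create_fun)
  qed
  show "left_create_fun i (a *\<^sub>C f) = a *\<^sub>C left_create_fun i f" for a and f :: "('a list, 'b) ell2"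
    by (rule ell2_eqI) (simp add: left_create_fun.rep_eq)
qed

lemma left_create_sgl: "capply (left_create i) (sgl w h) = sgl (i # w) h"
  by (rule ell2_eqI, simp add: capply_left_create left_create_fun.rep_eq)
    (metis list.collapse list.sel)

lemma coord_ampl [simp]: "coord (capply (ampl T) f) i = capply T (coord f i)"
  by (simp add: capply_ampl ampl_fun.rep_eq)

lemma inner_ampl: "capply (ampl T) f \<bullet> g = f \<bullet> capply (ampl (adj T)) g"
  unfolding inner_ell2_infsum coord_ampl inner_adj ..

lemma norm_ampl_le: "norm (capply (ampl T) f) \<le> norm T * norm f"
proof (rule power2_le_imp_le)
  have "(norm (capply (ampl T) f))\<^sup>2 \<le> (\<Sum>\<^sub>\<infinity>i. (norm T)\<^sup>2 * (norm (coord f i))\<^sup>2)"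
    unfolding norm_ell2_squared
  proof (rule infsum_mono[OF coord_summable])
    show "(\<lambda>i. (norm T)\<^sup>2 * (norm (coord f i))\<^sup>2) summable_on UNIV"
      by (intro summable_on_cmult_right coord_summable)
    show "(norm (coord (capply (ampl T) f) i))\<^sup>2 \<le> (norm T)\<^sup>2 * (norm (coord f i))\<^sup>2" for i
      unfolding power_mult_distrib[symmetric] coord_ampl
      by (intro power_mono norm_capply_le) auto
  qed
  also have "\<dots> = (norm T * norm f)\<^sup>2"
    unfolding power_mult_distrib norm_ell2_squared infsum_cmult_right' ..
  finally show "(norm (capply (ampl T) f))\<^sup>2 \<le> (norm T * norm f)\<^sup>2" .
qed simp

section \<open>The reconstruction operator and the Poisson form\<close>

lemma coord_reconstruction:
  "coord (capply (reconstruction X) u) v =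
    (if v = [] then 0 else capply (adj (X $ last v)) (coord u (butlast v)))"
proof (cases "v = []")
  case True
  then show ?thesis
    by (simp add: reconstruction_def capply_sum capply_right_create create_fun.rep_eq)
next
  case False
  have "coord (capply (reconstruction X) u) v =
      (\<Sum>i\<in>UNIV. if last v = i then capply (adj (X $ i)) (coord u (butlast v)) else 0)"
    unfolding reconstruction_def capply_sum coord_sum
    by (rule sum.cong) (use False in \<open>auto simp: capply_right_create create_fun.rep_eq\<close>)
  also have "\<dots> = capply (adj (X $ last v)) (coord u (butlast v))"
    by (simp add: sum.delta')
  finally show ?thesis
    using False by simp
qed

lemma reconstruction_diff: "reconstruction (X - Y) = reconstruction X - reconstruction Y"
  by (intro cblinfun_eqI ell2_eqI) (simp add: coord_reconstruction adj_diff)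

lemma inner_reconstruction:
  fixes X Y :: "('h::chilbert_space, 'n::finite) optuple"
  shows "capply (reconstruction X) u \<bullet> capply (reconstruction Y) v =
    (\<Sum>i\<in>UNIV. capply (ampl (adj (X $ i))) u \<bullet> capply (ampl (adj (Y $ i))) v)"
proof -
  have eq: "capply (reconstruction X) u = (\<Sum>i\<in>UNIV. create_fun i (capply (ampl (adj (X $ i))) u))"
    for X :: "('h, 'n) optuple" and u
  proof (rule ell2_eqI)
    fix v
    show "coord (capply (reconstruction X) u) v =
        coord (\<Sum>i\<in>UNIV. create_fun i (capply (ampl (adj (X $ i))) u)) v"
      by (cases "v = []") (simp_all add: coord_reconstruction create_fun.rep_eq sum.delta')
  qed
  show ?thesis
    unfolding eq inner_sum_left inner_sum_right inner_create_fun by (simp add: sum.delta')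
qed

text \<open>\<open>R\<^sub>X\<^sup>* R\<^sub>X = (\<Sum>X\<^sub>iX\<^sub>i\<^sup>*) \<otimes> I\<close>, because the creation operators are isometries with orthogonal ranges.\<close>

lemma inner_reconstruction_self:
  "capply (reconstruction X) u \<bullet> capply (reconstruction X) v =
    capply (ampl (\<Sum>i\<in>UNIV. X $ i \<circ>\<^sub>C adj (X $ i))) u \<bullet> v"
proof -
  have "capply (ampl (\<Sum>i\<in>UNIV. X $ i \<circ>\<^sub>C adj (X $ i))) u =
      (\<Sum>i\<in>UNIV. capply (ampl (X $ i)) (capply (ampl (adj (X $ i))) u))"
    by (rule ell2_eqI) (simp add: capply_sum)
  then show ?thesis
    unfolding inner_reconstruction by (simp add: inner_sum_left inner_ampl)
qed

lemma row_square_sym: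
  "capply (\<Sum>i\<in>UNIV. X $ i \<circ>\<^sub>C adj (X $ i)) x \<bullet> y = x \<bullet> capply (\<Sum>i\<in>UNIV. X $ i \<circ>\<^sub>C adj (X $ i)) y"
  by (simp add: capply_sum inner_sum_left inner_sum_right inner_adj inner_adj_left)

lemma row_norm_nonneg: "0 \<le> row_norm X"
  by (simp add: row_norm_def)

text \<open>Amplification does not increase the norm, which gives one inequality from
  \<open>R\<^sub>X\<^sup>* R\<^sub>X = (\<Sum>X\<^sub>iX\<^sub>i\<^sup>*) \<otimes> I\<close>; evaluation at the vectors \<open>h \<otimes> 1\<close> gives the other. In particular the
  row norm is a norm.\<close>

lemma norm_reconstruction:
  fixes X :: "('h::chilbert_space, 'n::finite) optuple"
  shows "norm (reconstruction X) = row_norm X"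
proof (rule order_antisym)
  let ?Q = "\<Sum>i\<in>UNIV. X $ i \<circ>\<^sub>C adj (X $ i)"
  have rn: "norm ?Q = (row_norm X)\<^sup>2"
    by (simp add: row_norm_def)
  show "norm (reconstruction X) \<le> row_norm X"
  proof (rule norm_cblinfun_bound[OF row_norm_nonneg], rule power2_le_imp_le)
    fix u
    have "(norm (capply (reconstruction X) u))\<^sup>2 = capply (ampl ?Q) u \<bullet> u"
      by (simp only: power2_norm_eq_inner inner_reconstruction_self)
    also have "\<dots> \<le> norm (capply (ampl ?Q) u) * norm u"
      by (rule norm_cauchy_schwarz)
    also have "\<dots> \<le> norm ?Q * norm u * norm u"
      by (intro mult_right_mono norm_ampl_le) auto
    finally show "(norm (capply (reconstruction X) u))\<^sup>2 \<le> (row_norm X * norm u)\<^sup>2"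
      by (simp add: rn power2_eq_square mult_ac)
  qed (simp add: row_norm_nonneg)
  have "norm ?Q \<le> (norm (reconstruction X))\<^sup>2"
  proof (rule norm_le_numerical_radius)
    fix h
    have *: "capply ?Q h \<bullet> h = (norm (capply (reconstruction X) (sgl [] h)))\<^sup>2"
      unfolding power2_norm_eq_inner inner_reconstruction_self by simp
    have "(norm (capply (reconstruction X) (sgl [] h)))\<^sup>2 \<le>
        (norm (reconstruction X) * norm (sgl [] h :: ('n list, 'h) ell2))\<^sup>2"
      by (intro power_mono norm_capply_le) auto
    then show "\<bar>capply ?Q h \<bullet> h\<bar> \<le> (norm (reconstruction X))\<^sup>2 * (norm h)\<^sup>2"
      unfolding * by (simp add: power_mult_distrib)
  qed (simp_all add: row_square_sym)
  then show "row_norm X \<le> norm (reconstruction X)"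
    unfolding rn by (rule power2_le_imp_le) simp
qed

definition resolvent :: "('h::chilbert_space, 'n::finite) optuple \<Rightarrow>
    (('n list, 'h) ell2, ('n list, 'h) ell2) cblinfun"
  where "resolvent X = cinverse (cid - reconstruction X)"

lemma resolvent_properties:
  assumes "X \<in> op_ball"
  shows resolvent_comp: "resolvent X \<circ>\<^sub>C (cid - reconstruction X) = cid"
    and comp_resolvent: "(cid - reconstruction X) \<circ>\<^sub>C resolvent X = cid"
    and norm_resolvent: "norm (resolvent X) \<le> 1 / (1 - row_norm X)"
proof -
  have "norm (reconstruction X) < 1"
    using assms by (simp add: norm_reconstruction op_ball_def)
  then obtain Z where Z: "Z \<circ>\<^sub>C (cid - reconstruction X) = cid" "(cid - reconstruction X) \<circ>\<^sub>C Z = cid"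
    "norm Z \<le> 1 / (1 - norm (reconstruction X))"
    by (rule neumann_inverse)
  then have "resolvent X = Z"
    unfolding resolvent_def by (intro cinverse_eqI)
  with Z show "resolvent X \<circ>\<^sub>C (cid - reconstruction X) = cid" "(cid - reconstruction X) \<circ>\<^sub>C resolvent X = cid"
    "norm (resolvent X) \<le> 1 / (1 - row_norm X)"
    by (simp_all add: norm_reconstruction)
qed

lemma resolvent_eqI:
  assumes "X \<in> op_ball" "u = x + capply (reconstruction X) u"
  shows "capply (resolvent X) x = u"
proof -
  have "x = capply (cid - reconstruction X) u"
    using assms(2) by (simp add: algebra_simps)
  then have "capply (resolvent X) x = capply (resolvent X \<circ>\<^sub>C (cid - reconstruction X)) u"
    by simp
  then show ?thesis
    unfolding resolvent_comp[OF assms(1)] by simp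
qed

lemma resolvent_unfold:
  assumes "X \<in> op_ball"
  shows "capply (resolvent X) x = x + capply (reconstruction X) (capply (resolvent X) x)"
proof -
  have "capply ((cid - reconstruction X) \<circ>\<^sub>C resolvent X) x = x"
    unfolding comp_resolvent[OF assms] by simp
  then show ?thesis
    by (simp add: algebra_simps)
qed

lemma coord_resolvent:
  assumes "X \<in> op_ball"
  shows "coord (capply (resolvent X) x) v = coord x v +
    (if v = [] then 0 else capply (adj (X $ last v)) (coord (capply (resolvent X) x) (butlast v)))"
  by (subst resolvent_unfold[OF assms]) (simp add: coord_reconstruction)

lemma defect_sqrt:
  assumes "X \<in> op_ball"
  obtains D' where "D' \<circ>\<^sub>C defect X = cid" "defect X \<circ>\<^sub>C D' = cid"
    "\<And>x y. capply (defect X) x \<bullet> y = x \<bullet> capply (defect X) y"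
    "defect X \<circ>\<^sub>C defect X = cid - (\<Sum>i\<in>UNIV. X $ i \<circ>\<^sub>C adj (X $ i))"
proof -
  have "norm (\<Sum>i\<in>UNIV. X $ i \<circ>\<^sub>C adj (X $ i)) < 1"
    using assms by (simp add: op_ball_def row_norm_def)
  from sqrt_op_cid_diff[OF this row_square_sym]
  obtain Y where Y: "norm Y < 1" "defect X = cid - Y"
    "\<And>x y. capply Y x \<bullet> y = x \<bullet> capply Y y"
    "(cid - Y) \<circ>\<^sub>C (cid - Y) = cid - (\<Sum>i\<in>UNIV. X $ i \<circ>\<^sub>C adj (X $ i))"
    unfolding defect_def by blast
  obtain Z where "Z \<circ>\<^sub>C (cid - Y) = cid" "(cid - Y) \<circ>\<^sub>C Z = cid"
    using neumann_inverse[OF Y(1)] by blast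
  then show ?thesis
    using that[of Z] Y by (simp add: inner_diff_left inner_diff_right)
qed

text \<open>This makes \<open>cinverse (kernel_C X)\<close> meaningful: both factors of \<open>C\<^sub>X\<close> are invertible.\<close>

lemma kernel_C_invertible:
  fixes X :: "('h::chilbert_space, 'n::finite) optuple"
  assumes "X \<in> op_ball"
  obtains K where "K \<circ>\<^sub>C kernel_C X = cid" "kernel_C X \<circ>\<^sub>C K = cid"
proof -
  obtain D' where D: "D' \<circ>\<^sub>C defect X = cid" "defect X \<circ>\<^sub>C D' = cid"
    by (rule defect_sqrt[OF assms])
  have D': "capply D' (capply (defect X) x) = x" "capply (defect X) (capply D' x) = x" for x
    by (metis D capply_ccompose capply_cid)+
  have R: "capply (resolvent X) (capply (cid - reconstruction X) x) = x"
    "capply (cid - reconstruction X) (capply (resolvent X) x) = x" for x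
    by (metis resolvent_comp[OF assms] comp_resolvent[OF assms] capply_ccompose capply_cid)+
  have A: "capply (ampl D') (capply (ampl (defect X)) u) = u"
    "capply (ampl (defect X)) (capply (ampl D') u) = u" for u :: "('n list, 'h) ell2"
    by (rule ell2_eqI, simp add: D')+
  show ?thesis
    by (rule that[of "(cid - reconstruction X) \<circ>\<^sub>C ampl D'"]; rule cblinfun_eqI)
      (simp_all add: kernel_C_def resolvent_def[symmetric] A R del: capply_simps(4))
qed

text \<open>The real part of \<open>\<langle>P(X) x, y\<rangle>\<close> for the Poisson kernel \<open>P(X) = C\<^sub>X\<^sup>* C\<^sub>X\<close>.\<close>

definition poisson :: "('h::chilbert_space, 'n::finite) optuple \<Rightarrow>
    ('n list, 'h) ell2 \<Rightarrow> ('n list, 'h) ell2 \<Rightarrow> real"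
  where "poisson X x y = capply (kernel_C X) x \<bullet> capply (kernel_C X) y"

lemma poisson_self: "poisson X x x = (norm (capply (kernel_C X) x))\<^sup>2"
  by (simp add: poisson_def power2_norm_eq_inner)

lemma poisson_defect:
  fixes X :: "('h::chilbert_space, 'n::finite) optuple"
  assumes "X \<in> op_ball"
  shows "poisson X x y = capply (resolvent X) x \<bullet> capply (resolvent X) y -
    capply (reconstruction X) (capply (resolvent X) x) \<bullet> capply (reconstruction X) (capply (resolvent X) y)"
proof -
  let ?D = "defect X"
  have sym: "\<And>x y. capply ?D x \<bullet> y = x \<bullet> capply ?D y"
    and sq: "?D \<circ>\<^sub>C ?D = cid - (\<Sum>i\<in>UNIV. X $ i \<circ>\<^sub>C adj (X $ i))"
    by (rule defect_sqrt[OF assms]; blast)+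
  have "adj ?D = ?D"
    by (rule adj_unique[OF sym])
  then have "capply (ampl ?D) u \<bullet> capply (ampl ?D) v = capply (ampl ?D) (capply (ampl ?D) u) \<bullet> v"
    for u v :: "('n list, 'h) ell2"
    by (simp add: inner_ampl)
  moreover have "capply (ampl ?D) (capply (ampl ?D) u) = capply (ampl (?D \<circ>\<^sub>C ?D)) u"
    for u :: "('n list, 'h) ell2"
    by (rule ell2_eqI) simp
  moreover have "capply (ampl (cid - T)) u = u - capply (ampl T) u"
    for u :: "('n list, 'h) ell2" and T
    by (rule ell2_eqI) simp
  ultimately show ?thesis
    unfolding poisson_def kernel_C_def inner_reconstruction_self resolvent_def[symmetric]
    by (simp add: sq inner_diff_left)
qed

text \<open>Substitute \<open>R\<^sub>X u = u - x\<close> for \<open>u = (I - R\<^sub>X)\<^sup>-\<^sup>1 x\<close>, and similarly for \<open>y\<close>. The result is linear in the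
  resolvent, whose entries are explicit.\<close>

lemma poisson_eq:
  assumes "X \<in> op_ball"
  shows "poisson X x y = capply (resolvent X) x \<bullet> y + x \<bullet> capply (resolvent X) y - x \<bullet> y"
proof -
  have R: "capply (reconstruction X) (capply (resolvent X) x) = capply (resolvent X) x - x" for x
    using resolvent_unfold[OF assms, of x] by (simp add: algebra_simps)
  show ?thesis
    unfolding poisson_defect[OF assms] R by (simp add: inner_diff_left inner_diff_right)
qed

lemma poisson_sum: "poisson X (\<Sum>i\<in>A. f i) y = (\<Sum>i\<in>A. poisson X (f i) y)"
  "poisson X x (\<Sum>i\<in>A. f i) = (\<Sum>i\<in>A. poisson X x (f i))"
  by (simp_all add: poisson_def inner_sum_left inner_sum_right)

lemma op_word_Cons: "op_word X (i # w) = X $ i \<circ>\<^sub>C op_word X w" and op_word_Nil: "op_word X [] = cid"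
  by (simp_all add: op_word_def)

lemma op_word_append: "op_word X (v @ w) = op_word X v \<circ>\<^sub>C op_word X w"
  by (induction v) (auto simp: op_word_Cons op_word_Nil intro!: cblinfun_eqI)

text \<open>By recursion on the word: \<open>u = x + R\<^sub>X u\<close> determines each coordinate of \<open>u = (I - R\<^sub>X)\<^sup>-\<^sup>1 x\<close> from the
  coordinate at the word without its last letter.\<close>

lemma inner_coord_resolvent_sgl:
  assumes "X \<in> op_ball"
  shows "coord (capply (resolvent X) (sgl b h)) v \<bullet> k =
    (if \<exists>g. v = b @ g then h \<bullet> capply (op_word X (drop (length b) v)) k else 0)"
proof (induction v arbitrary: k rule: rev_induct)
  case Nil
  then show ?case
    by (subst coord_resolvent[OF assms]) (auto simp: op_word_Nil)
next
  case (snoc i v)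
  have "coord (capply (resolvent X) (sgl b h)) (v @ [i]) \<bullet> k =
      (if v @ [i] = b then h \<bullet> k else 0) + coord (capply (resolvent X) (sgl b h)) v \<bullet> capply (X $ i) k"
    by (subst coord_resolvent[OF assms]) (simp add: inner_add_left inner_adj_left)
  also have "\<dots> = (if \<exists>g. v @ [i] = b @ g
      then h \<bullet> capply (op_word X (drop (length b) (v @ [i]))) k else 0)"
  proof (cases "v @ [i] = b")
    case True
    then have "\<not> (\<exists>g. v = b @ g)"
      by (metis append_assoc append_self_conv not_Cons_self2 append_is_Nil_conv)
    then show ?thesis
      using True by (auto simp: snoc.IH op_word_Nil)
  next
    case False
    have "(\<exists>g. v @ [i] = b @ g) \<longleftrightarrow> (\<exists>g. v = b @ g)"
      using False by (metis append_assoc append_self_conv butlast_append butlast_snoc)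
    then show ?thesis
      using False by (auto simp: snoc.IH op_word_append op_word_Cons op_word_Nil)
  qed
  finally show ?case .
qed

lemma poisson_vacuum:
  assumes "X \<in> op_ball"
  shows "poisson X (sgl g h) (sgl [] k) = capply (op_word X g) h \<bullet> k"
proof -
  have 1: "coord (capply (resolvent X) (sgl g h)) [] \<bullet> k = (if g = [] then h \<bullet> k else 0)"
    by (auto simp: inner_coord_resolvent_sgl[OF assms] op_word_Nil)
  have "coord (capply (resolvent X) (sgl [] k)) g \<bullet> h = k \<bullet> capply (op_word X g) h"
    by (simp add: inner_coord_resolvent_sgl[OF assms])
  then show ?thesis
    unfolding poisson_eq[OF assms] using 1 by (simp add: inner_commute)
qed

text \<open>\<open>R\<^sub>X\<close> acts at the right end of words and \<open>L\<^sub>i\<close> at the left end, so they commute.\<close>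

lemma resolvent_left_create:
  assumes "X \<in> op_ball"
  shows "capply (resolvent X) (capply (left_create i) x) = capply (left_create i) (capply (resolvent X) x)"
proof (rule resolvent_eqI[OF assms])
  have "capply (reconstruction X) (capply (left_create i) u) =
      capply (left_create i) (capply (reconstruction X) u)" for u
  proof (rule ell2_eqI)
    fix v
    show "coord (capply (reconstruction X) (capply (left_create i) u)) v =
        coord (capply (left_create i) (capply (reconstruction X) u)) v"
    proof (cases v)
      case (Cons j w)
      then show ?thesis
        by (cases w) (auto simp: coord_reconstruction capply_left_create left_create_fun.rep_eq)
    qed (simp add: coord_reconstruction capply_left_create left_create_fun.rep_eq)
  qed
  then show "capply (left_create i) (capply (resolvent X) x) = capply (left_create i) x +
      capply (reconstruction X) (capply (left_create i) (capply (resolvent X) x))"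
    by (metis capply_linear(1) resolvent_unfold[OF assms])
qed

lemma poisson_toeplitz:
  assumes "X \<in> op_ball"
  shows "poisson X (capply (left_create i) x) (capply (left_create j) y) =
    (if i = j then poisson X x y else 0)"
  unfolding poisson_eq[OF assms] resolvent_left_create[OF assms]
  by (simp add: capply_left_create inner_left_create_fun)

section \<open>Polynomials with positive real part\<close>

text \<open>The form of the Hermitian matrix \<open>\<Re> p(X)\<close> is the real part of the form of \<open>p(X)\<close>. Working with the
  latter removes adjoints and complex numbers from all inequalities between real parts.\<close>

definition polyform :: "nat \<Rightarrow> (nat \<Rightarrow> nat \<Rightarrow> 'n ncpoly) \<Rightarrow> ('h::chilbert_space, 'n::finite) optuple \<Rightarrow>
    (nat \<Rightarrow> 'h) \<Rightarrow> real"
  where "polyform m p X x = (\<Sum>i<m. \<Sum>j<m. capply (eval_ncpoly (p i j) X) (x j) \<bullet> x i)"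

lemma cinner_re_ncpoly:
  "(\<Sum>i<m. cinner (\<Sum>j<m. capply (re_ncpoly p X i j) (x j)) (x i)) = complex_of_real (polyform m p X x)"
proof -
  have half: "(1/2) * (z + cnj z) = complex_of_real (Re z)" for z
    by (simp add: complex_add_cnj)
  define a where "a i j = cinner (capply (eval_ncpoly (p i j) X) (x j)) (x i)" for i j
  have "cinner (capply (re_ncpoly p X i j) (x j)) (x i) = (1/2) * (a i j + cnj (a j i))" for i j
  proof -
    have "cinner (capply (adj (eval_ncpoly (p j i) X)) (x j)) (x i) = cnj (a j i)"
      unfolding a_def by (subst cinner_commute) (simp add: cinner_adj)
    then show ?thesis
      by (simp add: re_ncpoly_def a_def scaleR_scaleC cinner_scaleC_left cinner_add_left)
  qed
  then have "(\<Sum>i<m. cinner (\<Sum>j<m. capply (re_ncpoly p X i j) (x j)) (x i)) =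
      (1/2) * ((\<Sum>i<m. \<Sum>j<m. a i j) + (\<Sum>i<m. \<Sum>j<m. cnj (a j i)))"
    by (simp only: cinner_sum_left sum_distrib_left[symmetric] sum.distrib)
  also have "(\<Sum>i<m. \<Sum>j<m. cnj (a j i)) = cnj (\<Sum>i<m. \<Sum>j<m. a i j)"
    by (subst sum.swap) simp
  also have "(1/2) * ((\<Sum>i<m. \<Sum>j<m. a i j) + cnj (\<Sum>i<m. \<Sum>j<m. a i j)) =
      complex_of_real (Re (\<Sum>i<m. \<Sum>j<m. a i j))"
    by (rule half)
  also have "Re (\<Sum>i<m. \<Sum>j<m. a i j) = polyform m p X x"
    by (simp add: polyform_def a_def Re_cinner)
  finally show ?thesis .
qed

lemma opmat_positive_re_ncpoly: "opmat_positive m (re_ncpoly p X) \<longleftrightarrow> (\<forall>x. 0 \<le> polyform m p X x)"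
  unfolding opmat_positive_def cinner_re_ncpoly Let_def by simp

lemma opmat_le_re_ncpoly:
  "opmat_le m (\<lambda>i j. a *\<^sub>R re_ncpoly p X i j) (\<lambda>i j. b *\<^sub>R re_ncpoly p Y i j) \<longleftrightarrow>
    (\<forall>x. a * polyform m p X x \<le> b * polyform m p Y x)"
proof -
  have "(\<Sum>i<m. cinner (\<Sum>j<m. capply (b *\<^sub>R re_ncpoly p Y i j - a *\<^sub>R re_ncpoly p X i j) (x j)) (x i)) =
      complex_of_real (b * polyform m p Y x - a * polyform m p X x)" for x
  proof -
    have "cinner (\<Sum>j<m. capply (b *\<^sub>R re_ncpoly p Y i j - a *\<^sub>R re_ncpoly p X i j) (x j)) (x i) =
        complex_of_real b * cinner (\<Sum>j<m. capply (re_ncpoly p Y i j) (x j)) (x i) -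
        complex_of_real a * cinner (\<Sum>j<m. capply (re_ncpoly p X i j) (x j)) (x i)" for i
      by (simp add: sum_subtractf cinner_diff_left cinner_sum_left scaleR_scaleC cinner_scaleC_left
          sum_distrib_left)
    then show ?thesis
      by (simp add: sum_subtractf sum_distrib_left[symmetric] cinner_re_ncpoly)
  qed
  then show ?thesis
    unfolding opmat_le_def opmat_positive_def Let_def by simp
qed

lemma harnack_dominated_polyform:
  fixes A B :: "('h::chilbert_space, 'n::finite) optuple"
  shows "harnack_dominated c A B \<longleftrightarrow> (\<forall>m p.
    (\<forall>X \<in> (op_ball :: ('h, 'n) optuple set). \<forall>x. 0 \<le> polyform m p X x) \<longrightarrow>
    (\<forall>x. 1 / c\<^sup>2 * polyform m p B x \<le> polyform m p A x \<and>
         polyform m p A x \<le> c\<^sup>2 * polyform m p B x))"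
  unfolding harnack_dominated_def opmat_positive_re_ncpoly
  using opmat_le_re_ncpoly[of _ "1 / c\<^sup>2" _ B 1 A] opmat_le_re_ncpoly[of _ 1 _ A "c\<^sup>2" B]
  by (simp add: all_conj_distrib)

lemma capply_eval_ncpoly:
  "capply (eval_ncpoly q X) h =
    (\<Sum>w\<in>Poly_Mapping.keys q. Poly_Mapping.lookup q w *\<^sub>C capply (op_word X w) h)"
  by (simp add: eval_ncpoly_def capply_sum)

lemma capply_eval_single: "capply (eval_ncpoly (Poly_Mapping.single w c) X) h = c *\<^sub>C capply (op_word X w) h"
  by (simp add: capply_eval_ncpoly)

lemma scaleC_scaleR: "a *\<^sub>C (r *\<^sub>R x) = r *\<^sub>R (a *\<^sub>C x)"
  unfolding scaleR_scaleC scaleC_scaleC by (rule arg_cong2[where f = scaleC]) auto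

section \<open>Finite orthonormal families\<close>

definition orthonormal :: "nat \<Rightarrow> (nat \<Rightarrow> 'a::chilbert_space) \<Rightarrow> bool"
  where "orthonormal d e \<longleftrightarrow> (\<forall>k<d. \<forall>l<d. cinner (e k) (e l) = (if k = l then 1 else 0))"

text \<open>The partial isometry that carries \<open>e\<^sub>k\<close> to \<open>f\<^sub>k\<close>. For \<open>f = e\<close> it is the orthogonal projection onto
  the span of the \<open>e\<^sub>k\<close>, so \<open>transfer_fun d e e y = y\<close> says that \<open>y\<close> lies in this span.\<close>

definition transfer_fun :: "nat \<Rightarrow> (nat \<Rightarrow> 'a::chilbert_space) \<Rightarrow> (nat \<Rightarrow> 'b::chilbert_space) \<Rightarrow> 'a \<Rightarrow> 'b"
  where "transfer_fun d e f y = (\<Sum>k<d. cinner y (e k) *\<^sub>C f k)"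

lemma cinner_transfer_fun:
  "orthonormal d f \<Longrightarrow> l < d \<Longrightarrow> cinner (transfer_fun d e f y) (f l) = cinner y (e l)"
  by (simp add: transfer_fun_def orthonormal_def cinner_sum_left cinner_scaleC_left sum.delta
      if_distrib[of "(*) _"] cong: if_cong)

lemma orthonormal_extend:
  assumes e: "orthonormal d e" and v: "transfer_fun d e e v \<noteq> v"
  obtains e' where "orthonormal (Suc d) e'" "transfer_fun (Suc d) e' e' v = v"
    "\<And>y. transfer_fun d e e y = y \<Longrightarrow> transfer_fun (Suc d) e' e' y = y"
proof -
  define u where "u = v - transfer_fun d e e v"
  have u0: "u \<noteq> 0"
    using v by (simp add: u_def)
  define w where "w = (1 / complex_of_real (norm u)) *\<^sub>C u"
  have "norm w = 1"
    using u0 by (simp add: w_def norm_scaleC norm_divide)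
  then have ww: "cinner w w = 1"
    by (simp add: cinner_self)
  have uw: "cinner u w *\<^sub>C w = u"
    using u0 by (simp add: w_def cinner_scaleC_right cinner_self scaleC_scaleC power2_eq_square)
  have ul: "cinner u (e l) = 0" if "l < d" for l
    using that by (simp add: u_def cinner_diff_left cinner_transfer_fun[OF e])
  then have wl: "cinner w (e l) = 0" if "l < d" for l
    using that by (simp add: w_def cinner_scaleC_left)
  then have lw: "cinner (e l) w = 0" if "l < d" for l
    using that by (subst cinner_commute) simp
  define e' where "e' = e(d := w)"
  have t: "transfer_fun (Suc d) e' e' y = transfer_fun d e e y + cinner y w *\<^sub>C w" for y
    by (simp add: transfer_fun_def e'_def)
  have tw: "cinner (transfer_fun d e e y) w = 0" for y
    by (simp add: transfer_fun_def cinner_sum_left cinner_scaleC_left lw)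
  show ?thesis
  proof (rule that[of e'])
    show "orthonormal (Suc d) e'"
      using e wl lw ww by (auto simp: orthonormal_def e'_def less_Suc_eq)
    have "cinner v w = cinner u w"
      by (simp add: u_def cinner_diff_left tw)
    then show "transfer_fun (Suc d) e' e' v = v"
      by (simp add: t uw) (simp add: u_def)
    show "transfer_fun (Suc d) e' e' y = y" if "transfer_fun d e e y = y" for y
      using tw[of y] that by (simp add: t)
  qed
qed

lemma gram_schmidt:
  assumes "finite F"
  shows "\<exists>d e. orthonormal d e \<and> (\<forall>y\<in>F. transfer_fun d e e y = y)"
  using assms
proof induction
  case empty
  then show ?case
    by (auto simp: orthonormal_def intro!: exI[of _ 0])
next
  case (insert v F)
  then obtain d e where e: "orthonormal d e" "\<forall>y\<in>F. transfer_fun d e e y = y"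
    by blast
  show ?case
  proof (cases "transfer_fun d e e v = v")
    case True
    then show ?thesis
      using e by blast
  next
    case False
    then show ?thesis
      using orthonormal_extend[OF e(1) False] e(2) by (metis insert_iff)
  qed
qed

lemma orthonormal_family_exists:
  assumes "\<forall>S :: 'h::chilbert_space set. finite S \<longrightarrow> cspan S \<noteq> UNIV"
  shows "\<exists>f :: nat \<Rightarrow> 'h. orthonormal d f"
proof (induction d)
  case 0
  then show ?case
    by (simp add: orthonormal_def)
next
  case (Suc d)
  then obtain f :: "nat \<Rightarrow> 'h" where f: "orthonormal d f"
    by blast
  obtain v where v: "v \<notin> cspan (f ` {..<d})"
    using assms by (metis UNIV_eq_I finite_imageI finite_lessThan)
  have "transfer_fun d f f v \<in> cspan (f ` {..<d})"
    unfolding transfer_fun_def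
    by (intro complex_vs.span_sum complex_vs.span_scale complex_vs.span_base) auto
  then have "transfer_fun d f f v \<noteq> v"
    using v by auto
  then show ?case
    using orthonormal_extend[OF f] by metis
qed

definition transfer_op :: "nat \<Rightarrow> (nat \<Rightarrow> 'a::chilbert_space) \<Rightarrow> (nat \<Rightarrow> 'b::chilbert_space) \<Rightarrow> ('a, 'b) cblinfun"
  where "transfer_op d e f = CBlinfun (transfer_fun d e f)"

lemma capply_transfer_op: "capply (transfer_op d e f) = transfer_fun d e f"
  unfolding transfer_op_def
proof (rule capply_CBlinfun)
  show "bounded_linear (transfer_fun d e f)"
  proof (rule bounded_linear_intro[where K = "\<Sum>k<d. norm (e k) * norm (f k)"])
    show "transfer_fun d e f (x + y) = transfer_fun d e f x + transfer_fun d e f y" for x y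
      by (simp add: transfer_fun_def cinner_add_left scaleC_add_left sum.distrib)
    show "transfer_fun d e f (r *\<^sub>R x) = r *\<^sub>R transfer_fun d e f x" for r x
      by (simp add: transfer_fun_def scaleR_scaleC cinner_scaleC_left scaleC_scaleC
          complex_vs.scale_sum_right)
    show "norm (transfer_fun d e f x) \<le> norm x * (\<Sum>k<d. norm (e k) * norm (f k))" for x
      unfolding transfer_fun_def sum_distrib_left
      by (rule sum_norm_le)
        (simp add: norm_scaleC mult.assoc[symmetric] mult_right_mono norm_cinner_le)
  qed
  show "transfer_fun d e f (a *\<^sub>C x) = a *\<^sub>C transfer_fun d e f x" for a x
    by (simp add: transfer_fun_def cinner_scaleC_left scaleC_scaleC complex_vs.scale_sum_right)
qed

lemma adj_transfer_op: "adj (transfer_op d e f) = transfer_op d f e"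
proof (rule adj_unique)
  fix x y
  have "cinner (transfer_fun d e f x) y = cinner x (transfer_fun d f e y)"
    unfolding transfer_fun_def cinner_sum_left cinner_sum_right cinner_scaleC_left
      cinner_scaleC_right
    by (rule sum.cong) (auto simp: cinner_commute[of y] mult.commute)
  then show "capply (transfer_op d e f) x \<bullet> y = x \<bullet> capply (transfer_op d f e) y"
    by (metis Re_cinner capply_transfer_op)
qed

lemma transfer_fun_compose:
  assumes "orthonormal d f"
  shows "transfer_fun d f g (transfer_fun d e f y) = transfer_fun d e g y"
  by (subst transfer_fun_def) (simp add: cinner_transfer_fun[OF assms], simp add: transfer_fun_def)

lemma inner_transfer_fun:
  assumes "orthonormal d f"
  shows "transfer_fun d e f x \<bullet> transfer_fun d e f y = x \<bullet> transfer_fun d e e y"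
  using inner_adj[of "transfer_op d e f" x "transfer_fun d e f y"]
  unfolding adj_transfer_op capply_transfer_op transfer_fun_compose[OF assms] .

text \<open>Bessel's inequality: \<open>\<parallel>P x\<parallel>\<^sup>2 = \<langle>x, P x\<rangle>\<close> for the projection \<open>P\<close> onto the span of \<open>e\<close>.\<close>

lemma norm_transfer_fun_le:
  assumes e: "orthonormal d e" and f: "orthonormal d f"
  shows "norm (transfer_fun d e f x) \<le> norm x"
proof -
  let ?P = "transfer_fun d e e"
  have eq: "(norm (transfer_fun d e f x))\<^sup>2 = x \<bullet> ?P x" "(norm (?P x))\<^sup>2 = x \<bullet> ?P x"
    unfolding power2_norm_eq_inner inner_transfer_fun[OF f] inner_transfer_fun[OF e] by simp_all
  have "(norm (?P x))\<^sup>2 \<le> norm x * norm (?P x)"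
    unfolding eq by (rule norm_cauchy_schwarz)
  then have "norm (?P x) \<le> norm x"
    by (cases "?P x = 0") (simp_all add: power2_eq_square)
  moreover have "norm (transfer_fun d e f x) = norm (?P x)"
    by (rule power2_eq_imp_eq) (simp_all add: eq)
  ultimately show ?thesis
    by simp
qed

section \<open>Von Neumann's inequality by finite-dimensional compression\<close>

text \<open>The hypothesis bounds the row operator \<open>(X\<^sub>1, \<dots>, X\<^sub>n)\<close>; it is applied to \<open>v\<^sub>i = X\<^sub>i\<^sup>* y\<close>.\<close>

lemma row_norm_le:
  assumes r: "0 \<le> r" and *: "\<And>v. (norm (\<Sum>i\<in>UNIV. capply (X $ i) (v i)))\<^sup>2 \<le> r\<^sup>2 * (\<Sum>i\<in>UNIV. (norm (v i))\<^sup>2)"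
  shows "row_norm X \<le> r"
proof -
  let ?Q = "\<Sum>i\<in>UNIV. X $ i \<circ>\<^sub>C adj (X $ i)"
  have "norm ?Q \<le> r\<^sup>2"
  proof (rule norm_cblinfun_bound)
    fix y
    have "(norm (capply ?Q y))\<^sup>2 \<le> r\<^sup>2 * (\<Sum>i\<in>UNIV. (norm (capply (adj (X $ i)) y))\<^sup>2)"
      using *[of "\<lambda>i. capply (adj (X $ i)) y"] by (simp add: capply_sum)
    also have "(\<Sum>i\<in>UNIV. (norm (capply (adj (X $ i)) y))\<^sup>2) = capply ?Q y \<bullet> y"
      by (simp add: capply_sum inner_sum_left inner_adj power2_norm_eq_inner)
    also have "r\<^sup>2 * \<dots> \<le> r\<^sup>2 * (norm (capply ?Q y) * norm y)"
      by (intro mult_left_mono norm_cauchy_schwarz) auto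
    finally show "norm (capply ?Q y) \<le> r\<^sup>2 * norm y"
      by (cases "capply ?Q y = 0") (simp_all add: power2_eq_square mult_ac r)
  qed simp
  then show ?thesis
    unfolding row_norm_def using r by (metis real_sqrt_abs real_sqrt_le_iff abs_of_nonneg)
qed

text \<open>A polynomial of degree at most \<open>N\<close> only sees the finite-dimensional span of the vectors
  \<open>W\<^sub>\<gamma> x\<^sub>j\<close> with \<open>\<gamma>\<close> of length at most \<open>N\<close>. The compression of \<open>W\<close> to this span is a row contraction
  that acts on those vectors as \<open>W\<close> does, and it can be copied into any infinite-dimensional
  space.\<close>

lemma von_neumann_inequality:
  fixes W :: "('g::chilbert_space, 'n::finite) optuple"
  assumes infinite_dimensional: "\<forall>S :: 'h::chilbert_space set. finite S \<longrightarrow> cspan S \<noteq> UNIV"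
    and pos: "\<And>X x. X \<in> (op_ball :: ('h, 'n) optuple set) \<Longrightarrow> 0 \<le> polyform m p X x"
    and row: "\<And>v. (norm (\<Sum>i\<in>UNIV. capply (W $ i) (v i)))\<^sup>2 \<le> (\<Sum>i\<in>UNIV. (norm (v i))\<^sup>2)"
  shows "0 \<le> polyform m p W x"
proof -
  define K where "K = (\<Union>i<m. \<Union>j<m. Poly_Mapping.keys (p i j))"
  have "finite K"
    by (simp add: K_def)
  \<comment> \<open>Any bound for the degree will do; the sum is easier to handle than the maximum.\<close>
  define N where "N = (\<Sum>w\<in>K. length w)"
  have N: "length w \<le> N" if "w \<in> Poly_Mapping.keys (p i j)" "i < m" "j < m" for w i j
    unfolding N_def by (rule member_le_sum[of w K length]) (use that \<open>finite K\<close> in \<open>auto simp: K_def\<close>)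
  define F where "F = (\<lambda>(w, j). capply (op_word W w) (x j)) ` ({w. length w \<le> N} \<times> {..<m})"
  have "finite {w. set w \<subseteq> (UNIV :: 'n set) \<and> length w \<le> N}"
    by (rule finite_lists_length_le) simp
  then have "finite F"
    unfolding F_def by (intro finite_imageI finite_cartesian_product) simp_all
  from gram_schmidt[OF this] obtain d e
    where e: "orthonormal d e" and F: "\<And>y. y \<in> F \<Longrightarrow> transfer_fun d e e y = y"
    by metis
  obtain f :: "nat \<Rightarrow> 'h" where f: "orthonormal d f"
    using orthonormal_family_exists[OF infinite_dimensional, of d] ..
  define J where "J = transfer_fun d e f"
  define J' where "J' = transfer_fun d f e"
  have J'J: "J' (J y) = y" if "y \<in> F" for y
    using F[OF that] by (simp add: J_def J'_def transfer_fun_compose[OF f])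
  \<comment> \<open>The factor \<open>r < 1\<close> moves the compression into the open ball; it is removed by letting \<open>r\<close> tend to 1.\<close>
  define X :: "real \<Rightarrow> ('h, 'n) optuple"
    where "X r = (\<chi> i. r *\<^sub>R (transfer_op d e f \<circ>\<^sub>C W $ i \<circ>\<^sub>C transfer_op d f e))" for r
  have X: "capply (X r $ i) v = r *\<^sub>R J (capply (W $ i) (J' v))" for r i v
    by (simp add: X_def capply_transfer_op J_def J'_def)
  have ball: "X r \<in> op_ball" if r: "0 \<le> r" "r < 1" for r
  proof -
    have "row_norm (X r) \<le> r"
    proof (rule row_norm_le[OF r(1)])
      fix v :: "'n \<Rightarrow> 'h"
      have "(\<Sum>i\<in>UNIV. capply (X r $ i) (v i)) = r *\<^sub>R J (\<Sum>i\<in>UNIV. capply (W $ i) (J' (v i)))"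
        unfolding X J_def capply_transfer_op[symmetric] by (simp add: scaleR_sum_right)
      then have "(norm (\<Sum>i\<in>UNIV. capply (X r $ i) (v i)))\<^sup>2 =
          r\<^sup>2 * (norm (J (\<Sum>i\<in>UNIV. capply (W $ i) (J' (v i)))))\<^sup>2"
        by (simp add: power_mult_distrib)
      also have "\<dots> \<le> r\<^sup>2 * (norm (\<Sum>i\<in>UNIV. capply (W $ i) (J' (v i))))\<^sup>2"
        unfolding J_def by (intro mult_left_mono power_mono norm_transfer_fun_le e f) auto
      also have "\<dots> \<le> r\<^sup>2 * (\<Sum>i\<in>UNIV. (norm (J' (v i)))\<^sup>2)"
        by (intro mult_left_mono row) auto
      also have "\<dots> \<le> r\<^sup>2 * (\<Sum>i\<in>UNIV. (norm (v i))\<^sup>2)"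
        unfolding J'_def by (intro mult_left_mono sum_mono power_mono norm_transfer_fun_le e f) auto
      finally show "(norm (\<Sum>i\<in>UNIV. capply (X r $ i) (v i)))\<^sup>2 \<le> r\<^sup>2 * (\<Sum>i\<in>UNIV. (norm (v i))\<^sup>2)" .
    qed
    with r show ?thesis
      by (simp add: op_ball_def)
  qed
  have word: "capply (op_word (X r) w) (J (x j)) = r ^ length w *\<^sub>R J (capply (op_word W w) (x j))"
    if "length w \<le> N" "j < m" for r w j
    using that(1)
  proof (induction w)
    case (Cons i w)
    then have "capply (op_word W w) (x j) \<in> F"
      using that(2) by (auto simp: F_def)
    with Cons show ?case
      by (simp add: op_word_Cons X J'J)
  qed (simp add: op_word_Nil)
  define T where "T i j w = (Poly_Mapping.lookup (p i j) w *\<^sub>C capply (op_word W w) (x j)) \<bullet> x i" for i j w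
  define g where "g r = (\<Sum>i<m. \<Sum>j<m. \<Sum>w\<in>Poly_Mapping.keys (p i j). r ^ length w * T i j w)" for r :: real
  have "polyform m p (X r) (\<lambda>j. J (x j)) = g r" for r
    unfolding polyform_def g_def capply_eval_ncpoly inner_sum_left
  proof (intro sum.cong refl)
    fix i j w assume i: "i \<in> {..<m}" and j: "j \<in> {..<m}" and w: "w \<in> Poly_Mapping.keys (p i j)"
    let ?c = "Poly_Mapping.lookup (p i j) w" and ?y = "capply (op_word W w) (x j)"
    have wN: "length w \<le> N"
      using N w i j by auto
    have "x i \<in> F"
      using i by (auto simp: F_def op_word_Nil intro!: image_eqI[of _ _ "([], i)"])
    then have xi: "transfer_fun d e e (x i) = x i"
      by (rule F)
    have "(?c *\<^sub>C capply (op_word (X r) w) (J (x j))) \<bullet> J (x i) = r ^ length w * ((?c *\<^sub>C J ?y) \<bullet> J (x i))"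
      using word[OF wN] j by (simp add: scaleC_scaleR)
    also have "?c *\<^sub>C J ?y = J (?c *\<^sub>C ?y)"
      unfolding J_def capply_transfer_op[symmetric] by simp
    also have "J (?c *\<^sub>C ?y) \<bullet> J (x i) = T i j w"
      unfolding J_def inner_transfer_fun[OF f] xi T_def ..
    finally show "(?c *\<^sub>C capply (op_word (X r) w) (J (x j))) \<bullet> J (x i) = r ^ length w * T i j w" .
  qed
  then have g0: "0 \<le> g r" if "0 \<le> r" "r < 1" for r
    using pos[OF ball[OF that]] by metis
  have "isCont g 1"
    unfolding g_def by (intro continuous_intros)
  then have lim: "(g \<longlongrightarrow> g 1) (at_left 1)"
    unfolding isCont_def filterlim_at_split ..
  have "\<forall>\<^sub>F r in at_left (1::real). r \<in> {0<..<1}"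
    by (rule eventually_at_left_real) simp
  then have "\<forall>\<^sub>F r in at_left 1. 0 \<le> g r"
    by (rule eventually_mono) (use g0 in auto)
  then have "0 \<le> g 1"
    by (rule tendsto_lowerbound[OF lim]) simp
  moreover have "g 1 = polyform m p W x"
    by (simp add: g_def polyform_def T_def capply_eval_ncpoly inner_sum_left)
  ultimately show ?thesis
    by simp
qed

section \<open>Harnack domination is domination of Poisson kernels\<close>

lemma poisson_commute: "poisson X x y = poisson X y x"
  by (simp add: poisson_def inner_commute)

text \<open>The operator \<open>M = c\<^sub>2 P(B) - P(A) + e\<close> is strictly positive and Toeplitz with respect to the left
  creation operators \<open>L\<^sub>i\<close>. Hence with \<open>S = M\<^sup>1\<^sup>/\<^sup>2\<close> the operators \<open>W\<^sub>i = S L\<^sub>i S\<^sup>-\<^sup>1\<close> are isometries with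
  orthogonal ranges, and \<open>\<Re> p(W)\<close> at the vectors \<open>S (h\<^sub>j \<otimes> 1)\<close> is the wanted combination of
  \<open>\<Re> p(B)\<close>, \<open>\<Re> p(A)\<close> and \<open>\<Re> p(0)\<close>. Finally \<open>e\<close> tends to \<open>0\<close>.\<close>

lemma polyform_le_if_poisson_le:
  fixes A B :: "('h::chilbert_space, 'n::finite) optuple"
  assumes infinite_dimensional: "\<forall>S :: 'h set. finite S \<longrightarrow> cspan S \<noteq> UNIV"
    and A: "A \<in> op_ball" and B: "B \<in> op_ball"
    and le: "\<And>y. poisson A y y \<le> c2 * poisson B y y"
    and pos: "\<And>X x. X \<in> (op_ball :: ('h, 'n) optuple set) \<Longrightarrow> 0 \<le> polyform m p X x"
  shows "polyform m p A h \<le> c2 * polyform m p B h"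
proof -
  define Z where "Z = (\<Sum>i<m. \<Sum>j<m. \<Sum>w\<in>Poly_Mapping.keys (p i j).
    sgl w (Poly_Mapping.lookup (p i j) w *\<^sub>C h j) \<bullet> sgl [] (h i))"
  have key: "0 \<le> c2 * polyform m p B h - polyform m p A h + e * Z" if e: "0 < e" for e
  proof -
    let ?C = "\<lambda>X. adj (kernel_C X) \<circ>\<^sub>C kernel_C X"
    define M where "M = c2 *\<^sub>R ?C B - ?C A + e *\<^sub>R cid"
    have M: "capply M x \<bullet> y = c2 * poisson B x y - poisson A x y + e * (x \<bullet> y)" for x y
      by (simp add: M_def inner_add_left inner_diff_left inner_adj_left poisson_def)
    have sym: "capply M x \<bullet> y = x \<bullet> capply M y" for x y
      using M[of x y] M[of y x] by (simp add: poisson_commute[of _ y] inner_commute)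
    have low: "e * (norm x)\<^sup>2 \<le> capply M x \<bullet> x" for x
      using le[of x] by (simp add: M power2_norm_eq_inner)
    obtain S S' :: "(('n list, 'h) ell2, ('n list, 'h) ell2) cblinfun" where SS': "S \<circ>\<^sub>C S' = cid" "S' \<circ>\<^sub>C S = cid"
      and S: "\<And>x y. capply S x \<bullet> capply S y = capply M x \<bullet> y"
      using strictly_positive_sqrt[OF sym low e] by blast
    have S'S: "capply S (capply S' x) = x" "capply S' (capply S x) = x" for x
      by (metis SS' capply_ccompose capply_cid)+
    define W :: "(('n list, 'h) ell2, 'n) optuple" where "W = (\<chi> i. S \<circ>\<^sub>C left_create i \<circ>\<^sub>C S')"
    have toeplitz: "capply M (capply (left_create i) x) \<bullet> capply (left_create j) y =
        (if i = j then capply M x \<bullet> y else 0)" for i j x y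
      unfolding M poisson_toeplitz[OF A] poisson_toeplitz[OF B]
      by (simp add: capply_left_create inner_left_create_fun)
    have row: "(norm (\<Sum>i\<in>UNIV. capply (W $ i) (v i)))\<^sup>2 \<le> (\<Sum>i\<in>UNIV. (norm (v i))\<^sup>2)" for v
    proof -
      have "capply (W $ i) (v i) \<bullet> capply (W $ j) (v j) = (if i = j then (norm (v i))\<^sup>2 else 0)" for i j
      proof -
        have "capply (W $ i) (v i) \<bullet> capply (W $ j) (v j) =
            (if i = j then capply M (capply S' (v i)) \<bullet> capply S' (v j) else 0)"
          by (simp add: W_def S toeplitz)
        also have "capply M (capply S' (v i)) \<bullet> capply S' (v j) = v i \<bullet> v j"
          unfolding S[symmetric] S'S ..
        finally show ?thesis
          by (simp add: power2_norm_eq_inner)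
      qed
      then show ?thesis
        by (simp add: power2_norm_eq_inner[of "sum _ _"] inner_sum_left inner_sum_right sum.delta')
    qed
    have word: "capply (op_word W w) (capply S (sgl [] k)) = capply S (sgl w k)" for w k
      by (induction w) (simp_all add: op_word_Nil op_word_Cons W_def S'S left_create_sgl)
    have "0 \<le> polyform m p W (\<lambda>j. capply S (sgl [] (h j)))"
      by (rule von_neumann_inequality[OF infinite_dimensional pos row])
    also have "\<dots> = c2 * polyform m p B h - polyform m p A h + e * Z"
    proof -
      have "capply (eval_ncpoly (p i j) W) (capply S (sgl [] (h j))) \<bullet> capply S (sgl [] (h i)) =
          c2 * (capply (eval_ncpoly (p i j) B) (h j) \<bullet> h i) - capply (eval_ncpoly (p i j) A) (h j) \<bullet> h i +
          e * (\<Sum>w\<in>Poly_Mapping.keys (p i j).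
            sgl w (Poly_Mapping.lookup (p i j) w *\<^sub>C h j) \<bullet> sgl [] (h i))" for i j
      proof -
        have "(Poly_Mapping.lookup (p i j) w *\<^sub>C capply (op_word W w) (capply S (sgl [] (h j)))) \<bullet>
            capply S (sgl [] (h i)) =
            c2 * ((Poly_Mapping.lookup (p i j) w *\<^sub>C capply (op_word B w) (h j)) \<bullet> h i) -
            (Poly_Mapping.lookup (p i j) w *\<^sub>C capply (op_word A w) (h j)) \<bullet> h i +
            e * (sgl w (Poly_Mapping.lookup (p i j) w *\<^sub>C h j) \<bullet> sgl [] (h i))" for w
          unfolding word capply_scaleC[symmetric] sgl_scaleC[symmetric] S M
            poisson_vacuum[OF A] poisson_vacuum[OF B] ..
        then show ?thesis
          by (simp add: capply_eval_ncpoly inner_sum_left sum.distrib sum_subtractf sum_distrib_left)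
      qed
      then show ?thesis
        by (simp add: polyform_def Z_def sum.distrib sum_subtractf sum_distrib_left)
    qed
    finally show ?thesis .
  qed
  have "((\<lambda>e. c2 * polyform m p B h - polyform m p A h + e * Z) \<longlongrightarrow>
      c2 * polyform m p B h - polyform m p A h + 0 * Z) (at_right 0)"
    by (intro tendsto_intros)
  moreover have "\<forall>\<^sub>F e in at_right (0::real). 0 \<le> c2 * polyform m p B h - polyform m p A h + e * Z"
    using key by (auto simp: eventually_at_filter)
  ultimately have "0 \<le> c2 * polyform m p B h - polyform m p A h + 0 * Z"
    by (rule tendsto_lowerbound) simp
  then show ?thesis
    by simp
qed

text \<open>Conversely, finite sections of \<open>P(X)\<close> are themselves values \<open>\<Re> p(X)\<close>: the entry at the words
  \<open>\<alpha>\<close> and \<open>\<alpha>\<gamma>\<close> of the section is \<open>X\<^sub>\<gamma>\<close>, and the entry at \<open>\<alpha>\<gamma>\<close> and \<open>\<alpha>\<close> is its adjoint. The factor 2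
  makes up for taking real parts, off the diagonal.\<close>

definition section_poly :: "'n list list \<Rightarrow> nat \<Rightarrow> nat \<Rightarrow> 'n ncpoly"
  where "section_poly ws i j = (if \<exists>g. ws ! j = ws ! i @ g
    then Poly_Mapping.single (drop (length (ws ! i)) (ws ! j)) (if ws ! j = ws ! i then 1 else 2) else 0)"

lemma polyform_section_poly:
  fixes X :: "('h::chilbert_space, 'n::finite) optuple"
  assumes "X \<in> op_ball"
  shows "polyform (length ws) (section_poly ws) X x =
    poisson X (\<Sum>i<length ws. sgl (ws ! i) (x i)) (\<Sum>i<length ws. sgl (ws ! i) (x i))"
proof -
  let ?s = "\<lambda>i. sgl (ws ! i) (x i)"
  have "capply (eval_ncpoly (section_poly ws i j) X) (x j) \<bullet> x i =
      2 * (?s j \<bullet> capply (resolvent X) (?s i)) - ?s j \<bullet> ?s i" for i j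
  proof -
    have r: "?s j \<bullet> capply (resolvent X) (?s i) = (if \<exists>g. ws ! j = ws ! i @ g
        then x i \<bullet> capply (op_word X (drop (length (ws ! i)) (ws ! j))) (x j) else 0)"
      using inner_coord_resolvent_sgl[OF assms, of "ws ! i" "x i" "ws ! j" "x j"]
      by (simp add: inner_commute)
    show ?thesis
    proof (cases "\<exists>g. ws ! j = ws ! i @ g")
      case True
      have two: "(2 *\<^sub>C v) \<bullet> w = 2 * (v \<bullet> w)" for v w :: 'h
        using scaleR_scaleC[of 2 v] by (metis inner_scaleR_left of_real_numeral)
      show ?thesis
      proof (cases "ws ! j = ws ! i")
        case True
        then show ?thesis
          unfolding r section_poly_def
          by (simp add: capply_eval_single op_word_Nil inner_commute[of "x j"])
      next
        case False
        with True show ?thesis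
          unfolding r section_poly_def
          by (simp add: capply_eval_single two inner_commute[of "x i"])
      qed
    next
      case False
      then have "ws ! j \<noteq> ws ! i"
        by (metis append_Nil2)
      with False show ?thesis
        unfolding r section_poly_def by (auto simp: eval_ncpoly_def)
    qed
  qed
  then have "polyform (length ws) (section_poly ws) X x =
      2 * (\<Sum>i<length ws. \<Sum>j<length ws. ?s j \<bullet> capply (resolvent X) (?s i)) -
      (\<Sum>i<length ws. \<Sum>j<length ws. ?s j \<bullet> ?s i)"
    by (simp add: polyform_def sum_subtractf sum_distrib_left)
  also have "\<dots> = 2 * ((\<Sum>i<length ws. ?s i) \<bullet> capply (resolvent X) (\<Sum>i<length ws. ?s i)) -
      (\<Sum>i<length ws. ?s i) \<bullet> (\<Sum>i<length ws. ?s i)"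
    by (simp only: capply_linear(6) inner_sum_left inner_sum_right)
  finally show ?thesis
    by (simp add: poisson_eq[OF assms] inner_commute)
qed

text \<open>Finite sections are dense, and the Poisson forms are continuous.\<close>

lemma poisson_le_if_polyform_le:
  fixes A B :: "('h::chilbert_space, 'n::finite) optuple"
  assumes A: "A \<in> op_ball" and B: "B \<in> op_ball"
    and le: "\<And>m p h. (\<And>X x. X \<in> (op_ball :: ('h, 'n) optuple set) \<Longrightarrow> 0 \<le> polyform m p X x) \<Longrightarrow>
      polyform m p A h \<le> c2 * polyform m p B h"
  shows "poisson A y y \<le> c2 * poisson B y y"
proof -
  define s where "s F = (\<Sum>w\<in>F. sgl w (coord y w))" for F
  have "poisson A (s F) (s F) \<le> c2 * poisson B (s F) (s F)" if F: "finite F" for F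
  proof -
    obtain ws where ws: "set ws = F" "distinct ws"
      using finite_distinct_list[OF F] by blast
    have "s F = (\<Sum>w\<leftarrow>ws. sgl w (coord y w))"
      unfolding s_def ws(1)[symmetric] by (simp add: sum_list_distinct_conv_sum_set ws)
    also have "\<dots> = (\<Sum>i<length ws. sgl (ws ! i) (coord y (ws ! i)))"
      by (simp add: sum_list_sum_nth atLeast0LessThan)
    finally have s: "s F = (\<Sum>i<length ws. sgl (ws ! i) (coord y (ws ! i)))" .
    have "polyform (length ws) (section_poly ws) A (\<lambda>i. coord y (ws ! i)) \<le>
        c2 * polyform (length ws) (section_poly ws) B (\<lambda>i. coord y (ws ! i))"
      by (rule le) (simp add: polyform_section_poly poisson_self)
    then show ?thesis
      unfolding polyform_section_poly[OF A] polyform_section_poly[OF B] s .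
  qed
  then have ev: "\<forall>\<^sub>F F in finite_subsets_at_top UNIV.
      poisson A (s F) (s F) \<le> c2 * poisson B (s F) (s F)"
    by (intro eventually_finite_subsets_at_top_weakI) simp
  have "((\<lambda>F. poisson X (s F) (s F)) \<longlongrightarrow> poisson X y y) (finite_subsets_at_top UNIV)"
    for X :: "('h, 'n) optuple"
    unfolding poisson_def s_def
    by (intro tendsto_inner bounded_linear.tendsto[OF bounded_linear_capply] finite_sections_tendsto)
  from this[of A] tendsto_mult_left[OF this[of B], of c2] show ?thesis
    using tendsto_le[OF _ _ _ ev] by (metis finite_subsets_at_top_neq_bot)
qed

text \<open>Harnack domination quantifies over all matrix polynomials with positive real part; the two
  preceding results replace them by a single operator inequality in each direction.\<close>

theorem harnack_dominated_iff_poisson: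
  fixes A B :: "('h::chilbert_space, 'n::finite) optuple"
  assumes infinite_dimensional: "\<forall>S :: 'h set. finite S \<longrightarrow> cspan S \<noteq> UNIV"
    and A: "A \<in> op_ball" and B: "B \<in> op_ball" and c: "0 < c"
  shows "harnack_dominated c A B \<longleftrightarrow>
    (\<forall>y. poisson A y y \<le> c\<^sup>2 * poisson B y y \<and> poisson B y y \<le> c\<^sup>2 * poisson A y y)"
proof -
  have scale: "1 / c\<^sup>2 * s \<le> t \<longleftrightarrow> s \<le> c\<^sup>2 * t" for s t :: real
    using c by (simp add: divide_simps mult.commute)
  show ?thesis
    unfolding harnack_dominated_polyform scale
  proof (intro iffI allI impI)
    fix y
    assume *: "\<forall>m p. (\<forall>X\<in>(op_ball :: ('h, 'n) optuple set). \<forall>x. 0 \<le> polyform m p X x) \<longrightarrow>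
      (\<forall>x. polyform m p B x \<le> c\<^sup>2 * polyform m p A x \<and> polyform m p A x \<le> c\<^sup>2 * polyform m p B x)"
    show "poisson A y y \<le> c\<^sup>2 * poisson B y y \<and> poisson B y y \<le> c\<^sup>2 * poisson A y y"
      by (intro conjI poisson_le_if_polyform_le A B) (use * in blast)+
  next
    fix m p x
    assume le: "\<forall>y. poisson A y y \<le> c\<^sup>2 * poisson B y y \<and> poisson B y y \<le> c\<^sup>2 * poisson A y y"
      and pos: "\<forall>X\<in>(op_ball :: ('h, 'n) optuple set). \<forall>x. 0 \<le> polyform m p X x"
    show "polyform m p B x \<le> c\<^sup>2 * polyform m p A x \<and> polyform m p A x \<le> c\<^sup>2 * polyform m p B x"
      using le pos by (intro conjI polyform_le_if_poisson_le[OF infinite_dimensional] A B) auto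
  qed
qed

section \<open>The hyperbolic distance in terms of the kernel operators\<close>

definition kernel_ratio :: "('h::chilbert_space, 'n::finite) optuple \<Rightarrow> ('h, 'n) optuple \<Rightarrow>
    (('n list, 'h) ell2, ('n list, 'h) ell2) cblinfun"
  where "kernel_ratio X Y = kernel_C X \<circ>\<^sub>C cinverse (kernel_C Y)"

lemma cinverse_kernel_C:
  assumes "X \<in> op_ball"
  shows "capply (cinverse (kernel_C X)) (capply (kernel_C X) x) = x"
    "capply (kernel_C X) (capply (cinverse (kernel_C X)) x) = x"
proof -
  obtain K where K: "K \<circ>\<^sub>C kernel_C X = cid" "kernel_C X \<circ>\<^sub>C K = cid"
    by (rule kernel_C_invertible[OF assms])
  then have "cinverse (kernel_C X) = K"
    by (rule cinverse_eqI)
  with K show "capply (cinverse (kernel_C X)) (capply (kernel_C X) x) = x"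
    "capply (kernel_C X) (capply (cinverse (kernel_C X)) x) = x"
    by (metis capply_ccompose capply_cid)+
qed

lemma kernel_ratio_comp:
  assumes "Y \<in> op_ball"
  shows "kernel_ratio X Y \<circ>\<^sub>C kernel_ratio Y Z = kernel_ratio X Z"
  by (rule cblinfun_eqI) (simp add: kernel_ratio_def cinverse_kernel_C[OF assms])

lemma kernel_ratio_self:
  assumes "X \<in> op_ball"
  shows "kernel_ratio X X = cid"
  by (rule cblinfun_eqI) (simp add: kernel_ratio_def cinverse_kernel_C[OF assms])

text \<open>Substitute \<open>x = C\<^sub>Y y\<close>: the inequality between Poisson forms becomes \<open>\<parallel>C\<^sub>X C\<^sub>Y\<^sup>-\<^sup>1 x\<parallel> \<le> c \<parallel>x\<parallel>\<close>.\<close>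

lemma poisson_le_iff_kernel_ratio:
  assumes Y: "Y \<in> op_ball" and c: "0 \<le> c"
  shows "(\<forall>y. poisson X y y \<le> c\<^sup>2 * poisson Y y y) \<longleftrightarrow> norm (kernel_ratio X Y) \<le> c"
proof
  assume *: "\<forall>y. poisson X y y \<le> c\<^sup>2 * poisson Y y y"
  show "norm (kernel_ratio X Y) \<le> c"
  proof (rule norm_cblinfun_bound[OF c])
    fix x
    have "(norm (capply (kernel_ratio X Y) x))\<^sup>2 \<le> (c * norm x)\<^sup>2"
      using *[rule_format, of "capply (cinverse (kernel_C Y)) x"]
      by (simp add: poisson_self kernel_ratio_def cinverse_kernel_C[OF Y] power_mult_distrib)
    then show "norm (capply (kernel_ratio X Y) x) \<le> c * norm x"
      by (rule power2_le_imp_le) (simp add: c)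
  qed
next
  assume *: "norm (kernel_ratio X Y) \<le> c"
  show "\<forall>y. poisson X y y \<le> c\<^sup>2 * poisson Y y y"
  proof
    fix y
    have "norm (capply (kernel_C X) y) = norm (capply (kernel_ratio X Y) (capply (kernel_C Y) y))"
      by (simp add: kernel_ratio_def cinverse_kernel_C[OF Y])
    also have "\<dots> \<le> norm (kernel_ratio X Y) * norm (capply (kernel_C Y) y)"
      by (rule norm_capply_le)
    also have "\<dots> \<le> c * norm (capply (kernel_C Y) y)"
      by (intro mult_right_mono * norm_ge_zero)
    finally have "(norm (capply (kernel_C X) y))\<^sup>2 \<le> (c * norm (capply (kernel_C Y) y))\<^sup>2"
      by (intro power_mono) auto
    then show "poisson X y y \<le> c\<^sup>2 * poisson Y y y"
      by (simp add: poisson_self power_mult_distrib)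
  qed
qed

text \<open>This quantity turns out to be \<open>\<omega>(X, Y)\<close>.\<close>

definition mutual_ratio :: "('h::chilbert_space, 'n::finite) optuple \<Rightarrow> ('h, 'n) optuple \<Rightarrow> real"
  where "mutual_ratio X Y = max (norm (kernel_ratio X Y)) (norm (kernel_ratio Y X))"

lemma infinite_dimensional_imp_nonzero:
  assumes "\<forall>S :: 'h::chilbert_space set. finite S \<longrightarrow> cspan S \<noteq> UNIV"
  obtains h :: "'h::chilbert_space" where "h \<noteq> 0"
proof -
  have "cspan {0 :: 'h} \<noteq> UNIV"
    using assms by blast
  moreover have "0 \<in> cspan {0 :: 'h}"
    by (rule complex_vs.span_base) simp
  ultimately show ?thesis
    using that by (metis UNIV_eq_I)
qed

text \<open>The two ratios are inverse to each other, so the product of their norms is at least 1. This is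
  where the space must be nonzero.\<close>

lemma mutual_ratio_ge_1:
  fixes X Y :: "('h::chilbert_space, 'n::finite) optuple"
  assumes infinite_dimensional: "\<forall>S :: 'h set. finite S \<longrightarrow> cspan S \<noteq> UNIV"
    and X: "X \<in> op_ball" and Y: "Y \<in> op_ball"
  shows "1 \<le> mutual_ratio X Y"
proof -
  obtain h :: 'h where h: "h \<noteq> 0"
    by (rule infinite_dimensional_imp_nonzero[OF infinite_dimensional])
  let ?r = "mutual_ratio X Y"
  have r: "0 \<le> ?r"
    by (simp add: mutual_ratio_def le_max_iff_disj)
  have "norm h = norm (capply (kernel_ratio X Y \<circ>\<^sub>C kernel_ratio Y X) (sgl [] h))"
    unfolding kernel_ratio_comp[OF Y] kernel_ratio_self[OF X] by simp
  also have "\<dots> \<le> norm (kernel_ratio X Y \<circ>\<^sub>C kernel_ratio Y X) * norm h"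
    by (metis norm_capply_le norm_sgl)
  also have "\<dots> \<le> (norm (kernel_ratio X Y) * norm (kernel_ratio Y X)) * norm h"
    by (intro mult_right_mono norm_ccompose_le norm_ge_zero)
  also have "\<dots> \<le> (?r * ?r) * norm h"
    using r by (intro mult_right_mono mult_mono) (auto simp: mutual_ratio_def)
  finally have "1 \<le> ?r * ?r"
    using h by simp
  then have "1\<^sup>2 \<le> ?r\<^sup>2"
    by (simp add: power2_eq_square)
  then show ?thesis
    by (rule power2_le_imp_le[OF _ r])
qed

lemma mutual_ratio_commute: "mutual_ratio X Y = mutual_ratio Y X"
  by (simp add: mutual_ratio_def max.commute)

lemma mutual_ratio_triangle:
  assumes Y: "Y \<in> op_ball"
  shows "mutual_ratio X Z \<le> mutual_ratio X Y * mutual_ratio Y Z"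
proof -
  have *: "norm (kernel_ratio X Z) \<le> mutual_ratio X Y * mutual_ratio Y Z" for X Z
  proof -
    have "norm (kernel_ratio X Z) \<le> norm (kernel_ratio X Y) * norm (kernel_ratio Y Z)"
      unfolding kernel_ratio_comp[OF Y, of X Z, symmetric] by (rule norm_ccompose_le)
    also have "\<dots> \<le> mutual_ratio X Y * mutual_ratio Y Z"
      by (intro mult_mono) (auto simp: mutual_ratio_def le_max_iff_disj)
    finally show ?thesis .
  qed
  show ?thesis
    using *[of X Z] *[of Z X]
    by (subst mutual_ratio_def) (simp add: mutual_ratio_commute[of _ Y] mutual_ratio_commute[of Z] mult.commute)
qed


lemma harnack_dominated_iff_mutual_ratio:
  fixes X Y :: "('h::chilbert_space, 'n::finite) optuple"
  assumes infinite_dimensional: "\<forall>S :: 'h set. finite S \<longrightarrow> cspan S \<noteq> UNIV"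
    and XY: "X \<in> op_ball" "Y \<in> op_ball" and c: "0 < c"
  shows "harnack_dominated c X Y \<longleftrightarrow> mutual_ratio X Y \<le> c"
  unfolding harnack_dominated_iff_poisson[OF assms] mutual_ratio_def
  using poisson_le_iff_kernel_ratio[OF XY(1), of c Y] poisson_le_iff_kernel_ratio[OF XY(2), of c X]
    c by (simp add: all_conj_distrib)

lemma harnack_equivalent_op_ball:
  fixes X Y :: "('h::chilbert_space, 'n::finite) optuple"
  assumes infinite_dimensional: "\<forall>S :: 'h set. finite S \<longrightarrow> cspan S \<noteq> UNIV"
    and XY: "X \<in> op_ball" "Y \<in> op_ball"
  shows "harnack_equivalent X Y"
proof -
  have "1 \<le> mutual_ratio X Y"
    by (rule mutual_ratio_ge_1[OF assms])
  then have "harnack_dominated (mutual_ratio X Y) X Y"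
    by (subst harnack_dominated_iff_mutual_ratio[OF assms]) simp_all
  then show ?thesis
    unfolding harnack_equivalent_def
    using XY \<open>1 \<le> mutual_ratio X Y\<close> by (auto simp: op_ball_def op_cball_def)
qed

lemma harnack_omega_eq:
  fixes X Y :: "('h::chilbert_space, 'n::finite) optuple"
  assumes infinite_dimensional: "\<forall>S :: 'h set. finite S \<longrightarrow> cspan S \<noteq> UNIV"
    and XY: "X \<in> op_ball" "Y \<in> op_ball"
  shows "harnack_omega X Y = mutual_ratio X Y"
proof -
  have ge: "1 \<le> mutual_ratio X Y"
    by (rule mutual_ratio_ge_1[OF assms])
  have "{c. 1 \<le> c \<and> harnack_dominated c X Y} = {mutual_ratio X Y..}"
    using ge harnack_dominated_iff_mutual_ratio[OF assms] by auto
  then show ?thesis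
    by (simp add: harnack_omega_def harnack_equivalent_op_ball[OF infinite_dimensional XY])
qed

lemma norm_adj_compose: "norm (adj T \<circ>\<^sub>C T) = (norm T)\<^sup>2"
proof (rule order_antisym)
  show "norm (adj T \<circ>\<^sub>C T) \<le> (norm T)\<^sup>2"
    using norm_ccompose_le[of "adj T" T] by (simp add: power2_eq_square)
  have "norm T \<le> sqrt (norm (adj T \<circ>\<^sub>C T))"
  proof (rule norm_cblinfun_bound, simp, rule power2_le_imp_le)
    fix x
    have "(norm (capply T x))\<^sup>2 = capply (adj T \<circ>\<^sub>C T) x \<bullet> x"
      by (simp add: power2_norm_eq_inner inner_adj_left)
    also have "\<dots> \<le> norm (capply (adj T \<circ>\<^sub>C T) x) * norm x"
      by (rule norm_cauchy_schwarz)
    also have "\<dots> \<le> norm (adj T \<circ>\<^sub>C T) * norm x * norm x"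
      by (intro mult_right_mono norm_capply_le norm_ge_zero)
    finally show "(norm (capply T x))\<^sup>2 \<le> (sqrt (norm (adj T \<circ>\<^sub>C T)) * norm x)\<^sup>2"
      by (simp add: power_mult_distrib) (simp add: power2_eq_square mult.assoc)
  qed simp
  then have "(norm T)\<^sup>2 \<le> (sqrt (norm (adj T \<circ>\<^sub>C T)))\<^sup>2"
    by (intro power_mono) auto
  then show "(norm T)\<^sup>2 \<le> norm (adj T \<circ>\<^sub>C T)"
    by simp
qed

text \<open>With \<open>T = C\<^sub>X C\<^sub>Y\<^sup>-\<^sup>1\<close> and \<open>S = T\<^sup>-\<^sup>1\<close> one has \<open>\<Gamma> = T\<^sup>* T\<close> and \<open>\<Gamma>\<^sup>-\<^sup>1 = S S\<^sup>*\<close>.\<close>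

lemma max_norm_kernel_Gamma:
  assumes X: "X \<in> op_ball" and Y: "Y \<in> op_ball"
  shows "max (norm (kernel_Gamma X Y)) (norm (cinverse (kernel_Gamma X Y))) = (mutual_ratio X Y)\<^sup>2"
proof -
  let ?T = "kernel_ratio X Y" and ?S = "kernel_ratio Y X"
  have TS: "capply ?T (capply ?S x) = x" and ST: "capply ?S (capply ?T x) = x" for x
    using kernel_ratio_comp[OF Y, of X X] kernel_ratio_self[OF X]
      kernel_ratio_comp[OF X, of Y Y] kernel_ratio_self[OF Y]
    by (metis capply_ccompose capply_cid)+
  have aTS: "capply (adj ?T) (capply (adj ?S) x) = x" for x
    by (rule eq_if_inner_eq) (simp add: inner_adj_left ST)
  have aST: "capply (adj ?S) (capply (adj ?T) x) = x" for x
    by (rule eq_if_inner_eq) (simp add: inner_adj_left TS)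
  have G: "kernel_Gamma X Y = adj ?T \<circ>\<^sub>C ?T"
    by (simp add: kernel_Gamma_def kernel_ratio_def)
  have "cinverse (kernel_Gamma X Y) = adj (adj ?S) \<circ>\<^sub>C adj ?S"
    unfolding G by (rule cinverse_eqI; rule cblinfun_eqI) (simp_all add: TS ST aTS aST)
  then have "norm (cinverse (kernel_Gamma X Y)) = (norm ?S)\<^sup>2"
    by (simp only: norm_adj_compose norm_adj)
  then show ?thesis
    unfolding G by (simp add: norm_adj_compose mutual_ratio_def max_def power_mono_iff)
qed

text \<open>Monotonicity and subadditivity of \<open>tanh\<close> on nonnegative reals, at \<open>ln a\<close> and \<open>ln b\<close>. In terms of \<open>s = a\<^sup>2\<close> and \<open>u = b\<^sup>2\<close>
  it comes down to \<open>(s - 1) (u - 1) \<ge> 0\<close>.\<close>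

lemma pseudohyp_sum_bound:
  fixes a b c :: real
  assumes a: "1 \<le> a" and b: "1 \<le> b" and c: "1 \<le> c" "c \<le> a * b"
  shows "(c\<^sup>2 - 1) / (c\<^sup>2 + 1) \<le> (a\<^sup>2 - 1) / (a\<^sup>2 + 1) + (b\<^sup>2 - 1) / (b\<^sup>2 + 1)"
proof -
  define s u where "s = a\<^sup>2" and "u = b\<^sup>2"
  have s: "1 \<le> s" and u: "1 \<le> u"
    using a b by (auto simp: s_def u_def)
  have su: "1 \<le> s * u"
    using mult_mono[OF s u] s by simp
  have "c\<^sup>2 \<le> (a * b)\<^sup>2"
    using c by (intro power_mono) auto
  then have cs: "c\<^sup>2 \<le> s * u"
    by (simp add: s_def u_def power_mult_distrib)
  have pos: "0 < c\<^sup>2 + 1" "0 < s * u + 1" "0 < s + 1" "0 < u + 1"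
    using su s u by (auto intro: add_nonneg_pos)
  have "(c\<^sup>2 - 1) / (c\<^sup>2 + 1) = 1 - 2 / (c\<^sup>2 + 1)"
    using pos by (simp add: field_simps)
  also have "\<dots> \<le> 1 - 2 / (s * u + 1)"
    using cs pos by (intro diff_left_mono divide_left_mono mult_pos_pos) auto
  also have "\<dots> = (s * u - 1) / (s * u + 1)"
    using pos by (simp add: field_simps)
  also have "\<dots> = (2 * (s * u - 1)) / (2 * (s * u + 1))"
    by (simp only: mult_divide_mult_cancel_left_if) simp
  also have "\<dots> \<le> (2 * (s * u - 1)) / ((s + 1) * (u + 1))"
  proof (rule divide_left_mono)
    have "0 \<le> (s - 1) * (u - 1)"
      using s u by simp
    then show "(s + 1) * (u + 1) \<le> 2 * (s * u + 1)"
      by (simp add: algebra_simps)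
  qed (use su pos in auto)
  also have "\<dots> = (s - 1) / (s + 1) + (u - 1) / (u + 1)"
    using pos by (simp add: divide_simps) (simp add: algebra_simps)
  finally show ?thesis
    by (simp add: s_def u_def)
qed

lemma harnack_dominated_commute: "0 < c \<Longrightarrow> harnack_dominated c A B \<longleftrightarrow> harnack_dominated c B A"
proof -
  assume c: "0 < c"
  have scale: "1 / c\<^sup>2 * s \<le> t \<longleftrightarrow> s \<le> c\<^sup>2 * t" for s t :: real
    using c by (simp add: divide_simps mult.commute)
  show ?thesis
    unfolding harnack_dominated_polyform scale by blast
qed

text \<open>A metric in the sense of \<open>Metric_space\<close> is symmetric and nonnegative on the whole type, so these
  two properties are derived directly from the definition, for arbitrary tuples.\<close>

lemma harnack_omega_commute: "harnack_omega A B = harnack_omega B A"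
proof -
  have *: "{c. 1 \<le> c \<and> harnack_dominated c A B} = {c. 1 \<le> c \<and> harnack_dominated c B A}"
    using harnack_dominated_commute[of _ A B] by auto
  then have "harnack_equivalent A B \<longleftrightarrow> harnack_equivalent B A"
    unfolding harnack_equivalent_def by (auto simp: set_eq_iff)
  then show ?thesis
    by (simp add: harnack_omega_def *)
qed

lemma harnack_omega_ge_1: "1 \<le> harnack_omega A B"
  by (auto simp: harnack_omega_def harnack_equivalent_def intro!: cInf_greatest)

lemma pseudohyp_nonneg: "0 \<le> pseudohyp A B"
  using power_mono[OF harnack_omega_ge_1[of A B], of 2] by (simp add: pseudohyp_def)

lemma inner_poisson_difference:
  assumes "X \<in> op_ball" "Y \<in> op_ball"
  shows "poisson X (\<Sum>i\<in>UNIV. sgl [i] (v i)) (sgl [] k) - poisson Y (\<Sum>i\<in>UNIV. sgl [i] (v i)) (sgl [] k) =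
    (\<Sum>i\<in>UNIV. capply ((X - Y) $ i) (v i)) \<bullet> k"
  by (simp add: poisson_sum poisson_vacuum assms op_word_Cons op_word_Nil inner_sum_left
      inner_diff_left sum_subtractf)

text \<open>The tuple is read off from the first row of its Poisson kernel, so closeness of the kernels,
  which is a matter of quadratic forms, gives closeness of the tuples.\<close>

lemma row_norm_diff_le_poisson:
  fixes X Y :: "('h::chilbert_space, 'n::finite) optuple"
  assumes XY: "X \<in> op_ball" "Y \<in> op_ball" and K: "0 \<le> K"
    and *: "\<And>x. \<bar>poisson X x x - poisson Y x x\<bar> \<le> K * (norm x)\<^sup>2"
  shows "row_norm (X - Y) \<le> K"
proof (rule row_norm_le[OF K])
  fix v :: "'n \<Rightarrow> 'h"
  define T where "T = adj (kernel_C X) \<circ>\<^sub>C kernel_C X - adj (kernel_C Y) \<circ>\<^sub>C kernel_C Y"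
  have T: "capply T x \<bullet> y = poisson X x y - poisson Y x y" for x y
    by (simp add: T_def inner_diff_left inner_adj_left poisson_def)
  have nT: "norm T \<le> K"
  proof (rule norm_le_numerical_radius[OF _ _ K])
    show "capply T x \<bullet> y = x \<bullet> capply T y" for x y
      using T[of x y] T[of y x] by (simp add: poisson_commute[of _ y] inner_commute)
    show "\<bar>capply T x \<bullet> x\<bar> \<le> K * (norm x)\<^sup>2" for x
      unfolding T by (rule *)
  qed
  define x where "x = (\<Sum>i\<in>UNIV. sgl [i] (v i))"
  define k where "k = (\<Sum>i\<in>UNIV. capply ((X - Y) $ i) (v i))"
  have nx: "(norm x)\<^sup>2 = (\<Sum>i\<in>UNIV. (norm (v i))\<^sup>2)"
    by (simp add: x_def power2_norm_eq_inner inner_sum_left inner_sum_right sum.delta if_distrib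
        cong: if_cong)
  have "norm k * norm k = capply T x \<bullet> sgl [] k"
    unfolding T x_def inner_poisson_difference[OF XY] k_def[symmetric]
    by (simp add: power2_norm_eq_inner[symmetric] power2_eq_square)
  also have "\<dots> \<le> norm (capply T x) * norm k"
    using norm_cauchy_schwarz[of "capply T x" "sgl [] k"] by simp
  also have "\<dots> \<le> norm T * norm x * norm k"
    by (intro mult_right_mono norm_capply_le norm_ge_zero)
  also have "\<dots> \<le> K * norm x * norm k"
    by (intro mult_right_mono nT norm_ge_zero)
  finally have "norm k \<le> K * norm x"
    by (cases "k = 0") (simp_all add: K)
  then have "(norm k)\<^sup>2 \<le> (K * norm x)\<^sup>2"
    by (intro power_mono) auto
  then show "(norm (\<Sum>i\<in>UNIV. capply ((X - Y) $ i) (v i)))\<^sup>2 \<le> K\<^sup>2 * (\<Sum>i\<in>UNIV. (norm (v i))\<^sup>2)"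
    by (simp add: k_def power_mult_distrib nx)
qed

text \<open>\<open>P(X)\<close> and \<open>P(Y)\<close> differ by at most \<open>(\<omega>\<^sup>2 - 1) P(X)\<close> in either direction.\<close>

lemma row_norm_diff_le:
  fixes X Y :: "('h::chilbert_space, 'n::finite) optuple"
  assumes X: "X \<in> op_ball" and Y: "Y \<in> op_ball" and ge: "1 \<le> mutual_ratio X Y"
  shows "row_norm (X - Y) \<le> ((mutual_ratio X Y)\<^sup>2 - 1) * (norm (kernel_C X))\<^sup>2"
proof (rule row_norm_diff_le_poisson[OF X Y])
  let ?c = "mutual_ratio X Y"
  have c: "1 \<le> ?c\<^sup>2"
    using ge by simp
  then show "0 \<le> (?c\<^sup>2 - 1) * (norm (kernel_C X))\<^sup>2"
    by simp
  fix x
  have "poisson X x x \<le> ?c\<^sup>2 * poisson Y x x" "poisson Y x x \<le> ?c\<^sup>2 * poisson X x x"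
    using poisson_le_iff_kernel_ratio[OF Y, of ?c X] poisson_le_iff_kernel_ratio[OF X, of ?c Y] ge
    by (auto simp: mutual_ratio_def)
  moreover have "poisson X x x - poisson Y x x \<le> (?c\<^sup>2 - 1) * poisson X x x"
  proof (cases "poisson X x x \<le> poisson Y x x")
    case False
    then have "(?c\<^sup>2 - 1) * poisson Y x x \<le> (?c\<^sup>2 - 1) * poisson X x x"
      using c by (intro mult_left_mono) auto
    with \<open>poisson X x x \<le> ?c\<^sup>2 * poisson Y x x\<close> show ?thesis
      by (simp add: algebra_simps)
  next
    case True
    moreover have "0 \<le> (?c\<^sup>2 - 1) * poisson X x x"
      using c by (simp add: poisson_self)
    ultimately show ?thesis
      by linarith
  qed
  ultimately have "\<bar>poisson X x x - poisson Y x x\<bar> \<le> (?c\<^sup>2 - 1) * poisson X x x"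
    by (simp add: algebra_simps abs_le_iff)
  also have "\<dots> \<le> (?c\<^sup>2 - 1) * ((norm (kernel_C X))\<^sup>2 * (norm x)\<^sup>2)"
    unfolding poisson_self power_mult_distrib[symmetric]
    using c by (intro mult_left_mono power_mono norm_capply_le) auto
  finally show "\<bar>poisson X x x - poisson Y x x\<bar> \<le> (?c\<^sup>2 - 1) * (norm (kernel_C X))\<^sup>2 * (norm x)\<^sup>2"
    by (simp add: mult.assoc)
qed

lemma row_norm_metric:
  "Metric_space (op_ball :: ('h::chilbert_space, 'n::finite) optuple set) (\<lambda>X Y. row_norm (X - Y))"
proof
  fix X Y Z :: "('h, 'n) optuple"
  have *: "row_norm (X - Y) = norm (reconstruction X - reconstruction Y)" for X Y :: "('h, 'n) optuple"
    by (simp add: norm_reconstruction[symmetric] reconstruction_diff)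
  show "0 \<le> row_norm (X - Y)"
    by (rule row_norm_nonneg)
  show "row_norm (X - Y) = row_norm (Y - X)"
    unfolding * by (rule norm_minus_commute)
  show "row_norm (X - Z) \<le> row_norm (X - Y) + row_norm (Y - Z)"
    unfolding *
    using norm_triangle_ineq[of "reconstruction X - reconstruction Y" "reconstruction Y - reconstruction Z"]
    by simp
  show "row_norm (X - Y) = 0 \<longleftrightarrow> X = Y"
  proof
    assume "row_norm (X - Y) = 0"
    then have eq: "reconstruction X = reconstruction Y"
      by (simp add: *)
    have "adj (X $ i) = adj (Y $ i)" for i
    proof (rule cblinfun_eqI)
      fix h
      have "coord (capply (reconstruction X) (sgl [] h)) [i] = coord (capply (reconstruction Y) (sgl [] h)) [i]"
        by (simp add: eq)
      then show "capply (adj (X $ i)) h = capply (adj (Y $ i)) h"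
        by (simp add: coord_reconstruction)
    qed
    then show "X = Y"
      by (metis adj_adj vec_eq_iff)
  next
    assume "X = Y"
    then show "row_norm (X - Y) = 0"
      unfolding * by simp
  qed
qed

lemma pseudohyp_metric:
  assumes infinite_dimensional: "\<forall>S :: 'h::chilbert_space set. finite S \<longrightarrow> cspan S \<noteq> UNIV"
  shows "Metric_space (op_ball :: ('h, 'n::finite) optuple set) pseudohyp"
proof
  fix X Y Z :: "('h, 'n) optuple"
  note omega = harnack_omega_eq[OF infinite_dimensional]
  note ge = mutual_ratio_ge_1[OF infinite_dimensional]
  show "0 \<le> pseudohyp X Y"
    by (rule pseudohyp_nonneg)
  show "pseudohyp X Y = pseudohyp Y X"
    by (simp add: pseudohyp_def harnack_omega_commute)
  assume X: "X \<in> op_ball" and Y: "Y \<in> op_ball"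
  show "pseudohyp X Y = 0 \<longleftrightarrow> X = Y"
  proof
    assume "pseudohyp X Y = 0"
    moreover have "0 < (mutual_ratio X Y)\<^sup>2 + 1"
      by (simp add: add_nonneg_pos)
    ultimately have "(mutual_ratio X Y)\<^sup>2 = 1"
      by (simp add: pseudohyp_def omega[OF X Y])
    then have "row_norm (X - Y) \<le> 0"
      using row_norm_diff_le[OF X Y ge[OF X Y]] by simp
    then have "row_norm (X - Y) = 0"
      using row_norm_nonneg[of "X - Y"] by simp
    then show "X = Y"
      using Metric_space.zero[OF row_norm_metric X Y] by simp
  next
    have "norm (cid :: (('n list, 'h) ell2, ('n list, 'h) ell2) cblinfun) \<le> 1"
      by (rule norm_cblinfun_bound) auto
    then have "mutual_ratio X X \<le> 1"
      by (simp add: mutual_ratio_def kernel_ratio_self[OF X])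
    then have "mutual_ratio X X = 1"
      using ge[OF X X] by simp
    then have "pseudohyp X X = 0"
      by (simp add: pseudohyp_def omega[OF X X])
    moreover assume "X = Y"
    ultimately show "pseudohyp X Y = 0"
      by simp
  qed
  assume Z: "Z \<in> op_ball"
  show "pseudohyp X Z \<le> pseudohyp X Y + pseudohyp Y Z"
    unfolding pseudohyp_def omega[OF X Y] omega[OF Y Z] omega[OF X Z]
    by (intro pseudohyp_sum_bound ge X Y Z mutual_ratio_triangle)
qed

section \<open>Scalar points\<close>

lemma adj_scaleC_cid: "adj (a *\<^sub>C cid) = cnj a *\<^sub>C cid"
  by (rule adj_unique) (simp add: inner_scaleC_left)

lemma scalar_tuple_in_op_ball:
  assumes "norm z < 1"
  shows "(scalar_tuple z :: ('h::chilbert_space, 'n::finite) optuple) \<in> op_ball"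
proof -
  have "row_norm (scalar_tuple z :: ('h, 'n) optuple) \<le> norm z"
  proof (rule row_norm_le[OF norm_ge_zero])
    fix v :: "'n \<Rightarrow> 'h"
    have "norm (\<Sum>i\<in>UNIV. capply (scalar_tuple z $ i) (v i)) \<le> (\<Sum>i\<in>UNIV. \<bar>cmod (z $ i)\<bar> * \<bar>norm (v i)\<bar>)"
      by (rule sum_norm_le) (simp add: scalar_tuple_def norm_scaleC)
    also have "\<dots> \<le> L2_set (\<lambda>i. cmod (z $ i)) UNIV * L2_set (\<lambda>i. norm (v i)) UNIV"
      by (rule L2_set_mult_ineq)
    finally have "(norm (\<Sum>i\<in>UNIV. capply (scalar_tuple z $ i) (v i)))\<^sup>2 \<le>
        (norm z * L2_set (\<lambda>i. norm (v i)) UNIV)\<^sup>2"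
      unfolding norm_vec_def by (intro power_mono) auto
    then show "(norm (\<Sum>i\<in>UNIV. capply (scalar_tuple z $ i) (v i)))\<^sup>2 \<le>
        (norm z)\<^sup>2 * (\<Sum>i\<in>UNIV. (norm (v i))\<^sup>2)"
      by (simp add: power_mult_distrib L2_set_def sum_nonneg)
  qed
  with assms show ?thesis
    by (simp add: op_ball_def)
qed

text \<open>Up to conjugation of the coefficients this appends the vector \<open>z\<close> at the right.\<close>

abbreviation R_scalar :: "complex ^ 'n::finite \<Rightarrow> (('n list, 'h::chilbert_space) ell2, ('n list, 'h) ell2) cblinfun"
  where "R_scalar z \<equiv> reconstruction (scalar_tuple z)"

lemma inner_R_scalar: "capply (R_scalar q) x \<bullet> capply (R_scalar p) y = (cinner p q *\<^sub>C x) \<bullet> y"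
proof -
  have a: "capply (ampl (adj (scalar_tuple q $ i))) x = cnj (q $ i) *\<^sub>C x" for q i x
    by (rule ell2_eqI) (simp add: scalar_tuple_def adj_scaleC_cid)
  have "capply (R_scalar q) x \<bullet> capply (R_scalar p) y =
      (\<Sum>i\<in>UNIV. ((p $ i * cnj (q $ i)) *\<^sub>C x) \<bullet> y)"
    unfolding inner_reconstruction a
    by (simp add: inner_scaleC_left scaleC_scaleC mult.commute)
  also have "\<dots> = (cinner p q *\<^sub>C x) \<bullet> y"
    by (simp add: cinner_vec_def cinner_complex_def complex_vs.scale_sum_left inner_sum_left)
  finally show ?thesis .
qed

lemma coord_R_scalar:
  "coord (capply (R_scalar q) x) v = (if v = [] then 0 else cnj (q $ last v) *\<^sub>C coord x (butlast v))"
  by (simp add: coord_reconstruction scalar_tuple_def adj_scaleC_cid)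

lemma R_scalar_diff:
  "capply (R_scalar (w - b *\<^sub>C z)) x = capply (R_scalar w) x - cnj b *\<^sub>C capply (R_scalar z) x"
  by (rule ell2_eqI) (simp add: coord_R_scalar complex_vs.scale_left_diff_distrib scaleC_scaleC
      scaleC_vec_def scaleC_complex_def)

lemma norm_R_scalar: "(norm (capply (R_scalar q) x))\<^sup>2 = (norm q)\<^sup>2 * (norm x)\<^sup>2"
  unfolding power2_norm_eq_inner[of "capply _ _"] inner_R_scalar cinner_self scaleR_scaleC[symmetric]
  by (simp add: power2_norm_eq_inner)

lemma poisson_scalar:
  assumes "norm z < 1"
  shows "poisson (scalar_tuple z) x x = (1 - (norm z)\<^sup>2) * (norm (capply (resolvent (scalar_tuple z)) x))\<^sup>2"
  unfolding poisson_defect[OF scalar_tuple_in_op_ball[OF assms]] power2_norm_eq_inner[symmetric] norm_R_scalar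
  by (simp add: algebra_simps)

text \<open>The norm \<open>1 + t\<close> of \<open>I - S\<close> is approached on the vectors \<open>x = \<Sum> (- s S)\<^sup>j k\<close>, that is,
  \<open>k = x + s S x\<close>, where \<open>s t\<close> tends to 1: as \<open>k\<close> is orthogonal to the range of \<open>S\<close>, they satisfy
  \<open>\<langle>S x, x\<rangle> = - s \<parallel>S x\<parallel>\<^sup>2\<close>.\<close>

lemma nonunitary_isometry_bound:
  fixes S :: "('a::chilbert_space, 'a) cblinfun"
  assumes t: "0 \<le> t" and iso: "\<And>x. norm (capply S x) = t * norm x"
    and k: "k \<noteq> 0" "\<And>x. capply S x \<bullet> k = 0"
    and C: "\<And>x. (norm (x - capply S x))\<^sup>2 \<le> C * (norm x)\<^sup>2"
  shows "(1 + t)\<^sup>2 \<le> C"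
proof -
  have *: "2 * r * t \<le> C - 1 - t\<^sup>2" if r: "0 \<le> r" "r < 1" for r
  proof -
    \<comment> \<open>For \<open>t = 0\<close> this is \<open>s = 0\<close>, and the inequality still holds.\<close>
    define s where "s = r / t"
    have st: "s * t = (if t = 0 then 0 else r)" and s0: "0 \<le> s"
      using t r by (auto simp: s_def)
    have "norm (- s *\<^sub>R S) \<le> s * t"
      by (rule norm_cblinfun_bound) (use s0 t iso in \<open>auto simp: mult.assoc\<close>)
    also have "\<dots> < 1"
      using st r by auto
    finally have "norm (- s *\<^sub>R S) < 1" .
    then obtain Z where Z: "(cid - - s *\<^sub>R S) \<circ>\<^sub>C Z = cid"
      by (rule neumann_inverse)
    define x where "x = capply Z k"
    have "capply ((cid - - s *\<^sub>R S) \<circ>\<^sub>C Z) k = k"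
      unfolding Z by simp
    then have kx: "k = x + s *\<^sub>R capply S x"
      by (simp add: x_def)
    then have x0: "x \<noteq> 0"
      using k(1) by auto
    have "0 = capply S x \<bullet> (x + s *\<^sub>R capply S x)"
      using k(2)[of x] kx by simp
    then have xS: "capply S x \<bullet> x = - (s * t\<^sup>2 * (norm x)\<^sup>2)"
      by (simp add: inner_add_right power2_norm_eq_inner[symmetric] iso power_mult_distrib)
    have "(norm (x - capply S x))\<^sup>2 = (1 + t\<^sup>2 + 2 * (s * t) * t) * (norm x)\<^sup>2"
      unfolding power2_norm_eq_inner[of "x - _"] inner_diff_left inner_diff_right
        inner_commute[of x "capply S x"] xS
      by (simp add: power2_norm_eq_inner[symmetric] iso power_mult_distrib algebra_simps power2_eq_square)
    also have "2 * (s * t) * t = 2 * r * t"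
      by (simp add: st)
    finally have "(1 + t\<^sup>2 + 2 * r * t) * (norm x)\<^sup>2 \<le> C * (norm x)\<^sup>2"
      using C[of x] by simp
    then have "1 + t\<^sup>2 + 2 * r * t \<le> C"
      using x0 by simp
    then show ?thesis
      by simp
  qed
  have "2 * 1 * t \<le> C - 1 - t\<^sup>2"
  proof (rule tendsto_upperbound)
    show "((\<lambda>r. 2 * r * t) \<longlongrightarrow> 2 * 1 * t) (at_left (1::real))"
      by (intro tendsto_intros)
    have "\<forall>\<^sub>F r in at_left (1::real). r \<in> {0<..<1}"
      by (rule eventually_at_left_real) simp
    then show "\<forall>\<^sub>F r in at_left (1::real). 2 * r * t \<le> C - 1 - t\<^sup>2"
      by (rule eventually_mono) (use * in auto)
  qed simp
  then show ?thesis
    by (simp add: power2_eq_square algebra_simps)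
qed

text \<open>The factorization \<open>(I - R\<^sub>w)\<^sup>-\<^sup>1 (I - R\<^sub>z) = b\<^sup>-\<^sup>1 (I - S)\<close> is the operator analogue of the identity
  \<open>(1 - \<langle>a, z\<rangle>) / (1 - \<langle>a, w\<rangle>) = b\<^sup>-\<^sup>1 (1 - \<langle>\<psi>\<^sub>w(a), \<psi>\<^sub>w(z)\<rangle>)\<close> on the Euclidean ball, where
  \<open>b = (1 - \<parallel>w\<parallel>\<^sup>2) / (1 - \<langle>w, z\<rangle>)\<close>. With \<open>y = S x\<close>, \<open>c = 1 - b\<close> and a suitable \<open>q\<close> one has
  \<open>y - c x = R\<^sub>w y - R\<^sub>q x\<close>, and this value of \<open>b\<close> makes the cross terms in the squared norms of the
  two sides cancel, which leaves \<open>\<parallel>y\<parallel> = t \<parallel>x\<parallel>\<close>. The vector \<open>(I - R\<^sub>w)\<^sup>-\<^sup>1 (h \<otimes> 1)\<close> is orthogonal to the range of \<open>S\<close>.\<close>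

lemma scalar_kernel_factorization:
  fixes z w :: "complex ^ 'n::finite" and h :: "'h::chilbert_space"
  assumes z: "norm z < 1" and w: "norm w < 1" and h: "h \<noteq> 0"
  defines "t \<equiv> norm (ball_involution z w)"
  obtains S :: "(('n list, 'h) ell2, ('n list, 'h) ell2) cblinfun" and k
  where "\<And>x. norm (capply S x) = t * norm x" "k \<noteq> 0" "\<And>x. capply S x \<bullet> k = 0"
    "\<And>x. poisson (scalar_tuple w) (x - capply (R_scalar z) x) (x - capply (R_scalar z) x) * (1 - t\<^sup>2) =
      (1 - (norm z)\<^sup>2) * (norm (x - capply S x))\<^sup>2"
proof -
  let ?R = "R_scalar :: complex ^ 'n \<Rightarrow> (('n list, 'h) ell2, ('n list, 'h) ell2) cblinfun"
  let ?W = "resolvent (scalar_tuple w) :: (('n list, 'h) ell2, ('n list, 'h) ell2) cblinfun"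
  have wb: "(scalar_tuple w :: ('h, 'n) optuple) \<in> op_ball"
    by (rule scalar_tuple_in_op_ball[OF w])
  define g where "g = cinner w z"
  have "cmod g \<le> norm w * norm z"
    by (simp add: g_def norm_cinner_le)
  also have "\<dots> < 1"
    using mult_strict_mono'[OF w z] by simp
  finally have g1: "1 - g \<noteq> 0"
    by auto
  have w1: "0 < 1 - (norm w)\<^sup>2" and z1: "0 < 1 - (norm z)\<^sup>2"
    using w z by (simp_all add: power_less_one_iff)
  define b where "b = complex_of_real (1 - (norm w)\<^sup>2) / (1 - g)"
  have b: "b * (1 - g) = complex_of_real (1 - (norm w)\<^sup>2)"
    using g1 by (simp add: b_def)
  have nb: "(cmod b)\<^sup>2 * (cmod (1 - g))\<^sup>2 = (1 - (norm w)\<^sup>2)\<^sup>2"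
    unfolding power_mult_distrib[symmetric] norm_mult[symmetric] b
    by (simp only: norm_of_real power2_abs)
  define c where "c = 1 - b"
  define q where "q = w - cnj b *\<^sub>C z"
  have wq: "cinner w q = c"
    using b by (simp add: q_def cinner_diff_right cinner_scaleC_right cinner_self g_def[symmetric] c_def
        algebra_simps)
  have t2: "1 - t\<^sup>2 = (1 - (norm z)\<^sup>2) * (1 - (norm w)\<^sup>2) / (cmod (1 - g))\<^sup>2"
    unfolding t_def g_def by (rule ball_involution_norm[OF z w])
  have t2': "(1 - t\<^sup>2) * (1 - (norm w)\<^sup>2) = (cmod b)\<^sup>2 * (1 - (norm z)\<^sup>2)"
  proof -
    have "(1 - t\<^sup>2) * (1 - (norm w)\<^sup>2) = (1 - (norm z)\<^sup>2) * (1 - (norm w)\<^sup>2)\<^sup>2 / (cmod (1 - g))\<^sup>2"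
      unfolding t2 by (simp add: power2_eq_square)
    then show ?thesis
      using g1 unfolding nb[symmetric] by simp
  qed
  have nq: "(norm q)\<^sup>2 - (cmod c)\<^sup>2 = t\<^sup>2 * (1 - (norm w)\<^sup>2)"
  proof -
    have "w \<bullet> (cnj b *\<^sub>C z) = Re (b * g)"
      unfolding Re_cinner[symmetric] by (simp add: cinner_scaleC_right g_def)
    then have "(norm q)\<^sup>2 = (norm w)\<^sup>2 + (cmod b)\<^sup>2 * (norm z)\<^sup>2 - 2 * Re (b * g)"
      unfolding q_def power2_norm_eq_inner[of "w - _"] inner_diff_left inner_diff_right
        inner_commute[of "cnj b *\<^sub>C z" w]
      by (simp add: power2_norm_eq_inner[symmetric] norm_scaleC power_mult_distrib)
    moreover have "(cmod c)\<^sup>2 = 1 + (cmod b)\<^sup>2 - 2 * Re b"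
      unfolding c_def cmod_power2 by (simp add: power2_eq_square algebra_simps)
    moreover have "Re b - Re (b * g) = 1 - (norm w)\<^sup>2"
      using arg_cong[OF b, of Re] by (simp add: algebra_simps)
    moreover have "t\<^sup>2 * (1 - (norm w)\<^sup>2) = (1 - (norm w)\<^sup>2) - (cmod b)\<^sup>2 * (1 - (norm z)\<^sup>2)"
      using t2' by (simp add: algebra_simps)
    ultimately show ?thesis
      by (simp add: algebra_simps)
  qed
  define S where "S = cid - b *\<^sub>C (?W \<circ>\<^sub>C (cid - ?R z))"
  have S: "capply S x = x - b *\<^sub>C capply ?W (x - capply (?R z) x)" for x
    by (simp add: S_def)
  have solves: "u - capply (?R w) u = x" if "u = capply ?W x" for u x
    using resolvent_unfold[OF wb, of x] that by (simp add: algebra_simps)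
  have SR: "capply S x - capply (?R w) (capply S x) = c *\<^sub>C x - capply (?R q) x" for x
  proof -
    let ?v = "capply ?W (x - capply (?R z) x)"
    have "capply S x - capply (?R w) (capply S x) =
        (x - capply (?R w) x) - b *\<^sub>C (?v - capply (?R w) ?v)"
      by (simp only: S capply_linear(2) capply_scaleC complex_vs.scale_right_diff_distrib) simp
    also have "?v - capply (?R w) ?v = x - capply (?R z) x"
      by (rule solves[OF refl])
    finally show ?thesis
      by (simp add: q_def R_scalar_diff c_def complex_vs.scale_left_diff_distrib
          complex_vs.scale_right_diff_distrib)
  qed
  have iso: "norm (capply S x) = t * norm x" for x
  proof -
    let ?y = "capply S x"
    have "?y - c *\<^sub>C x = capply (?R w) ?y - capply (?R q) x"
      using SR[of x] by (simp add: algebra_simps)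
    then have "(norm (?y - c *\<^sub>C x))\<^sup>2 = (norm (capply (?R w) ?y - capply (?R q) x))\<^sup>2"
      by simp
    moreover have "(norm (?y - c *\<^sub>C x))\<^sup>2 = (norm ?y)\<^sup>2 + (cmod c)\<^sup>2 * (norm x)\<^sup>2 - 2 * ((c *\<^sub>C x) \<bullet> ?y)"
      unfolding power2_norm_eq_inner[of "_ - _"] inner_diff_left inner_diff_right
        inner_commute[of ?y "c *\<^sub>C x"]
      by (simp add: power2_norm_eq_inner[symmetric] norm_scaleC power_mult_distrib)
    moreover have "(norm (capply (?R w) ?y - capply (?R q) x))\<^sup>2 =
        (norm w)\<^sup>2 * (norm ?y)\<^sup>2 + (norm q)\<^sup>2 * (norm x)\<^sup>2 - 2 * ((c *\<^sub>C x) \<bullet> ?y)"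
      unfolding power2_norm_eq_inner[of "_ - _"] inner_diff_left inner_diff_right
        inner_commute[of "capply (?R w) ?y" "capply (?R q) x"] inner_R_scalar[of q x w] wq
      by (simp add: power2_norm_eq_inner[symmetric] norm_R_scalar)
    ultimately have "(1 - (norm w)\<^sup>2) * (norm ?y)\<^sup>2 = ((norm q)\<^sup>2 - (cmod c)\<^sup>2) * (norm x)\<^sup>2"
      by (simp add: algebra_simps)
    then have "(1 - (norm w)\<^sup>2) * (norm ?y)\<^sup>2 = (1 - (norm w)\<^sup>2) * (t * norm x)\<^sup>2"
      by (simp add: nq power_mult_distrib mult_ac)
    then have "(norm ?y)\<^sup>2 = (t * norm x)\<^sup>2"
      using w1 by simp
    then show ?thesis
      by (rule power2_eq_imp_eq) (simp_all add: t_def)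
  qed
  define k where "k = capply ?W (sgl [] h)"
  have k: "k - capply (?R w) k = sgl [] h"
    by (rule solves[OF k_def])
  have k0: "k \<noteq> 0"
  proof
    assume "k = 0"
    then have "norm (sgl [] h :: ('n list, 'h) ell2) = 0"
      using k by simp
    then show False
      using h by simp
  qed
  have kk: "k = sgl [] h + capply (?R w) k"
    using k by (simp add: algebra_simps)
  have Rk: "capply (?R p) y \<bullet> k = (cinner w p *\<^sub>C y) \<bullet> k" for p y
  proof -
    have "capply (?R p) y \<bullet> k = capply (?R p) y \<bullet> sgl [] h + capply (?R p) y \<bullet> capply (?R w) k"
      by (subst kk) (rule inner_add_right)
    then show ?thesis
      by (simp add: coord_reconstruction inner_R_scalar)
  qed
  have orth: "capply S x \<bullet> k = 0" for x
  proof -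
    let ?y = "capply S x"
    have "(?y - capply (?R w) ?y) \<bullet> k = (1 - (norm w)\<^sup>2) * (?y \<bullet> k)"
      by (simp only: inner_diff_left Rk cinner_self scaleR_scaleC[symmetric] inner_scaleR_left
          left_diff_distrib mult_1)
    moreover have "(c *\<^sub>C x - capply (?R q) x) \<bullet> k = 0"
      by (simp add: inner_diff_left Rk wq)
    ultimately show ?thesis
      using SR[of x] w1 by simp
  qed
  show ?thesis
  proof (rule that[OF iso k0 orth])
    fix x
    have "x - capply S x = b *\<^sub>C capply ?W (x - capply (?R z) x)"
      by (simp add: S)
    then have "(norm (x - capply S x))\<^sup>2 = (cmod b)\<^sup>2 * (norm (capply ?W (x - capply (?R z) x)))\<^sup>2"
      by (simp only: norm_scaleC power_mult_distrib)
    then have "(1 - (norm z)\<^sup>2) * (norm (x - capply S x))\<^sup>2 =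
        (cmod b)\<^sup>2 * (1 - (norm z)\<^sup>2) * (norm (capply ?W (x - capply (?R z) x)))\<^sup>2"
      by simp
    also have "\<dots> = (1 - t\<^sup>2) * ((1 - (norm w)\<^sup>2) * (norm (capply ?W (x - capply (?R z) x)))\<^sup>2)"
      unfolding t2'[symmetric] by simp
    finally show "poisson (scalar_tuple w) (x - capply (R_scalar z) x) (x - capply (R_scalar z) x) * (1 - t\<^sup>2) =
        (1 - (norm z)\<^sup>2) * (norm (x - capply S x))\<^sup>2"
      unfolding poisson_scalar[OF w] by simp
  qed
qed

lemma norm_ball_involution_less_1:
  assumes "norm z < 1" "norm w < 1"
  shows "norm (ball_involution z w) < 1"
proof -
  have "cmod (cinner w z) \<le> norm w * norm z"
    by (rule norm_cinner_le)
  also have "\<dots> < 1"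
    using mult_strict_mono'[OF assms(2,1)] by simp
  finally have "1 - cinner w z \<noteq> 0"
    by auto
  then have "0 < 1 - (norm (ball_involution z w))\<^sup>2"
    unfolding ball_involution_norm[OF assms] using assms
    by (intro divide_pos_pos mult_pos_pos) (simp_all add: power_less_one_iff)
  then show ?thesis
    by (simp add: power_less_one_iff)
qed

lemma norm_ball_involution_commute:
  assumes "norm z < 1" "norm w < 1"
  shows "norm (ball_involution z w) = norm (ball_involution w z)"
proof -
  have "cmod (1 - cinner w z) = cmod (1 - cinner z w)"
    by (subst cinner_commute) (metis complex_cnj_diff complex_cnj_one complex_mod_cnj)
  then have "1 - (norm (ball_involution z w))\<^sup>2 = 1 - (norm (ball_involution w z))\<^sup>2"
    unfolding ball_involution_norm[OF assms] ball_involution_norm[OF assms(2,1)]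
    by (simp only: mult.commute)
  then have "(norm (ball_involution z w))\<^sup>2 = (norm (ball_involution w z))\<^sup>2"
    by linarith
  then show ?thesis
    by (rule power2_eq_imp_eq) simp_all
qed

text \<open>By the factorization, \<open>\<parallel>C\<^sub>w C\<^sub>z\<^sup>-\<^sup>1\<parallel>\<^sup>2 = \<parallel>I - S\<parallel>\<^sup>2 / (1 - t\<^sup>2)\<close>, and \<open>\<parallel>I - S\<parallel> = 1 + t\<close>.\<close>

lemma norm_kernel_ratio_scalar:
  fixes z w :: "complex ^ 'n::finite" and h :: "'h::chilbert_space"
  assumes z: "norm z < 1" and w: "norm w < 1" and h: "h \<noteq> 0"
  defines "t \<equiv> norm (ball_involution z w)"
  shows "(norm (kernel_ratio (scalar_tuple w :: ('h, 'n) optuple) (scalar_tuple z)))\<^sup>2 = (1 + t) / (1 - t)"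
proof -
  let ?z = "scalar_tuple z :: ('h, 'n) optuple" and ?w = "scalar_tuple w :: ('h, 'n) optuple"
  let ?N = "norm (kernel_ratio ?w ?z)"
  have zb: "?z \<in> op_ball" and wb: "?w \<in> op_ball"
    using z w by (simp_all add: scalar_tuple_in_op_ball)
  have t: "0 \<le> t" "t < 1"
    using norm_ball_involution_less_1[OF z w] by (simp_all add: t_def)
  have t2: "0 < 1 - t\<^sup>2" and tt: "1 - t\<^sup>2 = (1 + t) * (1 - t)"
    using t by (simp_all add: power_less_one_iff) (simp add: power2_eq_square algebra_simps)
  obtain S :: "(('n list, 'h) ell2, ('n list, 'h) ell2) cblinfun" and k
    where iso: "\<And>x. norm (capply S x) = t * norm x" and k: "k \<noteq> 0" "\<And>x. capply S x \<bullet> k = 0"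
      and P: "\<And>x. poisson ?w (x - capply (R_scalar z) x) (x - capply (R_scalar z) x) * (1 - t\<^sup>2) =
        (1 - (norm z)\<^sup>2) * (norm (x - capply S x))\<^sup>2"
    using scalar_kernel_factorization[OF z w h] unfolding t_def by blast
  have z1: "0 < 1 - (norm z)\<^sup>2"
    using z by (simp add: power_less_one_iff)
  have resz: "capply (resolvent ?z) (x - capply (R_scalar z) x) = x" for x
    by (rule resolvent_eqI[OF zb]) simp
  have Pz: "poisson ?z (x - capply (R_scalar z) x) (x - capply (R_scalar z) x) = (1 - (norm z)\<^sup>2) * (norm x)\<^sup>2"
    for x
    unfolding poisson_scalar[OF z] resz ..
  have "(1 + t)\<^sup>2 \<le> ?N\<^sup>2 * (1 - t\<^sup>2)"
  proof (rule nonunitary_isometry_bound[OF t(1) iso k])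
    fix x :: "('n list, 'h) ell2"
    let ?y = "x - capply (R_scalar z) x"
    have "poisson ?w ?y ?y \<le> ?N\<^sup>2 * poisson ?z ?y ?y"
      using poisson_le_iff_kernel_ratio[OF zb, of ?N ?w] by simp
    then have "(1 - (norm z)\<^sup>2) * (norm (x - capply S x))\<^sup>2 \<le> (?N\<^sup>2 * poisson ?z ?y ?y) * (1 - t\<^sup>2)"
      unfolding P[symmetric] using t2 by (intro mult_right_mono) auto
    also have "\<dots> = (1 - (norm z)\<^sup>2) * (?N\<^sup>2 * (1 - t\<^sup>2) * (norm x)\<^sup>2)"
      unfolding Pz by simp
    finally show "(norm (x - capply S x))\<^sup>2 \<le> ?N\<^sup>2 * (1 - t\<^sup>2) * (norm x)\<^sup>2"
      using z1 by simp
  qed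
  then have "(1 + t) * (1 + t) \<le> (?N\<^sup>2 * (1 - t)) * (1 + t)"
    unfolding tt by (simp add: power2_eq_square mult_ac)
  then have "1 + t \<le> ?N\<^sup>2 * (1 - t)"
    using t by (simp only: mult_le_cancel_right)
  then have lower: "(1 + t) / (1 - t) \<le> ?N\<^sup>2"
    using t by (simp add: divide_le_eq)
  have "?N \<le> sqrt ((1 + t) / (1 - t))"
  proof (subst poisson_le_iff_kernel_ratio[OF zb, symmetric])
    show "0 \<le> sqrt ((1 + t) / (1 - t))"
      using t by simp
    show "\<forall>y. poisson ?w y y \<le> (sqrt ((1 + t) / (1 - t)))\<^sup>2 * poisson ?z y y"
    proof
      fix y
      define x where "x = capply (resolvent ?z) y"
      have y: "y = x - capply (R_scalar z) x"
        using resolvent_unfold[OF zb, of y] by (simp add: x_def algebra_simps)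
      have "norm (x - capply S x) \<le> (1 + t) * norm x"
        using norm_triangle_ineq4[of x "capply S x"] by (simp add: iso algebra_simps)
      then have "(norm (x - capply S x))\<^sup>2 \<le> (1 + t)\<^sup>2 * (norm x)\<^sup>2"
        unfolding power_mult_distrib[symmetric] by (intro power_mono) auto
      then have "(1 - (norm z)\<^sup>2) * (norm (x - capply S x))\<^sup>2 \<le> (1 - (norm z)\<^sup>2) * ((1 + t)\<^sup>2 * (norm x)\<^sup>2)"
        using z1 by (intro mult_left_mono) auto
      then have "poisson ?w y y * (1 - t\<^sup>2) \<le> (1 + t)\<^sup>2 * poisson ?z y y"
        unfolding y P Pz by (simp add: mult_ac)
      then have "poisson ?w y y \<le> (1 + t)\<^sup>2 * poisson ?z y y / (1 - t\<^sup>2)"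
        using t2 by (simp add: pos_le_divide_eq)
      also have "\<dots> = (1 + t) / (1 - t) * poisson ?z y y"
        unfolding tt using t by (simp add: power2_eq_square)
      also have "\<dots> = (sqrt ((1 + t) / (1 - t)))\<^sup>2 * poisson ?z y y"
        using t by simp
      finally show "poisson ?w y y \<le> (sqrt ((1 + t) / (1 - t)))\<^sup>2 * poisson ?z y y" .
    qed
  qed
  then have "?N\<^sup>2 \<le> (sqrt ((1 + t) / (1 - t)))\<^sup>2"
    by (intro power_mono) auto
  then show ?thesis
    using lower t by simp
qed

lemma pseudohyp_scalar_tuple:
  fixes z w :: "complex ^ 'n::finite"
  assumes infinite_dimensional: "\<forall>S :: 'h::chilbert_space set. finite S \<longrightarrow> cspan S \<noteq> UNIV"
    and z: "norm z < 1" and w: "norm w < 1"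
  shows "pseudohyp (scalar_tuple z :: ('h, 'n) optuple) (scalar_tuple w) = norm (ball_involution z w)"
proof -
  let ?z = "scalar_tuple z :: ('h, 'n) optuple" and ?w = "scalar_tuple w :: ('h, 'n) optuple"
  obtain h :: 'h where h: "h \<noteq> 0"
    by (rule infinite_dimensional_imp_nonzero[OF infinite_dimensional])
  define t where "t = norm (ball_involution z w)"
  have t: "0 \<le> t" "t < 1"
    using norm_ball_involution_less_1[OF z w] by (simp_all add: t_def)
  have "(norm (kernel_ratio ?w ?z))\<^sup>2 = (1 + t) / (1 - t)" "(norm (kernel_ratio ?z ?w))\<^sup>2 = (1 + t) / (1 - t)"
    using norm_kernel_ratio_scalar[OF z w h] norm_kernel_ratio_scalar[OF w z h]
    unfolding t_def norm_ball_involution_commute[OF w z] by simp_all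
  then have m: "(mutual_ratio ?z ?w)\<^sup>2 = (1 + t) / (1 - t)"
    by (simp add: mutual_ratio_def max_def)
  have omega: "harnack_omega ?z ?w = mutual_ratio ?z ?w"
    by (rule harnack_omega_eq[OF infinite_dimensional scalar_tuple_in_op_ball[OF z] scalar_tuple_in_op_ball[OF w]])
  have "(1 + t) / (1 - t) - 1 = 2 * t / (1 - t)" "(1 + t) / (1 - t) + 1 = 2 / (1 - t)"
    using t by (simp_all add: field_simps)
  then show ?thesis
    unfolding pseudohyp_def omega m t_def[symmetric] using t by simp
qed

section \<open>Comparison of topologies\<close>

text \<open>Through \<open>poisson_eq\<close> this is the resolvent identity
  \<open>(I - R\<^sub>X)\<^sup>-\<^sup>1 - (I - R\<^sub>Y)\<^sup>-\<^sup>1 = (I - R\<^sub>X)\<^sup>-\<^sup>1 R\<^sub>X\<^sub>-\<^sub>Y (I - R\<^sub>Y)\<^sup>-\<^sup>1\<close>.\<close>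

lemma poisson_difference_le:
  assumes X: "X \<in> op_ball" and Y: "Y \<in> op_ball"
  shows "\<bar>poisson X x x - poisson Y x x\<bar> \<le>
    2 * (row_norm (X - Y) / ((1 - row_norm X) * (1 - row_norm Y))) * (norm x)\<^sup>2"
proof -
  let ?u = "capply (resolvent X) x" and ?v = "capply (resolvent Y) x"
  have r: "row_norm X < 1" "row_norm Y < 1"
    using X Y by (simp_all add: op_ball_def)
  have eq: "capply (resolvent X) (capply (reconstruction (X - Y)) ?v) = ?u - ?v"
  proof (rule resolvent_eqI[OF X])
    have "capply (reconstruction X) ?u = ?u - x"
      using resolvent_unfold[OF X, of x] by (simp add: algebra_simps)
    moreover have "capply (reconstruction Y) ?v = ?v - x"
      using resolvent_unfold[OF Y, of x] by (simp add: algebra_simps)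
    ultimately show "?u - ?v = capply (reconstruction (X - Y)) ?v + capply (reconstruction X) (?u - ?v)"
      by (simp add: reconstruction_diff)
  qed
  have "norm (?u - ?v) \<le> norm (resolvent X) * norm (capply (reconstruction (X - Y)) ?v)"
    unfolding eq[symmetric] by (rule norm_capply_le)
  also have "\<dots> \<le> norm (resolvent X) * (row_norm (X - Y) * norm ?v)"
    unfolding norm_reconstruction[symmetric] by (intro mult_left_mono norm_capply_le norm_ge_zero)
  also have "\<dots> \<le> norm (resolvent X) * (row_norm (X - Y) * (norm (resolvent Y) * norm x))"
    by (intro mult_left_mono norm_capply_le norm_ge_zero row_norm_nonneg)
  also have "\<dots> \<le> 1 / (1 - row_norm X) * (row_norm (X - Y) * (1 / (1 - row_norm Y) * norm x))"
    using r by (intro mult_mono norm_resolvent X Y mult_right_mono mult_left_mono mult_nonneg_nonneg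
        row_norm_nonneg norm_ge_zero) auto
  finally have n: "norm (?u - ?v) \<le> row_norm (X - Y) / ((1 - row_norm X) * (1 - row_norm Y)) * norm x"
    by simp
  have "poisson X x x - poisson Y x x = 2 * ((?u - ?v) \<bullet> x)"
    unfolding poisson_eq[OF X] poisson_eq[OF Y] by (simp add: inner_diff_left inner_diff_right inner_commute)
  then have "\<bar>poisson X x x - poisson Y x x\<bar> = 2 * \<bar>(?u - ?v) \<bullet> x\<bar>"
    by simp
  also have "\<dots> \<le> 2 * (norm (?u - ?v) * norm x)"
    using Cauchy_Schwarz_ineq2[of "?u - ?v" x] by simp
  also have "\<dots> \<le> 2 * (row_norm (X - Y) / ((1 - row_norm X) * (1 - row_norm Y)) * norm x * norm x)"
    by (intro mult_left_mono mult_right_mono n norm_ge_zero) simp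
  finally show ?thesis
    by (simp add: power2_eq_square mult.assoc)
qed

text \<open>With \<open>u = (I - R\<^sub>X)\<^sup>-\<^sup>1 x\<close> and \<open>r = \<parallel>R\<^sub>X\<parallel>\<close>, the form is \<open>\<parallel>u\<parallel>\<^sup>2 - \<parallel>R\<^sub>X u\<parallel>\<^sup>2 \<ge> (1 - r\<^sup>2) \<parallel>u\<parallel>\<^sup>2\<close>, and
  \<open>\<parallel>x\<parallel> \<le> (1 + r) \<parallel>u\<parallel>\<close>.\<close>

lemma poisson_lower_bound:
  assumes X: "X \<in> op_ball"
  shows "(1 - row_norm X) * (norm x)\<^sup>2 \<le> 2 * poisson X x x"
proof -
  let ?u = "capply (resolvent X) x" and ?r = "row_norm X"
  have r: "0 \<le> ?r" "?r < 1"
    using X by (simp_all add: op_ball_def row_norm_nonneg)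
  have R: "norm (capply (reconstruction X) ?u) \<le> ?r * norm ?u"
    unfolding norm_reconstruction[symmetric] by (rule norm_capply_le)
  have "x = ?u - capply (reconstruction X) ?u"
    using resolvent_unfold[OF X, of x] by (simp add: algebra_simps)
  then have "norm x \<le> norm ?u + norm (capply (reconstruction X) ?u)"
    by (metis norm_triangle_ineq4)
  also have "\<dots> \<le> (1 + ?r) * norm ?u"
    using R by (simp add: algebra_simps)
  finally have "(norm x)\<^sup>2 \<le> ((1 + ?r) * norm ?u)\<^sup>2"
    by (intro power_mono) auto
  also have "\<dots> = (1 + ?r) * ((1 + ?r) * (norm ?u)\<^sup>2)"
    by (simp add: power_mult_distrib) (simp add: power2_eq_square)
  also have "\<dots> \<le> 2 * ((1 + ?r) * (norm ?u)\<^sup>2)"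
    using r by (intro mult_right_mono) auto
  finally have "(1 - ?r) * (norm x)\<^sup>2 \<le> (1 - ?r) * (2 * ((1 + ?r) * (norm ?u)\<^sup>2))"
    using r by (intro mult_left_mono) auto
  also have "\<dots> = 2 * ((norm ?u)\<^sup>2 - (?r * norm ?u)\<^sup>2)"
    by (simp add: power_mult_distrib) (simp add: power2_eq_square algebra_simps)
  also have "\<dots> \<le> 2 * ((norm ?u)\<^sup>2 - (norm (capply (reconstruction X) ?u))\<^sup>2)"
    using power_mono[OF R, of 2] by simp
  also have "\<dots> = 2 * poisson X x x"
    unfolding poisson_defect[OF X] by (simp add: power2_norm_eq_inner)
  finally show ?thesis .
qed

text \<open>Within distance \<open>s\<close> of \<open>X\<close> both tuples stay at distance at least \<open>s\<close> from the boundary of the ball,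
  so the bounds for the difference and for the size of the Poisson forms are uniform in \<open>Y\<close>.\<close>

lemma pseudohyp_le_row_norm:
  fixes X Y :: "('h::chilbert_space, 'n::finite) optuple"
  assumes infinite_dimensional: "\<forall>S :: 'h set. finite S \<longrightarrow> cspan S \<noteq> UNIV"
    and X: "X \<in> op_ball" and Y: "Y \<in> op_ball"
  defines "s \<equiv> (1 - row_norm X) / 2"
  assumes near: "row_norm (X - Y) \<le> s"
  shows "pseudohyp X Y \<le> 2 * row_norm (X - Y) / s ^ 3"
proof -
  let ?d = "row_norm (X - Y)" and ?m = "mutual_ratio X Y"
  define e where "e = 2 * ?d / s ^ 3"
  have s: "0 < s"
    using X by (simp add: s_def op_ball_def)
  have d: "0 \<le> ?d"
    by (rule row_norm_nonneg)
  have e: "0 \<le> e"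
    using s d by (simp add: e_def)
  have "row_norm Y \<le> row_norm X + ?d"
    using norm_triangle_ineq4[of "reconstruction X" "reconstruction X - reconstruction Y"]
    by (simp add: norm_reconstruction[symmetric] reconstruction_diff)
  then have Ys: "s \<le> 1 - row_norm Y"
    using near unfolding s_def by argo
  have "?d / ((1 - row_norm X) * (1 - row_norm Y)) \<le> ?d / ((2 * s) * s)"
    using s d Ys by (intro divide_left_mono mult_mono mult_pos_pos) (auto simp: s_def)
  also have "2 * \<dots> = e * s / 2"
    using s by (simp add: e_def power3_eq_cube)
  finally have bound: "2 * (?d / ((1 - row_norm X) * (1 - row_norm Y))) \<le> e * s / 2"
    by simp
  have diff: "\<bar>poisson X x x - poisson Y x x\<bar> \<le> e * (s / 2 * (norm x)\<^sup>2)" for x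
    using poisson_difference_le[OF X Y, of x] mult_right_mono[OF bound, of "(norm x)\<^sup>2"]
    by (simp add: mult.assoc)
  have low: "s / 2 * (norm x)\<^sup>2 \<le> poisson Z x x" if Z: "Z \<in> op_ball" "s \<le> 1 - row_norm Z"
    for x and Z :: "('h, 'n) optuple"
    using poisson_lower_bound[OF Z(1), of x] mult_right_mono[OF Z(2), of "(norm x)\<^sup>2"] by simp
  have Xs: "s \<le> 1 - row_norm X"
    using s by (simp add: s_def)
  have *: "poisson X x x \<le> (sqrt (1 + e))\<^sup>2 * poisson Y x x"
    "poisson Y x x \<le> (sqrt (1 + e))\<^sup>2 * poisson X x x" for x
  proof -
    have "(sqrt (1 + e))\<^sup>2 = 1 + e"
      using e by simp
    then show "poisson X x x \<le> (sqrt (1 + e))\<^sup>2 * poisson Y x x"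
      "poisson Y x x \<le> (sqrt (1 + e))\<^sup>2 * poisson X x x"
      using diff[of x] mult_left_mono[OF low[OF X Xs, of x] e] mult_left_mono[OF low[OF Y Ys, of x] e]
      unfolding distrib_right abs_le_iff by (simp_all add: distrib_right)
  qed
  have "?m \<le> sqrt (1 + e)"
    using poisson_le_iff_kernel_ratio[OF Y, of "sqrt (1 + e)" X]
      poisson_le_iff_kernel_ratio[OF X, of "sqrt (1 + e)" Y] * e
    by (simp add: mutual_ratio_def)
  then have "?m\<^sup>2 \<le> (sqrt (1 + e))\<^sup>2"
    using mutual_ratio_ge_1[OF infinite_dimensional X Y] by (intro power_mono) auto
  then have me: "?m\<^sup>2 - 1 \<le> e"
    using e by simp
  have m1: "1 \<le> ?m\<^sup>2"
    using mutual_ratio_ge_1[OF infinite_dimensional X Y] by simp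
  have "(?m\<^sup>2 - 1) / (?m\<^sup>2 + 1) \<le> (?m\<^sup>2 - 1) / 1"
    using m1 by (intro divide_left_mono) auto
  with me show ?thesis
    by (simp add: pseudohyp_def harnack_omega_eq[OF infinite_dimensional X Y] e_def)
qed

text \<open>\<open>\<omega>\<^sup>2 - 1 = d (\<omega>\<^sup>2 + 1)\<close>, and \<open>\<omega>\<^sup>2 + 1 \<le> 4\<close> when \<open>d \<le> 1/2\<close>.\<close>

lemma row_norm_le_pseudohyp:
  fixes X Y :: "('h::chilbert_space, 'n::finite) optuple"
  assumes infinite_dimensional: "\<forall>S :: 'h set. finite S \<longrightarrow> cspan S \<noteq> UNIV"
    and X: "X \<in> op_ball" and Y: "Y \<in> op_ball" and near: "pseudohyp X Y \<le> 1 / 2"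
  shows "row_norm (X - Y) \<le> 4 * pseudohyp X Y * (norm (kernel_C X))\<^sup>2"
proof -
  let ?m = "mutual_ratio X Y" and ?d = "pseudohyp X Y"
  have m: "1 \<le> ?m"
    by (rule mutual_ratio_ge_1[OF infinite_dimensional X Y])
  have pos: "0 < ?m\<^sup>2 + 1"
    by (simp add: add_nonneg_pos)
  have "?m\<^sup>2 - 1 = ?d * (?m\<^sup>2 + 1)"
    using pos by (simp add: pseudohyp_def harnack_omega_eq[OF infinite_dimensional X Y])
  moreover have "?d * (?m\<^sup>2 + 1) \<le> 1 / 2 * (?m\<^sup>2 + 1)"
    using near pos by (intro mult_right_mono) auto
  ultimately have "?m\<^sup>2 + 1 \<le> 4"
    by argo
  then have "?d * (?m\<^sup>2 + 1) \<le> ?d * 4"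
    by (intro mult_left_mono pseudohyp_nonneg)
  then have "(?m\<^sup>2 - 1) * (norm (kernel_C X))\<^sup>2 \<le> 4 * ?d * (norm (kernel_C X))\<^sup>2"
    using \<open>?m\<^sup>2 - 1 = _\<close> by (intro mult_right_mono) auto
  with row_norm_diff_le[OF X Y m] show ?thesis
    by linarith
qed

lemma openin_mtopology_mono:
  assumes d: "Metric_space M d" and d': "Metric_space M d'"
    and cont: "\<And>x e. x \<in> M \<Longrightarrow> 0 < e \<Longrightarrow> \<exists>r>0. \<forall>y\<in>M. d x y < r \<longrightarrow> d' x y < e"
    and U: "openin (Metric_space.mtopology M d') U"
  shows "openin (Metric_space.mtopology M d) U"
  unfolding Metric_space.openin_mtopology[OF d]
proof (intro conjI allI impI)
  show "U \<subseteq> M"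
    using U unfolding Metric_space.openin_mtopology[OF d'] by blast
  fix x assume x: "x \<in> U"
  then obtain e where e: "0 < e" "Metric_space.mball M d' x e \<subseteq> U"
    using U unfolding Metric_space.openin_mtopology[OF d'] by blast
  have xM: "x \<in> M"
    using x \<open>U \<subseteq> M\<close> by blast
  then obtain r where r: "0 < r" "\<And>y. y \<in> M \<Longrightarrow> d x y < r \<Longrightarrow> d' x y < e"
    using cont[OF _ e(1)] by blast
  have "Metric_space.mball M d x r \<subseteq> Metric_space.mball M d' x e"
    using r(2) by (auto simp: Metric_space.in_mball[OF d] Metric_space.in_mball[OF d'])
  then show "\<exists>r>0. Metric_space.mball M d x r \<subseteq> U"
    using r(1) e(2) by blast
qed

lemma mtopology_pseudohyp:
  assumes infinite_dimensional: "\<forall>S :: 'h::chilbert_space set. finite S \<longrightarrow> cspan S \<noteq> UNIV"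
  shows "Metric_space.mtopology (op_ball :: ('h, 'n::finite) optuple set) pseudohyp =
    Metric_space.mtopology op_ball (\<lambda>X Y. row_norm (X - Y))"
proof (rule topology_eq[THEN iffD2], intro allI iffI)
  fix U :: "('h, 'n) optuple set"
  note metrics = pseudohyp_metric[OF infinite_dimensional] row_norm_metric
  show "openin (Metric_space.mtopology op_ball (\<lambda>X Y. row_norm (X - Y))) U"
    if "openin (Metric_space.mtopology op_ball pseudohyp) U"
  proof (rule openin_mtopology_mono[OF metrics(2,1) _ that])
    fix X :: "('h, 'n) optuple" and e :: real
    assume X: "X \<in> op_ball" and e: "0 < e"
    define s where "s = (1 - row_norm X) / 2"
    have s: "0 < s"
      using X by (simp add: s_def op_ball_def)
    have "pseudohyp X Y < e" if "Y \<in> op_ball" "row_norm (X - Y) < min s (e * s ^ 3 / 2)" for Y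
    proof -
      have "pseudohyp X Y \<le> 2 * row_norm (X - Y) / s ^ 3"
        unfolding s_def
        by (rule pseudohyp_le_row_norm[OF infinite_dimensional X that(1)])
          (use that(2) in \<open>simp add: s_def\<close>)
      also have "\<dots> < e"
        using that(2) s by (simp add: pos_divide_less_eq)
      finally show ?thesis .
    qed
    then show "\<exists>r>0. \<forall>Y\<in>op_ball. row_norm (X - Y) < r \<longrightarrow> pseudohyp X Y < e"
      using s e by (intro exI[of _ "min s (e * s ^ 3 / 2)"]) auto
  qed
  show "openin (Metric_space.mtopology op_ball pseudohyp) U"
    if "openin (Metric_space.mtopology op_ball (\<lambda>X Y. row_norm (X - Y))) U"
  proof (rule openin_mtopology_mono[OF metrics _ that])
    fix X :: "('h, 'n) optuple" and e :: real
    assume X: "X \<in> op_ball" and e: "0 < e"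
    define K where "K = 4 * (norm (kernel_C X))\<^sup>2 + 1"
    have K: "0 < K"
      by (simp add: K_def add_nonneg_pos)
    have "row_norm (X - Y) < e" if "Y \<in> op_ball" "pseudohyp X Y < min (1 / 2) (e / K)" for Y
    proof -
      have "row_norm (X - Y) \<le> 4 * pseudohyp X Y * (norm (kernel_C X))\<^sup>2"
        by (rule row_norm_le_pseudohyp[OF infinite_dimensional X that(1)]) (use that(2) in simp)
      also have "\<dots> \<le> pseudohyp X Y * K"
        using pseudohyp_nonneg[of X Y] by (simp add: K_def algebra_simps)
      also have "\<dots> < e"
        using that(2) K by (simp add: pos_less_divide_eq)
      finally show ?thesis .
    qed
    then show "\<exists>r>0. \<forall>Y\<in>op_ball. pseudohyp X Y < r \<longrightarrow> row_norm (X - Y) < e"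
      using K e by (intro exI[of _ "min (1 / 2) (e / K)"]) auto
  qed
qed

theorem theorem9p2:
  assumes separable: "\<exists>D :: 'h::chilbert_space set. countable D \<and> closure D = UNIV"
    and infinite_dimensional: "\<forall>S :: 'h set. finite S \<longrightarrow> cspan S \<noteq> UNIV"
  shows
    "(\<forall>X \<in> (op_ball :: ('h, 'n::finite) optuple set). \<forall>Y \<in> op_ball. harnack_equivalent X Y) \<and>
     Metric_space (op_ball :: ('h, 'n) optuple set) pseudohyp \<and>
     (\<forall>X \<in> (op_ball :: ('h, 'n) optuple set). \<forall>Y \<in> op_ball.
        pseudohyp X Y = tanh (hyp_delta X Y)) \<and>
     (\<forall>z \<in> (ball 0 1 :: (complex ^ 'n) set). \<forall>w \<in> ball 0 1.
        pseudohyp (scalar_tuple z :: ('h, 'n) optuple) (scalar_tuple w) =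
          norm (ball_involution z w)) \<and>
     Metric_space.mtopology (op_ball :: ('h, 'n) optuple set) pseudohyp =
       Metric_space.mtopology op_ball (\<lambda>X Y. row_norm (X - Y)) \<and>
     (\<forall>X \<in> (op_ball :: ('h, 'n) optuple set). \<forall>Y \<in> op_ball.
        pseudohyp X Y =
          (max (norm (kernel_Gamma X Y)) (norm (cinverse (kernel_Gamma X Y))) - 1) /
          (max (norm (kernel_Gamma X Y)) (norm (cinverse (kernel_Gamma X Y))) + 1))"
proof (intro conjI ballI)
  show "Metric_space (op_ball :: ('h, 'n) optuple set) pseudohyp"
    by (rule pseudohyp_metric[OF infinite_dimensional])
  show "Metric_space.mtopology (op_ball :: ('h, 'n) optuple set) pseudohyp =
      Metric_space.mtopology op_ball (\<lambda>X Y. row_norm (X - Y))"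
    by (rule mtopology_pseudohyp[OF infinite_dimensional])
next
  fix z w :: "complex ^ 'n"
  assume "z \<in> ball 0 1" "w \<in> ball 0 1"
  then show "pseudohyp (scalar_tuple z :: ('h, 'n) optuple) (scalar_tuple w) = norm (ball_involution z w)"
    by (intro pseudohyp_scalar_tuple[OF infinite_dimensional]) simp_all
next
  fix X Y :: "('h, 'n) optuple"
  assume XY: "X \<in> op_ball" "Y \<in> op_ball"
  show "harnack_equivalent X Y"
    by (rule harnack_equivalent_op_ball[OF infinite_dimensional XY])
  show "pseudohyp X Y = tanh (hyp_delta X Y)"
    unfolding pseudohyp_def hyp_delta_def
    using harnack_omega_ge_1[of X Y] by (subst tanh_ln_real) auto
  show "pseudohyp X Y =
      (max (norm (kernel_Gamma X Y)) (norm (cinverse (kernel_Gamma X Y))) - 1) /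
      (max (norm (kernel_Gamma X Y)) (norm (cinverse (kernel_Gamma X Y))) + 1)"
    unfolding max_norm_kernel_Gamma[OF XY] pseudohyp_def harnack_omega_eq[OF infinite_dimensional XY] ..
qed

end
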